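(* Let $M = D_X u$ be a left $D_X$-module generated by $u$ and $I = \mathrm{Ann}_{D_X}u$ the annihilator of $u$, so that $M = D_X/I$. Let $f\in K[x]$ be a nonzero polynomial and let $\iota : M \rightarrow M[f^{-1}]$ be the canonical homomorphism, which sends $u\in M$ to $u\otimes 1$. Let $G$ be a finite set of generators of $I$, and let $J$ be the left ideal of $D_Y$ generated by $\{\tau(P) \mid P \in G\}$ and $tf-1$. Then (1) $J$ coincides with the annihilator $\mathrm{Ann}_{D_Y}(\delta\otimes \iota(u))$ of $\delta\otimes\iota(u)$ in $B_{Z|Y}[f^{-1}]\otimes_{K[x,f^{-1}]}M[f^{-1}]$. (2) $B_{Z|Y}[f^{-1}]\otimes_{K[x,f^{-1}]}M[f^{-1}]$ is generated by $\delta\otimes\iota(u)$ as a left $D_Y$-module. (3) As a left $D_Y$-module, $B_{Z|Y}\otimes_{K[x]}M$ is isomorphic to $D_Y/J$.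
   Context: $K$ is a field of characteristic zero, $K[x]=K[x_1,\dots,x_n]$, $X=K^n$, $D_X$ is the $n$-th Weyl algebra in $x$; $t$ is a new variable, $Y=X\times K$ with coordinates $(x,t)$, and $D_Y$ is the Weyl algebra in $(x,t)$. Put $f_i=\partial f/\partial x_i$ and $Z=\{(x,t)\in Y\mid tf(x)=1\}$. Let $B_{Z|Y}=H^1_{(tf-1)}(K[x,t])=K[x,t,(tf-1)^{-1}]/K[x,t]$, a left $D_Y$-module, and let $B_{Z|Y}[f^{-1}]=B_{Z|Y}\otimes_{K[x]}K[x,f^{-1}]=K[x,t,f^{-1},(tf-1)^{-1}]/K[x,t,f^{-1}]$. Let $\delta\in B_{Z|Y}[f^{-1}]$ be the residue class of $f/(tf-1)$. $M[f^{-1}]=M\otimes_{K[x]}K[x,f^{-1}]$ is a left $D_X$-module via the Leibniz rule. On $B_{Z|Y}\otimes_{K[x]}M$ and $B_{Z|Y}[f^{-1}]\otimes_{K[x,f^{-1}]}M[f^{-1}]$ the left $D_Y$-module structure is: $t,\partial_t$ act on the first factor and $\partial_{x_i}$ acts by the Leibniz rule. Define $\vartheta_i=\partial_{x_i}-f_i\partial_tt^2\in D_Y$ ($i=1,\dots,n$); these commute with each other and $[\vartheta_i,x_j]=\delta_{ij}$, so there is a ring homomorphism $\tau:D_X\to D_Y$, $\tau(P(x,\partial_x))=P(x,\vartheta_1,\dots,\vartheta_n)$. *)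

theory Defs
  imports
    "HOL-Algebra.Free_Abelian_Groups"
    "HOL-Algebra.QuotRing"
    "HOL-Algebra.Module"
    "HOL-Computational_Algebra.Fraction_Field"
begin

abbreviation "single \<equiv> Poly_Mapping.single"
abbreviation "lookup \<equiv> Poly_Mapping.lookup"
abbreviation "keys \<equiv> Poly_Mapping.keys"

section \<open>Polynomials and rational functions\<close>

text \<open>
  Variables are indexed by natural numbers; a power product is a finitely supported exponent
  function.  Polynomials in the first \<open>n\<close> variables form a subring of the polynomials in all
  variables, so that \<open>K[x\<^sub>1,\<dots>,x\<^sub>n]\<close> uses the variables with index \<open>0,\<dots>,n - 1\<close>, and in
  \<open>K[x,t]\<close> the new variable \<open>t\<close> is the one with index \<open>n\<close>.
\<close>

type_synonym 'k mpol = "(nat \<Rightarrow>\<^sub>0 nat) \<Rightarrow>\<^sub>0 'k"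
type_synonym 'k ratfun = "'k mpol fract"

definition pvar :: "nat \<Rightarrow> 'k::field mpol" where
  "pvar i = single (single i 1) 1"

definition pdiff :: "nat \<Rightarrow> 'k::field mpol \<Rightarrow> 'k mpol" where
  "pdiff i p = (\<Sum>m\<in>keys p.
     single (m - single i 1) (of_nat (lookup m i) * lookup p m))"

lemma lookup_pdiff: "lookup (pdiff i p) m = of_nat (Suc (lookup m i)) * lookup p (m + single i 1)"
proof -
  let ?e = "single i (1::nat)"
  have *: "m' = m + ?e" if "m' - ?e = m" "lookup m' i \<noteq> 0" for m'
  proof (rule poly_mapping_eqI)
    fix j show "lookup m' j = lookup (m + ?e) j"
      using that by (auto simp: lookup_add lookup_minus lookup_single when_def)
  qed
  have **: "lookup (single (m' - ?e) (of_nat (lookup m' i) * lookup p m')) m =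
      (if m' = m + ?e then of_nat (lookup m' i) * lookup p m' else 0)" for m'
  proof (cases "lookup m' i = 0")
    case False
    then have "m' - ?e = m \<longleftrightarrow> m' = m + ?e" using *[of m'] by fastforce
    then show ?thesis by (simp add: lookup_single when_def)
  qed (simp only: of_nat_0 mult_zero_left single_zero lookup_zero if_cancel)
  have "lookup (pdiff i p) m = (\<Sum>m'\<in>keys p. if m' = m + ?e then of_nat (lookup m' i) * lookup p m' else 0)"
    by (simp only: pdiff_def lookup_sum **)
  also have "\<dots> = of_nat (lookup (m + ?e) i) * lookup p (m + ?e)"
    by (simp add: sum.delta not_in_keys_iff_lookup_eq_zero)
  also have "\<dots> = of_nat (Suc (lookup m i)) * lookup p (m + ?e)"
    by (simp add: lookup_add)
  finally show ?thesis .
qed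

lemma pdiff_zero [simp]: "pdiff i 0 = 0"
  by (simp add: pdiff_def)

lemma pdiff_one [simp]: "pdiff i 1 = 0"
  by (simp add: pdiff_def)

lemma pdiff_add: "pdiff i (p + q) = pdiff i p + pdiff i q"
  by (rule poly_mapping_eqI) (simp add: lookup_pdiff lookup_add algebra_simps)

lemma pdiff_minus: "pdiff i (- p) = - pdiff i p"
  by (rule poly_mapping_eqI) (simp add: lookup_pdiff)

lemma pdiff_single: "pdiff i (single m a) = single (m - single i 1) (of_nat (lookup m i) * a)"
  by (simp add: pdiff_def)

lemma sum_single: "p = (\<Sum>m\<in>keys p. single m (lookup p m))"
  by (rule poly_mapping_eqI) (simp add: lookup_sum lookup_single when_def sum.delta not_in_keys_iff_lookup_eq_zero)

lemma pdiff_sum: "pdiff i (sum g A) = (\<Sum>x\<in>A. pdiff i (g x))"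
  by (induction A rule: infinite_finite_induct) (auto simp: pdiff_add)

lemma pdiff_mult: "pdiff i (p * q) = pdiff i p * q + p * pdiff i q"
proof -
  let ?e = "single i (1::nat)"
  have e1: "lookup m i * c \<noteq> 0 \<Longrightarrow> m - ?e + m' = m + m' - ?e" for m m' :: "nat \<Rightarrow>\<^sub>0 nat" and c
    by (rule poly_mapping_eqI) (auto simp: lookup_add lookup_minus lookup_single when_def)
  have e1': "lookup m i \<noteq> 0 \<Longrightarrow> m - ?e + m' = m + m' - ?e" for m m' :: "nat \<Rightarrow>\<^sub>0 nat"
    using e1[of m 1] by simp
  have e2: "m' + (m - ?e) = m' + m - ?e" if "lookup m i \<noteq> 0" for m m' :: "nat \<Rightarrow>\<^sub>0 nat"
    using e1'[OF that, of m'] by (simp add: add.commute)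
  have s: "pdiff i (single m a * single m' b) =
     pdiff i (single m a) * single m' b +
     single m a * pdiff i (single m' b)" for m m' and a b :: 'a
  proof -
    have 1: "pdiff i (single m a) * single m' b =
        single (m + m' - ?e) (of_nat (lookup m i) * a * b)"
      using e1'[of m m'] by (cases "lookup m i = 0") (auto simp: pdiff_single mult_single)
    have 2: "single m a * pdiff i (single m' b) =
        single (m + m' - ?e) (of_nat (lookup m' i) * a * b)"
      using e2[of m' m] by (cases "lookup m' i = 0") (auto simp: pdiff_single mult_single algebra_simps)
    show ?thesis unfolding 1 2
      by (simp add: mult_single pdiff_single lookup_add algebra_simps flip: single_add)
  qed
  have s2: "pdiff i (single m a * q) =
     pdiff i (single m a) * q + single m a * pdiff i q" for m and a :: 'a
    by (subst (1 2 3) sum_single[of q]) (simp only: sum_distrib_left pdiff_sum s sum.distrib)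
  show ?thesis
    by (subst (1 2 3) sum_single[of p]) (simp only: sum_distrib_right pdiff_sum s2 sum.distrib)
qed

definition pols :: "nat \<Rightarrow> 'k::field mpol set" where
  "pols n = {p. \<forall>m\<in>keys p. keys m \<subseteq> {..<n}}"

definition pol_ring :: "nat \<Rightarrow> 'k::field mpol ring" where
  "pol_ring n = \<lparr>carrier = pols n, mult = (*), one = 1, zero = 0, add = (+)\<rparr>"

subsection \<open>Derivations on the field of rational functions\<close>

lemma Fract_pdiff_cong:
  fixes a b c d :: "'k::field mpol"
  assumes "b \<noteq> 0" "d \<noteq> 0" "a * d = c * b"
  shows "(pdiff i a * b - a * pdiff i b) * (d * d) = (pdiff i c * d - c * pdiff i d) * (b * b)"
proof -
  have e: "pdiff i a * d = pdiff i c * b + c * pdiff i b - a * pdiff i d"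
    using arg_cong[OF assms(3), of "pdiff i"] by (simp add: pdiff_mult algebra_simps)
  have "(pdiff i a * b - a * pdiff i b) * (d * d) =
      (pdiff i a * d) * (b * d) - (a * d) * (pdiff i b * d)"
    by (simp add: algebra_simps)
  also have "\<dots> = (pdiff i c * b + c * pdiff i b) * (b * d) - (a * d) * (b * pdiff i d) - (a * d) * (pdiff i b * d)"
    unfolding e by (simp add: algebra_simps)
  also have "\<dots> = (pdiff i c * d - c * pdiff i d) * (b * b)"
    unfolding assms(3) by (simp add: algebra_simps)
  finally show ?thesis .
qed

lift_definition rdiff :: "nat \<Rightarrow> 'k::field ratfun \<Rightarrow> 'k ratfun"
  is "\<lambda>i (a, b). (pdiff i a * b - a * pdiff i b, b * b)"
proof -
  fix i :: nat and x y :: "'k mpol \<times> 'k mpol"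
  assume xy: "fractrel x y"
  obtain a b c d where x: "x = (a, b)" and y: "y = (c, d)" by (metis surj_pair)
  have "b \<noteq> 0" "d \<noteq> 0" "a * d = c * b" using xy by (auto simp: x y)
  from this Fract_pdiff_cong[OF this, of i]
  show "fractrel (case x of (a, b) \<Rightarrow> (pdiff i a * b - a * pdiff i b, b * b))
      (case y of (a, b) \<Rightarrow> (pdiff i a * b - a * pdiff i b, b * b))"
    by (simp only: x y fractrel_iff prod.case fst_conv snd_conv mult_eq_0_iff not_False_eq_True simp_thms)
qed

lemma rdiff_Fract:
  assumes "b \<noteq> 0"
  shows "rdiff i (Fraction_Field.Fract a b) =
    Fraction_Field.Fract (pdiff i a * b - a * pdiff i b) (b * b)"
proof -
  have 1: "Fraction_Field.Fract a b = abs_fract (a, b)"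
    using assms by (simp add: Fraction_Field.Fract.abs_eq)
  show ?thesis unfolding 1 using assms
    by (subst rdiff.abs_eq) (simp_all only: Fraction_Field.Fract.abs_eq eq_onp_def fractrel_iff
      prod.case fst_conv snd_conv mult_eq_0_iff simp_thms if_False)
qed

definition localization :: "nat \<Rightarrow> 'k::field mpol set \<Rightarrow> 'k ratfun set" where
  "localization n S = {Fraction_Field.Fract p s |p s. p \<in> pols n \<and> s \<in> S}"

section \<open>Weyl algebras\<close>

text \<open>
  An element \<open>P\<close> of a Weyl algebra is stored in normal form: \<open>lookup P \<beta>\<close> is the
  polynomial coefficient \<open>P\<^sub>\<beta>\<close> in \<open>P = \<Sum>\<^sub>\<beta> P\<^sub>\<beta> \<partial>\<^sup>\<beta>\<close>.
\<close>

type_synonym 'k weyl = "(nat \<Rightarrow>\<^sub>0 nat) \<Rightarrow>\<^sub>0 'k mpol"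

text \<open>
  \<open>op_power d \<beta>\<close> is \<open>d\<^sub>0\<^sup>\<beta>\<^sup>0 d\<^sub>1\<^sup>\<beta>\<^sup>1 \<dots>\<close>; it is only used for operators \<open>d\<^sub>i\<close> which commute with each
  other on the structure in question, so that the order of the factors is irrelevant.
\<close>

definition op_power :: "(nat \<Rightarrow> 'v \<Rightarrow> 'v) \<Rightarrow> (nat \<Rightarrow>\<^sub>0 nat) \<Rightarrow> 'v \<Rightarrow> 'v" where
  "op_power d \<beta> v = foldr (\<lambda>i. d i ^^ lookup \<beta> i) (sorted_list_of_set (keys \<beta>)) v"

text \<open>
  \<open>normal_act s d P v = \<Sum>\<^sub>\<beta> P\<^sub>\<beta> \<partial>\<^sup>\<beta> v\<close>, where polynomials act through \<open>s\<close> and \<open>\<partial>\<^sub>i\<close> acts as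
  \<open>d i\<close>.
\<close>

definition normal_act ::
    "('k::field mpol \<Rightarrow> 'v \<Rightarrow> 'v) \<Rightarrow> (nat \<Rightarrow> 'v \<Rightarrow> 'v) \<Rightarrow> 'k weyl \<Rightarrow> 'v \<Rightarrow> 'v::comm_monoid_add" where
  "normal_act s d P v = (\<Sum>\<beta>\<in>keys P. s (lookup P \<beta>) (op_power d \<beta> v))"

definition weyl_pol :: "'k::field mpol \<Rightarrow> 'k weyl" where
  "weyl_pol p = single 0 p"

definition weyl_del :: "nat \<Rightarrow> 'k::field weyl" where
  "weyl_del i = single (single i 1) 1"

text \<open>Left multiplication by a polynomial, and left multiplication by \<open>\<partial>\<^sub>i\<close>, according to
  \<open>\<partial>\<^sub>i q \<partial>\<^sup>\<gamma> = q \<partial>\<^sub>i \<partial>\<^sup>\<gamma> + (\<partial>q/\<partial>x\<^sub>i) \<partial>\<^sup>\<gamma>\<close>.\<close>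

definition pol_lmult :: "'k::field mpol \<Rightarrow> 'k weyl \<Rightarrow> 'k weyl" where
  "pol_lmult p Q = (\<Sum>\<gamma>\<in>keys Q. single \<gamma> (p * lookup Q \<gamma>))"

definition del_lmult :: "nat \<Rightarrow> 'k::field weyl \<Rightarrow> 'k weyl" where
  "del_lmult i Q = (\<Sum>\<gamma>\<in>keys Q. single (\<gamma> + single i 1) (lookup Q \<gamma>) + single \<gamma> (pdiff i (lookup Q \<gamma>)))"

definition weyl_mult :: "'k::field weyl \<Rightarrow> 'k weyl \<Rightarrow> 'k weyl" where
  "weyl_mult = normal_act pol_lmult del_lmult"

definition weyl_algebra :: "nat \<Rightarrow> 'k::field weyl ring" where
  "weyl_algebra n = \<lparr>carrier = {P. \<forall>\<beta>\<in>keys P. keys \<beta> \<subseteq> {..<n} \<and> lookup P \<beta> \<in> pols n},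
     mult = weyl_mult, one = 1, zero = 0, add = (+)\<rparr>"

subsection \<open>Ring axioms and the Weyl relations\<close>

lemma keys_sum_add:
  fixes g :: "'a \<Rightarrow> 'b::ab_group_add \<Rightarrow> 'c::ab_group_add"
  assumes "\<And>k a b. g k (a + b) = g k a + g k b"
  shows "(\<Sum>k\<in>keys (P + Q). g k (lookup (P + Q) k)) =
    (\<Sum>k\<in>keys P. g k (lookup P k)) + (\<Sum>k\<in>keys Q. g k (lookup Q k))"
proof -
  have z: "g k 0 = 0" for k using assms[of k 0 0] by simp
  let ?S = "keys P \<union> keys Q"
  have *: "(\<Sum>k\<in>keys R. g k (lookup R k)) = (\<Sum>k\<in>?S. g k (lookup R k))" if "keys R \<subseteq> ?S" for R
    using that by (intro sum.mono_neutral_left) (auto simp: not_in_keys_iff_lookup_eq_zero z)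
  have "(\<Sum>k\<in>keys (P + Q). g k (lookup (P + Q) k)) = (\<Sum>k\<in>?S. g k (lookup (P + Q) k))"
    by (rule *) (rule keys_add)
  also have "\<dots> = (\<Sum>k\<in>?S. g k (lookup P k)) + (\<Sum>k\<in>?S. g k (lookup Q k))"
    by (simp add: lookup_add assms sum.distrib)
  finally show ?thesis using *[of P] *[of Q] by simp
qed

lemma additive_sum:
  fixes H :: "'b::ab_group_add \<Rightarrow> 'c::ab_group_add"
  assumes "\<And>P Q. H (P + Q) = H P + H Q"
  shows "H (\<Sum>k\<in>S. X k) = (\<Sum>k\<in>S. H (X k))"
proof -
  have "H 0 = 0" using assms[of 0 0] by simp
  then show ?thesis by (induction S rule: infinite_finite_induct) (simp_all add: assms)
qed

lemma additive_extend:
  fixes F G :: "('a \<Rightarrow>\<^sub>0 'b::ab_group_add) \<Rightarrow> 'c::ab_group_add"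
  assumes F: "\<And>P Q. F (P + Q) = F P + F Q" and G: "\<And>P Q. G (P + Q) = G P + G Q"
    and s: "\<And>k a. F (single k a) = G (single k a)"
  shows "F P = G P"
proof -
  have e: "P = (\<Sum>m\<in>keys P. single m (lookup P m))"
    by (rule poly_mapping_eqI) (simp add: lookup_sum lookup_single when_def sum.delta not_in_keys_iff_lookup_eq_zero)
  show ?thesis by (subst (1 2) e) (simp only: additive_sum[of F, OF F] additive_sum[of G, OF G] s)
qed

lemma pdiff_commute: "pdiff i (pdiff j p) = pdiff j (pdiff i p)"
proof (rule poly_mapping_eqI)
  fix m
  show "lookup (pdiff i (pdiff j p)) m = lookup (pdiff j (pdiff i p)) m"
  proof (cases "i = j")
    case False
    have 1: "lookup (pdiff i' (pdiff j' p)) m =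
        of_nat (Suc (lookup m i')) * (of_nat (Suc (lookup m j')) * lookup p (m + single i' 1 + single j' 1))"
      if "i' \<noteq> j'" for i' j'
      by (simp only: lookup_pdiff lookup_add lookup_single_not_eq[OF that] add_0_right)
    have c: "m + single i 1 + single j 1 = m + single j 1 + single i (1::nat)" by (simp only: ac_simps)
    show ?thesis unfolding 1[OF False] 1[OF not_sym[OF False]] c by (rule mult.left_commute)
  qed simp
qed

lemma pol_lmult_single [simp]: "pol_lmult p (single \<gamma> q) = single \<gamma> (p * q)"
  by (simp add: pol_lmult_def)

lemma pol_lmult_add_right: "pol_lmult p (Q + R) = pol_lmult p Q + pol_lmult p R"
  unfolding pol_lmult_def by (rule keys_sum_add) (simp add: distrib_left single_add)

lemma pol_lmult_add_left: "pol_lmult (p + q) Q = pol_lmult p Q + pol_lmult q Q"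
  by (simp add: pol_lmult_def distrib_right single_add sum.distrib)

lemma del_lmult_single [simp]:
  "del_lmult i (single \<gamma> q) = single (\<gamma> + single i 1) q + single \<gamma> (pdiff i q)"
  by (simp add: del_lmult_def)

lemma del_lmult_add: "del_lmult i (Q + R) = del_lmult i Q + del_lmult i R"
  unfolding del_lmult_def
  by (rule keys_sum_add) (simp add: single_add pdiff_add)

lemma pol_lmult_mult: "pol_lmult p (pol_lmult q Q) = pol_lmult (p * q) Q"
  by (rule additive_extend[where P = Q and F = "\<lambda>Q. pol_lmult p (pol_lmult q Q)" and G = "pol_lmult (p * q)"]) (simp_all add: pol_lmult_add_right mult.assoc)

lemma pol_lmult_1: "pol_lmult 1 Q = Q"
  by (rule additive_extend[where P = Q and F = "pol_lmult 1" and G = "\<lambda>Q. Q"]) (simp_all add: pol_lmult_add_right)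

lemma del_pol_lmult:
  "del_lmult i (pol_lmult q S) = pol_lmult q (del_lmult i S) + pol_lmult (pdiff i q) S"
  by (rule additive_extend[where P = S and F = "\<lambda>S. del_lmult i (pol_lmult q S)"
      and G = "\<lambda>S. pol_lmult q (del_lmult i S) + pol_lmult (pdiff i q) S"])
     (simp_all add: pol_lmult_add_right del_lmult_add pdiff_mult single_add add_ac)

lemma del_lmult_commute: "del_lmult i (del_lmult j S) = del_lmult j (del_lmult i S)"
  by (rule additive_extend[where P = S and F = "\<lambda>S. del_lmult i (del_lmult j S)" and G = "\<lambda>S. del_lmult j (del_lmult i S)"])
     (simp_all add: del_lmult_add pdiff_commute[of i j] ac_simps)

lemma op_power_closed:
  assumes "\<And>i v. i \<in> keys \<beta> \<Longrightarrow> v \<in> C \<Longrightarrow> d i v \<in> C" "v \<in> C"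
  shows "op_power d \<beta> v \<in> C"
proof -
  have p: "(d i ^^ k) w \<in> C" if "i \<in> keys \<beta>" "w \<in> C" for i k w
    using that by (induction k) (auto simp: assms)
  have "foldr (\<lambda>i. d i ^^ lookup \<beta> i) xs v \<in> C" if "set xs \<subseteq> keys \<beta>" for xs
    using that by (induction xs) (auto simp: assms p)
  then show ?thesis by (simp add: op_power_def)
qed

lemma op_power_hom:
  assumes "\<And>i v. h (d i v) = d' i (h v)"
  shows "h (op_power d \<beta> v) = op_power d' \<beta> (h v)"
proof -
  have p: "h ((d i ^^ k) w) = (d' i ^^ k) (h w)" for i k w
    by (induction k) (auto simp: assms)
  have "h (foldr (\<lambda>i. d i ^^ lookup \<beta> i) xs v) = foldr (\<lambda>i. d' i ^^ lookup \<beta> i) xs (h v)" for xs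
    by (induction xs) (auto simp: p)
  then show ?thesis by (simp add: op_power_def)
qed

lemma op_power_add:
  assumes "\<And>i v w. d i (v + w) = d i v + d i w"
  shows "op_power d \<beta> (v + w) = op_power d \<beta> v + op_power d \<beta> (w :: 'v::ab_group_add)"
proof -
  have p: "(d i ^^ k) (v + w) = (d i ^^ k) v + (d i ^^ k) w" for i k v w
    by (induction k) (auto simp: assms)
  have "foldr (\<lambda>i. d i ^^ lookup \<beta> i) xs (v + w) =
      foldr (\<lambda>i. d i ^^ lookup \<beta> i) xs v + foldr (\<lambda>i. d i ^^ lookup \<beta> i) xs w" for xs
    by (induction xs) (auto simp: p)
  then show ?thesis by (simp add: op_power_def)
qed

lemma op_power_0 [simp]: "op_power d 0 v = v"
  by (simp add: op_power_def)

lemma op_power_Suc: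
  assumes "\<And>i j v. d i (d j v) = d j (d i v)"
  shows "op_power d (\<beta> + single i 1) v = d i (op_power d \<beta> v)"
proof -
  have c1: "(d i ^^ k) (d j v) = d j ((d i ^^ k) v)" for i j k v
    by (induction k) (auto simp: assms)
  have c2: "(d i ^^ k) ((d j ^^ l) v) = (d j ^^ l) ((d i ^^ k) v)" for i j k l v
    by (induction l) (auto simp: c1)
  have fo: "d j (foldr (\<lambda>i. d i ^^ e i) xs v) = foldr (\<lambda>i. d i ^^ e i) xs (d j v)" for j e xs v
    by (induction xs) (auto simp: c1[symmetric])
  have foo: "(d j ^^ k) (foldr (\<lambda>i. d i ^^ e i) xs v) = foldr (\<lambda>i. d i ^^ e i) xs ((d j ^^ k) v)" for j k e xs v
    by (induction k) (auto simp: fo)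
  have ex: "foldr (\<lambda>i. d i ^^ e i) xs v = (d j ^^ e j) (foldr (\<lambda>i. d i ^^ e i) (remove1 j xs) v)"
    if "distinct xs" "j \<in> set xs" for j e xs v
    using that by (induction xs) (auto simp: c2)
  have perm: "foldr (\<lambda>i. d i ^^ e i) xs v = foldr (\<lambda>i. d i ^^ e i) ys v"
    if "distinct xs" "distinct ys" "\<And>j. e j \<noteq> 0 \<Longrightarrow> j \<in> set xs \<longleftrightarrow> j \<in> set ys" for e xs ys v
    using that
  proof (induction xs arbitrary: ys)
    case Nil
    then have "\<forall>j\<in>set ys. e j = 0" by auto
    then have "foldr (\<lambda>i. d i ^^ e i) ys v = v" by (induction ys) auto
    then show ?case by simp
  next
    case (Cons x xs)
    show ?case
    proof (cases "e x = 0")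
      case True
      have "foldr (\<lambda>i. d i ^^ e i) xs v = foldr (\<lambda>i. d i ^^ e i) ys v"
      proof (rule Cons.IH)
        fix j assume "e j \<noteq> 0"
        then show "j \<in> set xs \<longleftrightarrow> j \<in> set ys" using Cons.prems(3)[of j] True by auto
      qed (use Cons.prems in auto)
      then show ?thesis using True by simp
    next
      case False
      then have x: "x \<in> set ys" using Cons.prems(3)[of x] by simp
      have "foldr (\<lambda>i. d i ^^ e i) xs v = foldr (\<lambda>i. d i ^^ e i) (remove1 x ys) v"
        by (rule Cons.IH) (use Cons.prems in \<open>auto\<close>)
      then show ?thesis by (simp add: ex[OF Cons.prems(2) x])
    qed
  qed
  let ?b = "\<beta> + single i 1"
  define xs where "xs = sorted_list_of_set (insert i (keys \<beta>))"
  have xs: "distinct xs" "set xs = insert i (keys \<beta>)"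
    unfolding xs_def by (rule distinct_sorted_list_of_set) (rule set_sorted_list_of_set, simp)
  have k: "lookup ?b j = (if j = i then Suc (lookup \<beta> j) else lookup \<beta> j)" for j
    by (simp add: lookup_add lookup_single)
  have i: "i \<in> set xs" by (simp add: xs)
  have "op_power d ?b v = foldr (\<lambda>j. d j ^^ lookup ?b j) xs v"
    unfolding op_power_def
  proof (rule perm)
    fix j assume j: "lookup ?b j \<noteq> 0"
    then have "j \<in> keys ?b" by (simp only: in_keys_iff not_False_eq_True)
    moreover have "j = i \<or> j \<in> keys \<beta>" using j unfolding k by (auto simp: in_keys_iff split: if_splits)
    ultimately show "j \<in> set (sorted_list_of_set (keys ?b)) \<longleftrightarrow> j \<in> set xs" by (auto simp: xs)
  qed (simp_all add: xs)
  also have "\<dots> = (d i ^^ Suc (lookup \<beta> i)) (foldr (\<lambda>j. d j ^^ lookup ?b j) (remove1 i xs) v)"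
    by (subst ex[OF _ i]) (simp_all add: k[unfolded One_nat_def] xs)
  also have "foldr (\<lambda>j. d j ^^ lookup ?b j) (remove1 i xs) v = foldr (\<lambda>j. d j ^^ lookup \<beta> j) (remove1 i xs) v"
    by (rule foldr_cong) (auto simp: k[unfolded One_nat_def] xs)
  also have "(d i ^^ Suc (lookup \<beta> i)) \<dots> = d i (foldr (\<lambda>j. d j ^^ lookup \<beta> j) xs v)"
    by (simp add: ex[OF xs(1) i])
  also have "foldr (\<lambda>j. d j ^^ lookup \<beta> j) xs v = op_power d \<beta> v"
    unfolding op_power_def by (rule perm) (auto simp: xs in_keys_iff)
  finally show ?thesis .
qed

lemmas op_power_del_Suc = op_power_Suc[where d = del_lmult, OF del_lmult_commute]

lemma normal_act_single: "(\<And>v. s 0 v = 0) \<Longrightarrow> normal_act s d (single \<beta> p) v = s p (op_power d \<beta> v)"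
  by (simp add: normal_act_def)

lemma normal_act_add_left:
  fixes v :: "'v::ab_group_add"
  assumes "\<And>p q v. s (p + q) v = s p v + s q v"
  shows "normal_act s d (P + Q) v = normal_act s d P v + normal_act s d Q v"
  unfolding normal_act_def by (rule keys_sum_add) (rule assms)

lemma normal_act_add_right:
  fixes v :: "'v::ab_group_add"
  assumes "\<And>p v w. s p (v + w) = s p v + s p w" "\<And>i v w. d i (v + w) = d i v + d i w"
  shows "normal_act s d P (v + w) = normal_act s d P v + normal_act s d P w"
  by (simp add: normal_act_def assms op_power_add[of d] sum.distrib)

lemma weyl_mult_add_left: "weyl_mult (P + Q) R = weyl_mult P R + weyl_mult Q R"
  unfolding weyl_mult_def by (rule normal_act_add_left) (rule pol_lmult_add_left)

lemma weyl_mult_add_right: "weyl_mult P (Q + R) = weyl_mult P Q + weyl_mult P R"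
  unfolding weyl_mult_def by (rule normal_act_add_right) (rule pol_lmult_add_right del_lmult_add)+

lemma pol_lmult_zero [simp]: "pol_lmult 0 Q = 0"
  by (simp add: pol_lmult_def)

lemma weyl_mult_single: "weyl_mult (single \<beta> p) Q = pol_lmult p (op_power del_lmult \<beta> Q)"
  unfolding weyl_mult_def by (rule normal_act_single) simp

lemma weyl_mult_pol_lmult: "weyl_mult (pol_lmult p Q) R = pol_lmult p (weyl_mult Q R)"
  by (rule additive_extend[where P = Q and F = "\<lambda>Q. weyl_mult (pol_lmult p Q) R" and G = "\<lambda>Q. pol_lmult p (weyl_mult Q R)"])
     (simp_all add: pol_lmult_add_right weyl_mult_add_left weyl_mult_single pol_lmult_mult)

lemma weyl_mult_del_lmult: "weyl_mult (del_lmult i Q) R = del_lmult i (weyl_mult Q R)"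
  by (rule additive_extend[where P = Q and F = "\<lambda>Q. weyl_mult (del_lmult i Q) R" and G = "\<lambda>Q. del_lmult i (weyl_mult Q R)"])
     (simp_all add: del_lmult_add weyl_mult_add_left weyl_mult_single del_pol_lmult
        op_power_del_Suc[unfolded One_nat_def])

lemma weyl_mult_0_left: "weyl_mult 0 R = 0"
  by (simp add: weyl_mult_def normal_act_def)

lemma weyl_mult_assoc: "weyl_mult (weyl_mult P Q) R = weyl_mult P (weyl_mult Q R)"
proof -
  have "weyl_mult (op_power del_lmult \<beta> Q) R = op_power del_lmult \<beta> (weyl_mult Q R)" for \<beta>
    by (rule op_power_hom[where h = "\<lambda>Q. weyl_mult Q R"]) (rule weyl_mult_del_lmult)
  then show ?thesis
    by (intro additive_extend[where P = P and F = "\<lambda>P. weyl_mult (weyl_mult P Q) R" and G = "\<lambda>P. weyl_mult P (weyl_mult Q R)"])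
       (simp_all add: weyl_mult_add_left weyl_mult_single weyl_mult_pol_lmult)
qed

lemma op_power_del_1: "op_power del_lmult \<beta> 1 = (single \<beta> 1 :: 'k::field weyl)"
proof (induction "\<Sum>i\<in>keys \<beta>. lookup \<beta> i" arbitrary: \<beta> rule: less_induct)
  case less
  show ?case
  proof (cases "\<beta> = 0")
    case False
    then obtain i where i: "lookup \<beta> i \<noteq> 0" by (metis lookup_zero poly_mapping_eqI)
    define \<gamma> where "\<gamma> = \<beta> - single i 1"
    have b: "\<beta> = \<gamma> + single i 1"
      by (rule poly_mapping_eqI) (use i in \<open>auto simp: \<gamma>_def lookup_add lookup_minus lookup_single when_def\<close>)
    have *: "(\<Sum>i\<in>keys \<alpha>. lookup \<alpha> i) = (\<Sum>i\<in>keys \<alpha>. id (lookup \<alpha> i))" for \<alpha> :: "nat \<Rightarrow>\<^sub>0 nat" by simp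
    have kb: "keys \<gamma> \<subseteq> keys \<beta>" by (auto simp: b in_keys_iff lookup_add simp del: lookup_not_eq_zero_eq_in_keys)
    have "(\<Sum>i\<in>keys \<gamma>. lookup \<gamma> i) = (\<Sum>i\<in>keys \<beta>. lookup \<gamma> i)"
      by (rule sum.mono_neutral_left) (use kb in \<open>auto simp: not_in_keys_iff_lookup_eq_zero\<close>)
    also have "\<dots> < (\<Sum>i\<in>keys \<beta>. lookup \<beta> i)"
      by (rule sum_strict_mono_ex1) (use i in \<open>auto simp: b lookup_add lookup_not_eq_zero_eq_in_keys[symmetric] intro!: bexI[of _ i]\<close>)
    finally have "op_power del_lmult \<gamma> 1 = (single \<gamma> 1 :: 'k weyl)" by (rule less)
    then show ?thesis unfolding b by (simp add: op_power_del_Suc[unfolded One_nat_def])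
  qed simp
qed

lemma weyl_mult_1_right: "weyl_mult P 1 = P"
  by (rule additive_extend[where P = P and F = "\<lambda>P. weyl_mult P 1" and G = "\<lambda>P. P"])
     (simp_all add: weyl_mult_add_left weyl_mult_single op_power_del_1)

lemma weyl_mult_1_left: "weyl_mult 1 P = P"
  using weyl_mult_single[of 0 1 P] by (simp add: pol_lmult_1)



lemma pols_zero: "0 \<in> pols n" and pols_one: "1 \<in> pols n"
  by (auto simp: pols_def)

lemma pols_add: "p \<in> pols n \<Longrightarrow> q \<in> pols n \<Longrightarrow> p + q \<in> pols n"
  unfolding pols_def using keys_add[of p q] by blast

lemma pols_minus: "p \<in> pols n \<Longrightarrow> - p \<in> pols n"
  by (simp add: pols_def)

lemma pols_mult:
  assumes "p \<in> pols n" "q \<in> pols n" shows "p * q \<in> pols n"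
proof -
  have "keys m \<subseteq> {..<n}" if "m \<in> keys (p * q)" for m
  proof -
    have "m \<in> {a + b |a b. a \<in> keys p \<and> b \<in> keys q}" using that keys_mult[of p q] by (rule rev_subsetD)
    then obtain a b where "m = a + b" "a \<in> keys p" "b \<in> keys q" by blast
    then show ?thesis using assms keys_add[of a b] unfolding pols_def by blast
  qed
  then show ?thesis by (simp add: pols_def)
qed

lemma pols_pdiff: "p \<in> pols n \<Longrightarrow> pdiff i p \<in> pols n"
proof -
  assume p: "p \<in> pols n"
  have "keys m \<subseteq> {..<n}" if "m \<in> keys (pdiff i p)" for m
  proof -
    have "lookup p (m + single i 1) \<noteq> 0" using that by (auto simp: lookup_pdiff simp flip: lookup_not_eq_zero_eq_in_keys)
    then have "keys (m + single i 1) \<subseteq> {..<n}" using p by (simp add: pols_def in_keys_iff)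
    moreover have "keys m \<subseteq> keys (m + single i 1)" by (auto simp: lookup_add simp flip: lookup_not_eq_zero_eq_in_keys)
    ultimately show ?thesis by blast
  qed
  then show ?thesis by (simp add: pols_def)
qed

lemma weyl_carrier_add:
  fixes P Q :: "'k::field weyl"
  assumes "P \<in> carrier (weyl_algebra n)" "Q \<in> carrier (weyl_algebra n)"
  shows "P + Q \<in> carrier (weyl_algebra n)"
proof -
  have l: "lookup R \<beta> \<in> pols n" if "R \<in> carrier (weyl_algebra n)" for R :: "'k weyl" and \<beta>
    using that by (cases "\<beta> \<in> keys R") (auto simp: weyl_algebra_def not_in_keys_iff_lookup_eq_zero pols_zero)
  show ?thesis
    using assms keys_add[of P Q] pols_add[OF l[OF assms(1)] l[OF assms(2)]]
    by (auto simp: weyl_algebra_def lookup_add)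
qed

lemma weyl_carrier_zero: "0 \<in> carrier (weyl_algebra n)"
  by (simp add: weyl_algebra_def)

lemma weyl_carrier_single:
  "keys \<beta> \<subseteq> {..<n} \<Longrightarrow> p \<in> pols n \<Longrightarrow> single \<beta> p \<in> carrier (weyl_algebra n)"
  by (cases "p = 0") (auto simp: weyl_algebra_def)

lemma weyl_carrier_sum:
  "(\<And>x. x \<in> S \<Longrightarrow> X x \<in> carrier (weyl_algebra n)) \<Longrightarrow> sum X S \<in> carrier (weyl_algebra n)"
  by (induction S rule: infinite_finite_induct) (auto simp: weyl_carrier_zero weyl_carrier_add)

lemma weyl_carrierD:
  "P \<in> carrier (weyl_algebra n) \<Longrightarrow> \<beta> \<in> keys P \<Longrightarrow> keys \<beta> \<subseteq> {..<n}"
  "P \<in> carrier (weyl_algebra n) \<Longrightarrow> \<beta> \<in> keys P \<Longrightarrow> lookup P \<beta> \<in> pols n"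
  by (auto simp: weyl_algebra_def)

lemma weyl_carrier_mult:
  assumes P: "P \<in> carrier (weyl_algebra n)" and Q: "Q \<in> carrier (weyl_algebra n)"
  shows "weyl_mult P Q \<in> carrier (weyl_algebra n)"
proof -
  have p: "pol_lmult p R \<in> carrier (weyl_algebra n)" if "p \<in> pols n" "R \<in> carrier (weyl_algebra n)" for p R
    unfolding pol_lmult_def
    by (intro weyl_carrier_sum weyl_carrier_single pols_mult weyl_carrierD[OF that(2)] that)
  have k: "keys (\<gamma> + single i 1) \<subseteq> {..<n}" if "keys \<gamma> \<subseteq> {..<n}" "i < n" for \<gamma> :: "nat \<Rightarrow>\<^sub>0 nat" and i
    using that keys_add[of \<gamma> "single i 1"] by auto
  have d: "del_lmult i R \<in> carrier (weyl_algebra n)" if "i < n" "R \<in> carrier (weyl_algebra n)" for i R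
    unfolding del_lmult_def
    by (intro weyl_carrier_sum weyl_carrier_add weyl_carrier_single pols_pdiff k weyl_carrierD[OF that(2)] that)
  show ?thesis
    unfolding weyl_mult_def normal_act_def
    by (intro weyl_carrier_sum p weyl_carrierD[OF P] op_power_closed[OF d] Q) (use weyl_carrierD(1)[OF P] in auto)
qed

lemma weyl_algebra_simps:
  "mult (weyl_algebra n) = weyl_mult" "one (weyl_algebra n) = 1"
  "zero (weyl_algebra n) = 0" "add (weyl_algebra n) = (+)"
  by (simp_all add: weyl_algebra_def)

lemma ring_weyl_algebra: "ring (weyl_algebra n :: 'k::field weyl ring)"
proof (rule ringI)
  show "abelian_group (weyl_algebra n :: 'k weyl ring)"
  proof (rule abelian_groupI)
    fix P :: "'k weyl" assume "P \<in> carrier (weyl_algebra n)"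
    then have "- P \<in> carrier (weyl_algebra n)" by (auto simp: weyl_algebra_def pols_minus)
    then show "\<exists>Q\<in>carrier (weyl_algebra n). Q \<oplus>\<^bsub>weyl_algebra n\<^esub> P = \<zero>\<^bsub>weyl_algebra n\<^esub>"
      by (intro bexI[of _ "- P"]) (simp add: weyl_algebra_def)
  qed (simp_all add: weyl_algebra_simps weyl_carrier_add weyl_carrier_zero add_ac)
  show "Group.monoid (weyl_algebra n :: 'k weyl ring)"
  proof (rule monoidI)
    show "\<one>\<^bsub>weyl_algebra n\<^esub> \<in> carrier (weyl_algebra n :: 'k weyl ring)"
      by (auto simp: weyl_algebra_def pols_one)
  qed (simp_all add: weyl_algebra_simps weyl_carrier_mult weyl_mult_assoc weyl_mult_1_left weyl_mult_1_right)
qed (simp_all add: weyl_algebra_def weyl_mult_add_left weyl_mult_add_right)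

lemma weyl_relations:
  fixes p q :: "'k::field mpol"
  shows
  "weyl_mult (weyl_pol p) (weyl_pol q) = weyl_pol (p * q)"
  "weyl_mult (weyl_del i) (weyl_del j :: 'k weyl) = weyl_mult (weyl_del j) (weyl_del i)"
  "weyl_mult (weyl_del i) (weyl_pol p) = weyl_mult (weyl_pol p) (weyl_del i) + weyl_pol (pdiff i p)"
proof -
  have d: "weyl_mult (weyl_del i) Q = del_lmult i Q" for i and Q :: "'k weyl"
    using op_power_del_Suc[of 0 i Q] by (simp add: weyl_del_def weyl_mult_single pol_lmult_1)
  have p: "weyl_mult (weyl_pol p) Q = pol_lmult p Q" for p and Q :: "'k weyl"
    by (simp add: weyl_pol_def weyl_mult_single)
  show "weyl_mult (weyl_pol p) (weyl_pol q) = weyl_pol (p * q)"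
    by (simp add: p) (simp add: weyl_pol_def)
  show "weyl_mult (weyl_del i) (weyl_del j :: 'k weyl) = weyl_mult (weyl_del j) (weyl_del i)"
    by (simp add: d) (simp add: weyl_del_def add.commute)
  show "weyl_mult (weyl_del i) (weyl_pol p) = weyl_mult (weyl_pol p) (weyl_del i) + weyl_pol (pdiff i p)"
    by (simp add: d p) (simp add: weyl_pol_def weyl_del_def)
qed

section \<open>Left modules\<close>

text \<open>As \<^locale>\<open>module\<close>, but over a ring that need not be commutative.\<close>

locale left_module = R?: ring R + M?: abelian_group M for R (structure) and M (structure) +
  assumes smult_closed: "\<lbrakk>a \<in> carrier R; x \<in> carrier M\<rbrakk> \<Longrightarrow> a \<odot>\<^bsub>M\<^esub> x \<in> carrier M"
    and smult_l_distr: "\<lbrakk>a \<in> carrier R; b \<in> carrier R; x \<in> carrier M\<rbrakk> \<Longrightarrow>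
      (a \<oplus> b) \<odot>\<^bsub>M\<^esub> x = a \<odot>\<^bsub>M\<^esub> x \<oplus>\<^bsub>M\<^esub> b \<odot>\<^bsub>M\<^esub> x"
    and smult_r_distr: "\<lbrakk>a \<in> carrier R; x \<in> carrier M; y \<in> carrier M\<rbrakk> \<Longrightarrow>
      a \<odot>\<^bsub>M\<^esub> (x \<oplus>\<^bsub>M\<^esub> y) = a \<odot>\<^bsub>M\<^esub> x \<oplus>\<^bsub>M\<^esub> a \<odot>\<^bsub>M\<^esub> y"
    and smult_assoc: "\<lbrakk>a \<in> carrier R; b \<in> carrier R; x \<in> carrier M\<rbrakk> \<Longrightarrow>
      (a \<otimes> b) \<odot>\<^bsub>M\<^esub> x = a \<odot>\<^bsub>M\<^esub> (b \<odot>\<^bsub>M\<^esub> x)"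
    and smult_one: "x \<in> carrier M \<Longrightarrow> \<one> \<odot>\<^bsub>M\<^esub> x = x"

locale left_ideal = additive_subgroup I R + ring R for I and R (structure) +
  assumes I_l_closed: "\<lbrakk>a \<in> I; x \<in> carrier R\<rbrakk> \<Longrightarrow> x \<otimes> a \<in> I"

definition gen_left_ideal :: "('r, 'x) ring_scheme \<Rightarrow> 'r set \<Rightarrow> 'r set" where
  "gen_left_ideal R S = \<Inter>{I. left_ideal I R \<and> S \<subseteq> I}"

definition annihilator :: "('r, 'x) ring_scheme \<Rightarrow> ('r, 'm, 'y) module_scheme \<Rightarrow> 'm \<Rightarrow> 'r set" where
  "annihilator R M u = {a \<in> carrier R. a \<odot>\<^bsub>M\<^esub> u = \<zero>\<^bsub>M\<^esub>}"

definition cyclic_submodule :: "('r, 'x) ring_scheme \<Rightarrow> ('r, 'm, 'y) module_scheme \<Rightarrow> 'm \<Rightarrow> 'm set" where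
  "cyclic_submodule R M u = (\<lambda>a. a \<odot>\<^bsub>M\<^esub> u) ` carrier R"

definition left_module_iso ::
    "('r, 'x) ring_scheme \<Rightarrow> ('r, 'm, 'y) module_scheme \<Rightarrow> ('r, 'n, 'z) module_scheme \<Rightarrow> ('m \<Rightarrow> 'n) set" where
  "left_module_iso R M N = {\<phi>. bij_betw \<phi> (carrier M) (carrier N) \<and>
     (\<forall>x\<in>carrier M. \<forall>y\<in>carrier M. \<phi> (x \<oplus>\<^bsub>M\<^esub> y) = \<phi> x \<oplus>\<^bsub>N\<^esub> \<phi> y) \<and>
     (\<forall>a\<in>carrier R. \<forall>x\<in>carrier M. \<phi> (a \<odot>\<^bsub>M\<^esub> x) = a \<odot>\<^bsub>N\<^esub> \<phi> x)}"

text \<open>In the module records below, the ring multiplication and unit play no role.\<close>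

definition quot_module :: "('r, 'm, 'y) module_scheme \<Rightarrow> 'm set \<Rightarrow> ('r, 'm set) module" where
  "quot_module M N = \<lparr>carrier = a_rcosets\<^bsub>M\<^esub> N, mult = undefined, one = undefined,
     zero = N, add = set_add M, smult = (\<lambda>a C. \<Union>x\<in>C. N +>\<^bsub>M\<^esub> (a \<odot>\<^bsub>M\<^esub> x))\<rparr>"

definition regular_module :: "('r, 'x) ring_scheme \<Rightarrow> ('r, 'r) module" where
  "regular_module R = \<lparr>carrier = carrier R, mult = mult R, one = one R, zero = zero R, add = add R,
     smult = mult R\<rparr>"

definition restrict_scalars :: "('s \<Rightarrow> 'r) \<Rightarrow> ('r, 'm, 'y) module_scheme \<Rightarrow> ('s, 'm) module" where
  "restrict_scalars h M = \<lparr>carrier = carrier M, mult = mult M, one = one M, zero = zero M,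
     add = add M, smult = (\<lambda>a. smult M (h a))\<rparr>"

section \<open>Tensor products over a commutative ring\<close>

text \<open>
  The tensor product of \<open>A\<close> and \<open>B\<close> over \<open>R\<close> is the free abelian group on
  \<open>carrier A \<times> carrier B\<close> modulo the subgroup of bilinearity relations.
\<close>

definition tensor_relations ::
    "('r, 'x) ring_scheme \<Rightarrow> ('r, 'a, 'y) module_scheme \<Rightarrow> ('r, 'b, 'z) module_scheme \<Rightarrow> ('a \<times> 'b \<Rightarrow>\<^sub>0 int) set" where
  "tensor_relations R A B = generate (free_Abelian_group (carrier A \<times> carrier B))
    ({frag_of (a \<oplus>\<^bsub>A\<^esub> a', b) - frag_of (a, b) - frag_of (a', b) |a a' b.
        a \<in> carrier A \<and> a' \<in> carrier A \<and> b \<in> carrier B} \<union>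
     {frag_of (a, b \<oplus>\<^bsub>B\<^esub> b') - frag_of (a, b) - frag_of (a, b') |a b b'.
        a \<in> carrier A \<and> b \<in> carrier B \<and> b' \<in> carrier B} \<union>
     {frag_of (r \<odot>\<^bsub>A\<^esub> a, b) - frag_of (a, r \<odot>\<^bsub>B\<^esub> b) |r a b.
        r \<in> carrier R \<and> a \<in> carrier A \<and> b \<in> carrier B})"

text \<open>
  \<open>act\<close> gives the scalar action on representatives; it is required to preserve
  \<open>tensor_relations R A B\<close>.
\<close>

definition free_pairs ::
    "('r, 'a, 'y) module_scheme \<Rightarrow> ('r, 'b, 'z) module_scheme \<Rightarrow>
     ('s \<Rightarrow> ('a \<times> 'b \<Rightarrow>\<^sub>0 int) \<Rightarrow> ('a \<times> 'b \<Rightarrow>\<^sub>0 int)) \<Rightarrow> ('s, 'a \<times> 'b \<Rightarrow>\<^sub>0 int) module" where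
  "free_pairs A B act = \<lparr>carrier = carrier (free_Abelian_group (carrier A \<times> carrier B)),
     mult = undefined, one = undefined, zero = 0, add = (+), smult = act\<rparr>"

definition tensor_module ::
    "('r, 'x) ring_scheme \<Rightarrow> ('r, 'a, 'y) module_scheme \<Rightarrow> ('r, 'b, 'z) module_scheme \<Rightarrow>
     ('s \<Rightarrow> ('a \<times> 'b \<Rightarrow>\<^sub>0 int) \<Rightarrow> ('a \<times> 'b \<Rightarrow>\<^sub>0 int)) \<Rightarrow> ('s, ('a \<times> 'b \<Rightarrow>\<^sub>0 int) set) module" where
  "tensor_module R A B act = quot_module (free_pairs A B act) (tensor_relations R A B)"

definition pure_tensor ::
    "('r, 'x) ring_scheme \<Rightarrow> ('r, 'a, 'y) module_scheme \<Rightarrow> ('r, 'b, 'z) module_scheme \<Rightarrow>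
     'a \<Rightarrow> 'b \<Rightarrow> ('a \<times> 'b \<Rightarrow>\<^sub>0 int) set" where
  "pure_tensor R A B a b = {z + frag_of (a, b) |z. z \<in> tensor_relations R A B}"

definition snd_act :: "('r, 'b, 'z) module_scheme \<Rightarrow> 'r \<Rightarrow> ('a \<times> 'b \<Rightarrow>\<^sub>0 int) \<Rightarrow> ('a \<times> 'b \<Rightarrow>\<^sub>0 int)" where
  "snd_act B r = frag_extend (\<lambda>(a, b). frag_of (a, r \<odot>\<^bsub>B\<^esub> b))"

text \<open>
  \<open>A\<close> is a module over a Weyl algebra in at least \<open>n\<close> variables and \<open>B\<close> one over the
  Weyl algebra in the first \<open>n\<close> variables: \<open>\<partial>\<^sub>i\<close> acts by the Leibniz rule if \<open>i < n\<close>, while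
  polynomials and the remaining \<open>\<partial>\<^sub>i\<close> act on the first factor.  The tensor product is taken over a
  ring containing the polynomials in the first \<open>n\<close> variables, so these may act on either factor.
\<close>

definition leibniz_act ::
    "nat \<Rightarrow> ('k::field weyl, 'a, 'y) module_scheme \<Rightarrow> ('k weyl, 'b, 'z) module_scheme \<Rightarrow>
     'k weyl \<Rightarrow> ('a \<times> 'b \<Rightarrow>\<^sub>0 int) \<Rightarrow> ('a \<times> 'b \<Rightarrow>\<^sub>0 int)" where
  "leibniz_act n A B = normal_act
     (\<lambda>p. frag_extend (\<lambda>(a, b). frag_of (weyl_pol p \<odot>\<^bsub>A\<^esub> a, b)))
     (\<lambda>i. frag_extend (\<lambda>(a, b). frag_of (weyl_del i \<odot>\<^bsub>A\<^esub> a, b) +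
        (if i < n then frag_of (a, weyl_del i \<odot>\<^bsub>B\<^esub> b) else 0)))"

section \<open>The modules attached to \<open>f\<close>\<close>

definition ratfun_ring :: "'k::field ratfun set \<Rightarrow> 'k ratfun ring" where
  "ratfun_ring A = \<lparr>carrier = A, mult = (*), one = 1, zero = 0, add = (+)\<rparr>"

definition ratfun_weyl_module :: "'k::field ratfun set \<Rightarrow> ('k weyl, 'k ratfun) module" where
  "ratfun_weyl_module A = \<lparr>carrier = A, mult = (*), one = 1, zero = 0, add = (+),
     smult = normal_act (\<lambda>p q. Fraction_Field.Fract p 1 * q) rdiff\<rparr>"

definition ratfun_mult_module :: "'k::field ratfun set \<Rightarrow> ('k ratfun, 'k ratfun) module" where
  "ratfun_mult_module A = \<lparr>carrier = A, mult = (*), one = 1, zero = 0, add = (+), smult = (*)\<rparr>"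

text \<open>\<open>K[x,f\<^sup>-\<^sup>1]\<close>\<close>

definition loc_f :: "nat \<Rightarrow> 'k::field mpol \<Rightarrow> 'k ratfun set" where
  "loc_f n f = localization n {f ^ j |j. True}"

text \<open>\<open>tf - 1\<close>\<close>

definition tf1 :: "nat \<Rightarrow> 'k::field mpol \<Rightarrow> 'k mpol" where
  "tf1 n f = pvar n * f - 1"

text \<open>\<open>B\<^sub>Z\<^sub>|\<^sub>Y = K[x,t,(tf - 1)\<^sup>-\<^sup>1]/K[x,t]\<close> as a module over the Weyl algebra in \<open>(x,t)\<close>\<close>

definition B_mod :: "nat \<Rightarrow> 'k::field mpol \<Rightarrow> ('k weyl, 'k ratfun set) module" where
  "B_mod n f = quot_module
     (ratfun_weyl_module (localization (Suc n) {tf1 n f ^ k |k. True}))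
     (localization (Suc n) {1})"

text \<open>\<open>K[x,t,f\<^sup>-\<^sup>1,(tf - 1)\<^sup>-\<^sup>1]\<close>\<close>

definition loc_f_tf1 :: "nat \<Rightarrow> 'k::field mpol \<Rightarrow> 'k ratfun set" where
  "loc_f_tf1 n f = localization (Suc n) {f ^ j * tf1 n f ^ k |j k. True}"

text \<open>
  \<open>B\<^sub>Z\<^sub>|\<^sub>Y[f\<^sup>-\<^sup>1] = K[x,t,f\<^sup>-\<^sup>1,(tf - 1)\<^sup>-\<^sup>1]/K[x,t,f\<^sup>-\<^sup>1]\<close>, first as a module over the Weyl algebra in
  \<open>(x,t)\<close>, then as a \<open>K[x,f\<^sup>-\<^sup>1]\<close>-module, on the same underlying group.
\<close>

definition Bf_weyl :: "nat \<Rightarrow> 'k::field mpol \<Rightarrow> ('k weyl, 'k ratfun set) module" where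
  "Bf_weyl n f = quot_module (ratfun_weyl_module (loc_f_tf1 n f)) (loc_f (Suc n) f)"

definition Bf_loc :: "nat \<Rightarrow> 'k::field mpol \<Rightarrow> ('k ratfun, 'k ratfun set) module" where
  "Bf_loc n f = quot_module (ratfun_mult_module (loc_f_tf1 n f)) (loc_f (Suc n) f)"

text \<open>The residue class of \<open>f/(tf - 1)\<close>\<close>

definition delta :: "nat \<Rightarrow> 'k::field mpol \<Rightarrow> 'k ratfun set" where
  "delta n f = loc_f (Suc n) f +>\<^bsub>ratfun_weyl_module (loc_f_tf1 n f)\<^esub> Fraction_Field.Fract f (tf1 n f)"

text \<open>\<open>M[f\<^sup>-\<^sup>1] = M \<otimes> K[x,f\<^sup>-\<^sup>1]\<close> over \<open>K[x]\<close>, with its two module structures\<close>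

abbreviation pol_module :: "('k::field weyl, 'm, 'y) module_scheme \<Rightarrow> ('k mpol, 'm) module" where
  "pol_module M \<equiv> restrict_scalars weyl_pol M"

definition Mf_weyl ::
    "nat \<Rightarrow> 'k::field mpol \<Rightarrow> ('k weyl, 'm) module \<Rightarrow> ('k weyl, ('m \<times> 'k ratfun \<Rightarrow>\<^sub>0 int) set) module" where
  "Mf_weyl n f M = tensor_module (pol_ring n) (pol_module M) (pol_module (ratfun_weyl_module (loc_f n f)))
     (leibniz_act n M (ratfun_weyl_module (loc_f n f)))"

definition Mf_loc ::
    "nat \<Rightarrow> 'k::field mpol \<Rightarrow> ('k weyl, 'm) module \<Rightarrow> ('k ratfun, ('m \<times> 'k ratfun \<Rightarrow>\<^sub>0 int) set) module" where
  "Mf_loc n f M = tensor_module (pol_ring n) (pol_module M) (pol_module (ratfun_weyl_module (loc_f n f)))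
     (snd_act (ratfun_mult_module (loc_f n f)))"

definition iota ::
    "nat \<Rightarrow> 'k::field mpol \<Rightarrow> ('k weyl, 'm) module \<Rightarrow> 'm \<Rightarrow> ('m \<times> 'k ratfun \<Rightarrow>\<^sub>0 int) set" where
  "iota n f M m = pure_tensor (pol_ring n) (pol_module M) (pol_module (ratfun_weyl_module (loc_f n f))) m 1"

text \<open>The \<open>K[x]\<close>- and \<open>K[x,f\<^sup>-\<^sup>1]\<close>-tensor products, as modules over the Weyl algebra in \<open>(x,t)\<close>\<close>

definition B_tensor_M ::
    "nat \<Rightarrow> 'k::field mpol \<Rightarrow> ('k weyl, 'm) module \<Rightarrow> ('k weyl, ('k ratfun set \<times> 'm \<Rightarrow>\<^sub>0 int) set) module" where
  "B_tensor_M n f M = tensor_module (pol_ring n) (pol_module (B_mod n f)) (pol_module M)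
     (leibniz_act n (B_mod n f) M)"

definition Bf_tensor_Mf ::
    "nat \<Rightarrow> 'k::field mpol \<Rightarrow> ('k weyl, 'm) module \<Rightarrow>
     ('k weyl, ('k ratfun set \<times> ('m \<times> 'k ratfun \<Rightarrow>\<^sub>0 int) set \<Rightarrow>\<^sub>0 int) set) module" where
  "Bf_tensor_Mf n f M = tensor_module (ratfun_ring (loc_f n f)) (Bf_loc n f) (Mf_loc n f M)
     (leibniz_act n (Bf_weyl n f) (Mf_weyl n f M))"

definition delta_tensor_iota ::
    "nat \<Rightarrow> 'k::field mpol \<Rightarrow> ('k weyl, 'm) module \<Rightarrow> 'm \<Rightarrow>
     ('k ratfun set \<times> ('m \<times> 'k ratfun \<Rightarrow>\<^sub>0 int) set \<Rightarrow>\<^sub>0 int) set" where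
  "delta_tensor_iota n f M u =
     pure_tensor (ratfun_ring (loc_f n f)) (Bf_loc n f) (Mf_loc n f M) (delta n f) (iota n f M u)"

text \<open>\<open>\<vartheta>\<^sub>i = \<partial>\<^sub>i - f\<^sub>i \<partial>\<^sub>t t\<^sup>2\<close>, and the substitution \<open>\<tau>(P) = P(x, \<vartheta>)\<close>\<close>

definition theta :: "nat \<Rightarrow> 'k::field mpol \<Rightarrow> nat \<Rightarrow> 'k weyl" where
  "theta n f i = weyl_del i -
     weyl_mult (weyl_pol (pdiff i f)) (weyl_mult (weyl_del n) (weyl_pol (pvar n ^ 2)))"

definition tau :: "nat \<Rightarrow> 'k::field mpol \<Rightarrow> 'k weyl \<Rightarrow> 'k weyl" where
  "tau n f P = normal_act (\<lambda>p. weyl_mult (weyl_pol p)) (\<lambda>i. weyl_mult (theta n f i)) P 1"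

definition J_ideal :: "nat \<Rightarrow> 'k::field mpol \<Rightarrow> 'k weyl set \<Rightarrow> 'k weyl set" where
  "J_ideal n f G = gen_left_ideal (weyl_algebra (Suc n)) (tau n f ` G \<union> {weyl_pol (tf1 n f)})"

end

theory Submission
  imports Defs
begin

text \<open>
  Write \<open>N\<close> for either of the two tensor products and \<open>e m = \<delta> \<otimes> m\<close> (respectively
  \<open>\<delta> \<otimes> \<iota>(m)\<close>).  Four facts about the additive map \<open>e\<close> from \<open>M\<close> to \<open>N\<close> determine everything:
  \<^item> \<open>t f - 1\<close> kills \<open>e m\<close>, so on these elements \<open>t\<close> is the inverse of \<open>f\<close>;
  \<^item> \<open>\<theta>\<^sub>i \<delta> = 0\<close>, hence \<open>\<theta>\<^sub>i (e m) = e (\<partial>\<^sub>i m)\<close> and \<open>\<tau>(P) (e m) = e (P m)\<close>;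
  \<^item> \<open>e m = 0\<close> only if some \<open>f\<^sup>k\<close> kills \<open>m\<close>;
  \<^item> the elements \<open>e m\<close> generate \<open>N\<close> over \<open>D\<^sub>Y\<close>.

  The second and the fourth fact give the generation statement, and the first two show that \<open>J\<close>
  annihilates \<open>e u\<close>.  For the converse inclusion, \<open>\<partial>\<^sub>i = \<theta>\<^sub>i + f\<^sub>i \<partial>\<^sub>t t\<^sup>2\<close> shows that each \<open>Q \<in> D\<^sub>Y\<close> is
  a sum \<open>\<Sum>\<^sub>k \<partial>\<^sub>t\<^sup>k A\<^sub>k\<close>, where modulo \<open>J\<close> each \<open>A\<^sub>k\<close> is killed by \<open>t f - 1\<close> and some \<open>f\<^sup>e A\<^sub>k\<close> is a
  \<open>\<tau>(P\<^sub>k)\<close>.  If \<open>Q\<close> kills \<open>e u\<close> and \<open>m\<close> is the largest index, then \<open>(t f - 1)\<^sup>m Q\<close> is congruent to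
  \<open>(-1)\<^sup>m m! f\<^sup>m A\<^sub>m\<close>, so that \<open>e (P\<^sub>m u)\<close> vanishes, \<open>f\<^sup>l P\<^sub>m\<close> lies in \<open>I\<close>, and \<open>A\<^sub>m\<close> lies in \<open>J\<close> because
  \<open>t\<close> inverts \<open>f\<close>; descending induction on \<open>m\<close> finishes the argument.  This is lemma
  \<open>eq_if_reduced_subset\<close> together with \<open>J_eq_annihilator\<close>.  Since the annihilator is \<open>J\<close> in both
  cases, the tensor product over \<open>K[x]\<close> is isomorphic to \<open>D\<^sub>Y/J\<close>.

  The third fact needs a map out of the tensor product.  It comes from the residue along
  \<open>t f = 1\<close>, a \<open>K[x,f\<^sup>-\<^sup>1]\<close>-linear map that vanishes on functions without pole there and maps
  \<open>f/(t f - 1)\<close> to \<open>1\<close>; it maps \<open>\<delta> \<otimes> z\<close> to \<open>z\<close>, and \<open>\<iota>(m) = 0\<close> means that a power of \<open>f\<close> kills \<open>m\<close>.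
  The fourth fact holds because \<open>t \<partial>\<^sub>t\<close> raises pole orders and \<open>t\<close> divides by \<open>f\<close>.

  Tensor products and their module structures are handled through representatives: \<open>weyl_operators\<close>
  turns operators that satisfy the Weyl relations modulo a subgroup into a module structure on the
  quotient, and \<open>leibniz_tensor\<close> applies this to the free abelian group on pairs.
\<close>

section \<open>Computation rules in the Weyl algebra\<close>

notation weyl_mult (infixl "\<star>" 70)

abbreviation W :: "nat \<Rightarrow> 'k::field weyl set" where
  "W n \<equiv> carrier (weyl_algebra n)"

lemma weyl_pol_mult: "weyl_pol p \<star> Q = pol_lmult p Q"
  by (simp add: weyl_pol_def weyl_mult_single)

lemma weyl_del_mult: "weyl_del i \<star> Q = del_lmult i Q"
  using op_power_del_Suc[of 0 i Q] by (simp add: weyl_del_def weyl_mult_single pol_lmult_1)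

lemma weyl_mult_minus_left: "(- P) \<star> R = - (P \<star> R)"
  using weyl_mult_add_left[of P "- P" R] by (simp add: weyl_mult_0_left eq_neg_iff_add_eq_0 add.commute)

lemma weyl_mult_0_right [simp]: "P \<star> 0 = 0"
  using weyl_mult_add_right[of P 0 0] by (metis add.right_neutral add_left_cancel)

lemma weyl_mult_minus_right: "P \<star> (- R) = - (P \<star> R)"
  using weyl_mult_add_right[of P R "- R"] by (simp add: eq_neg_iff_add_eq_0 add.commute)

lemma weyl_mult_diff_left: "(P - Q) \<star> R = P \<star> R - Q \<star> R"
  using weyl_mult_add_left[of P "- Q" R] by (simp add: weyl_mult_minus_left)

lemma weyl_mult_diff_right: "P \<star> (Q - R) = P \<star> Q - P \<star> R"
  using weyl_mult_add_right[of P Q "- R"] by (simp add: weyl_mult_minus_right)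

lemmas weyl_distribs = weyl_mult_add_left weyl_mult_add_right weyl_mult_diff_left weyl_mult_diff_right
  weyl_mult_minus_left weyl_mult_minus_right

lemma weyl_mult_sum_right: "P \<star> sum g S = (\<Sum>x\<in>S. P \<star> g x)"
  by (rule additive_sum) (rule weyl_mult_add_right)

lemma weyl_pol_add: "weyl_pol (p + q) = weyl_pol p + weyl_pol q"
  by (simp add: weyl_pol_def single_add)

lemma weyl_pol_minus: "weyl_pol (- p) = - weyl_pol p"
  by (simp add: weyl_pol_def single_uminus)

lemma weyl_pol_0 [simp]: "weyl_pol 0 = 0" and weyl_pol_1: "weyl_pol 1 = 1"
  by (simp_all add: weyl_pol_def)

lemma weyl_pol_pol_mult: "weyl_pol p \<star> (weyl_pol q \<star> Q) = weyl_pol (p * q) \<star> Q"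
  by (simp add: weyl_pol_mult pol_lmult_mult)

lemma weyl_del_pol_mult:
  "weyl_del i \<star> (weyl_pol p \<star> Q) = weyl_pol p \<star> (weyl_del i \<star> Q) + weyl_pol (pdiff i p) \<star> Q"
  by (simp add: weyl_pol_mult weyl_del_mult del_pol_lmult)

lemma weyl_del_del_mult: "weyl_del i \<star> (weyl_del j \<star> Q) = weyl_del j \<star> (weyl_del i \<star> Q)"
  by (simp add: weyl_del_mult del_lmult_commute)

lemma weyl_pol_closed [simp]: "p \<in> pols n \<Longrightarrow> weyl_pol p \<in> W n"
  unfolding weyl_pol_def by (rule weyl_carrier_single) simp

lemma weyl_del_closed [simp]: "i < n \<Longrightarrow> weyl_del i \<in> W n"
  unfolding weyl_del_def by (rule weyl_carrier_single) (auto simp: pols_one)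

lemma weyl_1_closed [simp]: "1 \<in> W n"
  using weyl_pol_closed[OF pols_one] by (simp add: weyl_pol_1)

lemma weyl_minus_closed: "P \<in> W n \<Longrightarrow> - P \<in> W n"
  using weyl_carrier_mult[OF weyl_pol_closed[OF pols_minus[OF pols_one]], of P n]
  by (simp only: weyl_pol_minus weyl_pol_1 weyl_mult_minus_left weyl_mult_1_left)

lemma weyl_diff_closed: "P \<in> W n \<Longrightarrow> Q \<in> W n \<Longrightarrow> P - Q \<in> W n"
  using weyl_carrier_add[OF _ weyl_minus_closed, of P n Q] by simp

lemmas weyl_closed = weyl_carrier_add weyl_diff_closed weyl_minus_closed weyl_carrier_mult weyl_carrier_zero

lemma pols_mono: "p \<in> pols n \<Longrightarrow> n \<le> m \<Longrightarrow> p \<in> pols m"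
  by (force simp: pols_def)

lemma pols_diff: "p \<in> pols n \<Longrightarrow> q \<in> pols n \<Longrightarrow> p - q \<in> pols n"
  using pols_add[of p n "- q"] pols_minus[of q n] by simp

lemma pols_power: "p \<in> pols n \<Longrightarrow> p ^ k \<in> pols n"
  by (induction k) (auto simp: pols_one pols_mult)

lemma pols_of_nat: "of_nat k \<in> pols n"
  by (induction k) (auto simp: pols_zero pols_one pols_add)

lemma of_nat_eq_single: "of_nat k = (single 0 (of_nat k) :: 'k::field mpol)"
  by (induction k) (simp_all add: single_add)

lemma pvar_pols: "i < n \<Longrightarrow> pvar i \<in> pols n"
  by (auto simp: pols_def pvar_def)

lemma pols_pdiff_eq_0: "p \<in> pols n \<Longrightarrow> n \<le> i \<Longrightarrow> pdiff i p = 0"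
proof (rule poly_mapping_eqI)
  fix m assume p: "p \<in> pols n" "n \<le> i"
  have "m + single i 1 \<notin> keys p"
  proof
    assume "m + single i 1 \<in> keys p"
    then have "keys (m + single i 1) \<subseteq> {..<n}" using p by (simp add: pols_def)
    moreover have "i \<in> keys (m + single i 1)" by (simp add: in_keys_iff lookup_add)
    ultimately show False using p by auto
  qed
  then show "lookup (pdiff i p) m = lookup 0 m"
    by (simp add: lookup_pdiff not_in_keys_iff_lookup_eq_zero)
qed

lemma pdiff_pvar: "pdiff i (pvar j) = (if i = j then 1 else 0)"
  by (auto simp: pvar_def pdiff_single lookup_single when_def simp del: One_nat_def)

lemma pdiff_power: "pdiff i (p ^ Suc k) = of_nat (Suc k) * p ^ k * pdiff i p"
  by (induction k) (simp_all add: pdiff_mult algebra_simps)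

lemma weyl_single_induct [consumes 1, case_names single add]:
  assumes P: "P \<in> W n"
    and single: "\<And>\<beta> p. keys \<beta> \<subseteq> {..<n} \<Longrightarrow> p \<in> pols n \<Longrightarrow> H (single \<beta> p)"
    and add: "\<And>P Q. P \<in> W n \<Longrightarrow> Q \<in> W n \<Longrightarrow> H P \<Longrightarrow> H Q \<Longrightarrow> H (P + Q)"
  shows "H P"
proof -
  have "(\<Sum>\<beta>\<in>S. single \<beta> (lookup P \<beta>)) \<in> W n \<and> H (\<Sum>\<beta>\<in>S. single \<beta> (lookup P \<beta>))"
    if "finite S" "S \<subseteq> keys P" for S
    using that
  proof (induction S rule: finite_induct)
    case empty
    show ?case using single[of 0 0] by (simp add: pols_zero weyl_carrier_zero)
  next
    case (insert \<beta> S)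
    then have "single \<beta> (lookup P \<beta>) \<in> W n \<and> H (single \<beta> (lookup P \<beta>))"
      using weyl_carrierD[OF P, of \<beta>] by (auto intro!: single weyl_carrier_single)
    with insert show ?case by (auto intro!: add weyl_carrier_add)
  qed
  from this[of "keys P"] show ?thesis using sum_single[of P] by simp
qed

text \<open>The Weyl algebra is spanned by the left translates of \<open>1\<close> under polynomials and
  derivations, so a property closed under these holds everywhere.\<close>

lemma weyl_gen_induct [consumes 1, case_names one add pol del]:
  assumes P: "P \<in> W n"
    and one: "H 1"
    and add: "\<And>P Q. P \<in> W n \<Longrightarrow> Q \<in> W n \<Longrightarrow> H P \<Longrightarrow> H Q \<Longrightarrow> H (P + Q)"
    and pol: "\<And>p P. p \<in> pols n \<Longrightarrow> P \<in> W n \<Longrightarrow> H P \<Longrightarrow> H (weyl_pol p \<star> P)"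
    and del: "\<And>i P. i < n \<Longrightarrow> P \<in> W n \<Longrightarrow> H P \<Longrightarrow> H (weyl_del i \<star> P)"
  shows "H P"
  using P
proof (induction rule: weyl_single_induct)
  case (single \<beta> p)
  have "op_power del_lmult \<beta> 1 \<in> {P. P \<in> W n \<and> H P}"
  proof (rule op_power_closed)
    fix i and v :: "'a weyl" assume "i \<in> keys \<beta>" "v \<in> {P. P \<in> W n \<and> H P}"
    moreover from this single have "i < n" by auto
    ultimately show "del_lmult i v \<in> {P. P \<in> W n \<and> H P}"
      using del[of i v] weyl_carrier_mult[of "weyl_del i" n v] by (simp add: weyl_del_mult)
  qed (simp add: one)
  then have "H (weyl_pol p \<star> single \<beta> 1)"
    using single by (intro pol) (simp_all add: op_power_del_1)
  then show ?case by (simp add: weyl_pol_mult)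
qed (rule add)

section \<open>Subgroups and cosets\<close>

definition add_subgroup :: "'a::ab_group_add set \<Rightarrow> bool" where
  "add_subgroup N \<longleftrightarrow> 0 \<in> N \<and> (\<forall>x\<in>N. \<forall>y\<in>N. x - y \<in> N)"

lemma add_subgroupI: "0 \<in> N \<Longrightarrow> (\<And>x y. x \<in> N \<Longrightarrow> y \<in> N \<Longrightarrow> x - y \<in> N) \<Longrightarrow> add_subgroup N"
  by (simp add: add_subgroup_def)

lemma add_subgroup_zero: "add_subgroup N \<Longrightarrow> 0 \<in> N"
  and add_subgroup_diff: "add_subgroup N \<Longrightarrow> x \<in> N \<Longrightarrow> y \<in> N \<Longrightarrow> x - y \<in> N"
  by (simp_all add: add_subgroup_def)

lemma add_subgroup_minus: "add_subgroup N \<Longrightarrow> x \<in> N \<Longrightarrow> - x \<in> N"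
  using add_subgroup_diff[of N 0 x] by (simp add: add_subgroup_zero)

lemma add_subgroup_add: "add_subgroup N \<Longrightarrow> x \<in> N \<Longrightarrow> y \<in> N \<Longrightarrow> x + y \<in> N"
  using add_subgroup_diff[of N x "- y"] by (simp add: add_subgroup_minus)

lemma add_subgroup_sum:
  "add_subgroup N \<Longrightarrow> (\<And>x. x \<in> S \<Longrightarrow> g x \<in> N) \<Longrightarrow> sum g S \<in> N"
  by (induction S rule: infinite_finite_induct) (auto simp: add_subgroup_zero add_subgroup_add)

lemmas add_subgroup_closed = add_subgroup_zero add_subgroup_diff add_subgroup_minus add_subgroup_add

lemma add_subgroup_zero_set: "add_subgroup {0}"
  by (simp add: add_subgroup_def)

lemma add_subgroup_W: "add_subgroup (W n)"
  by (simp add: add_subgroup_def weyl_closed)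

definition coset :: "'a::ab_group_add set \<Rightarrow> 'a \<Rightarrow> 'a set" where
  "coset N v = {z + v |z. z \<in> N}"

lemma mem_coset_iff: "x \<in> coset N v \<longleftrightarrow> x - v \<in> N"
  by (auto simp: coset_def) (metis diff_add_cancel)

lemma coset_eq_iff:
  assumes "add_subgroup N" shows "coset N v = coset N w \<longleftrightarrow> v - w \<in> N"
proof
  assume "coset N v = coset N w"
  moreover have "v \<in> coset N v" using assms by (simp add: mem_coset_iff add_subgroup_zero)
  ultimately show "v - w \<in> N" by (simp add: mem_coset_iff)
next
  assume *: "v - w \<in> N"
  have "x - v \<in> N \<longleftrightarrow> x - w \<in> N" for x
    using add_subgroup_add[OF assms _ *, of "x - v"] add_subgroup_diff[OF assms _ *, of "x - w"] by auto
  then show "coset N v = coset N w" by (auto simp: mem_coset_iff)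
qed

lemma coset_eq_self_iff: "add_subgroup N \<Longrightarrow> coset N v = N \<longleftrightarrow> v \<in> N"
  using coset_eq_iff[of N v 0] by (simp add: coset_def)

lemma coset_add: "add_subgroup N \<Longrightarrow> {x + y |x y. x \<in> coset N v \<and> y \<in> coset N w} = coset N (v + w)"
proof (intro subset_antisym subsetI)
  fix x assume N: "add_subgroup N" and "x \<in> coset N (v + w)"
  then have "x - w \<in> coset N v" "w \<in> coset N w"
    by (simp_all add: mem_coset_iff add_subgroup_zero algebra_simps)
  then show "x \<in> {x + y |x y. x \<in> coset N v \<and> y \<in> coset N w}" by force
next
  fix x assume N: "add_subgroup N" and "x \<in> {x + y |x y. x \<in> coset N v \<and> y \<in> coset N w}"
  then obtain a b where x: "x = a + b" and "a - v \<in> N" "b - w \<in> N"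
    by (auto simp: mem_coset_iff)
  then have "(a - v) + (b - w) \<in> N" using N add_subgroup_add by blast
  then show "x \<in> coset N (v + w)" by (simp add: x mem_coset_iff algebra_simps)
qed

lemma a_r_coset_eq_coset:
  assumes "add M = (+)" shows "N +>\<^bsub>M\<^esub> v = coset N v"
  by (auto simp: a_r_coset_def r_coset_def coset_def assms)

lemma quot_module_simps:
  assumes "add M = (+)"
  shows "carrier (quot_module M N) = coset N ` carrier M"
    and "zero (quot_module M N) = N"
    and "add_subgroup N \<Longrightarrow> coset N v \<oplus>\<^bsub>quot_module M N\<^esub> coset N w = coset N (v + w)"
proof -
  show "carrier (quot_module M N) = coset N ` carrier M"
    using a_r_coset_eq_coset[OF assms] by (auto simp: quot_module_def A_RCOSETS_def RCOSETS_def a_r_coset_def)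
  show "coset N v \<oplus>\<^bsub>quot_module M N\<^esub> coset N w = coset N (v + w)" if "add_subgroup N"
  proof -
    have "coset N v \<oplus>\<^bsub>quot_module M N\<^esub> coset N w = {x + y |x y. x \<in> coset N v \<and> y \<in> coset N w}"
      by (auto simp: quot_module_def set_add_def set_mult_def assms)
    then show ?thesis using coset_add[OF that] by simp
  qed
qed (simp add: quot_module_def)

lemma quot_module_smult:
  assumes N: "add_subgroup N" and M: "add M = (+)"
    and diff: "\<And>v w. smult M a (v - w) = smult M a v - smult M a w"
    and closed: "\<And>v. v \<in> N \<Longrightarrow> smult M a v \<in> N"
  shows "a \<odot>\<^bsub>quot_module M N\<^esub> coset N v = coset N (a \<odot>\<^bsub>M\<^esub> v)"
proof -
  have "a \<odot>\<^bsub>quot_module M N\<^esub> coset N v = (\<Union>x\<in>coset N v. coset N (a \<odot>\<^bsub>M\<^esub> x))"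
    by (simp add: quot_module_def a_r_coset_eq_coset[OF M])
  also have "\<dots> = (\<Union>x\<in>coset N v. coset N (a \<odot>\<^bsub>M\<^esub> v))"
  proof (rule SUP_cong)
    fix x assume "x \<in> coset N v"
    then show "coset N (a \<odot>\<^bsub>M\<^esub> x) = coset N (a \<odot>\<^bsub>M\<^esub> v)"
      using closed[of "x - v"] by (simp add: coset_eq_iff N mem_coset_iff diff)
  qed simp
  also have "\<dots> = coset N (a \<odot>\<^bsub>M\<^esub> v)"
    using mem_coset_iff[of v N v] by (auto simp: N add_subgroup_zero)
  finally show ?thesis .
qed

section \<open>Modules given by operators that satisfy the Weyl relations\<close>

text \<open>
  To give an action of the Weyl algebra on a quotient group \<open>C/N\<close> it suffices to give operators
  for polynomials and for the \<open>\<partial>\<^sub>i\<close> on \<open>C\<close> that satisfy the Weyl relations modulo \<open>N\<close>.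
  The relations are not required on \<open>C\<close> itself, because on a tensor product they only hold
  modulo the bilinearity relations.
\<close>

locale weyl_operators =
  fixes n :: nat and C N :: "'v::ab_group_add set"
    and s :: "'k::field mpol \<Rightarrow> 'v \<Rightarrow> 'v" and d :: "nat \<Rightarrow> 'v \<Rightarrow> 'v"
  assumes C: "add_subgroup C" and N: "add_subgroup N" and N_subset: "N \<subseteq> C"
    and s_closed: "\<And>p v. p \<in> pols n \<Longrightarrow> v \<in> C \<Longrightarrow> s p v \<in> C"
    and s_N: "\<And>p v. p \<in> pols n \<Longrightarrow> v \<in> N \<Longrightarrow> s p v \<in> N"
    and d_closed: "\<And>i v. i < n \<Longrightarrow> v \<in> C \<Longrightarrow> d i v \<in> C"
    and d_N: "\<And>i v. i < n \<Longrightarrow> v \<in> N \<Longrightarrow> d i v \<in> N"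
    and s_add: "\<And>p v w. s p (v + w) = s p v + s p w"
    and d_add: "\<And>i v w. d i (v + w) = d i v + d i w"
    and s_plus: "\<And>p q v. p \<in> pols n \<Longrightarrow> q \<in> pols n \<Longrightarrow> v \<in> C \<Longrightarrow> s (p + q) v - (s p v + s q v) \<in> N"
    and s_mult: "\<And>p q v. p \<in> pols n \<Longrightarrow> q \<in> pols n \<Longrightarrow> v \<in> C \<Longrightarrow> s (p * q) v - s p (s q v) \<in> N"
    and s_one: "\<And>v. v \<in> C \<Longrightarrow> s 1 v - v \<in> N"
    and d_commute: "\<And>i j v. i < n \<Longrightarrow> j < n \<Longrightarrow> v \<in> C \<Longrightarrow> d i (d j v) - d j (d i v) \<in> N"
    and d_s: "\<And>i p v. i < n \<Longrightarrow> p \<in> pols n \<Longrightarrow> v \<in> C \<Longrightarrow>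
      d i (s p v) - (s p (d i v) + s (pdiff i p) v) \<in> N"
begin

abbreviation act where "act \<equiv> normal_act s d"

definition cong (infix "\<asymp>" 50) where "v \<asymp> w \<longleftrightarrow> v - w \<in> N"

lemma coset_cong: "coset N v = coset N w \<longleftrightarrow> v \<asymp> w"
  by (simp add: cong_def coset_eq_iff N)

lemma cong_refl: "v \<asymp> v"
  by (simp add: cong_def N add_subgroup_zero)

lemma cong_sym: "v \<asymp> w \<Longrightarrow> w \<asymp> v"
  using add_subgroup_minus[OF N, of "v - w"] by (simp add: cong_def)

lemma cong_trans [trans]: "u \<asymp> v \<Longrightarrow> v \<asymp> w \<Longrightarrow> u \<asymp> w"
  using add_subgroup_add[OF N, of "u - v" "v - w"] by (simp add: cong_def)

lemma add_cong: "v \<asymp> v' \<Longrightarrow> w \<asymp> w' \<Longrightarrow> v + w \<asymp> v' + w'"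
  using add_subgroup_add[OF N, of "v - v'" "w - w'"] by (simp add: cong_def algebra_simps)

lemmas relations = s_plus[folded cong_def] s_mult[folded cong_def] s_one[folded cong_def]
  d_commute[folded cong_def] d_s[folded cong_def]

lemma s_diff: "s p (v - w) = s p v - s p w"
  using s_add[of p "v - w" w] by simp

lemma d_diff: "d i (v - w) = d i v - d i w"
  using d_add[of i "v - w" w] by simp

lemma s_cong: "p \<in> pols n \<Longrightarrow> v \<asymp> w \<Longrightarrow> s p v \<asymp> s p w"
  using s_N[of p "v - w"] by (simp add: cong_def s_diff)

lemma d_cong: "i < n \<Longrightarrow> v \<asymp> w \<Longrightarrow> d i v \<asymp> d i w"
  using d_N[of i "v - w"] by (simp add: cong_def d_diff)

lemma s_0: "v \<in> C \<Longrightarrow> s 0 v \<in> N"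
  using s_plus[of 0 0 v] add_subgroup_minus[OF N] by (fastforce simp: pols_zero)

lemma op_power_closed_C:
  assumes "keys \<beta> \<subseteq> {..<n}" "v \<in> C" shows "op_power d \<beta> v \<in> C"
  by (rule op_power_closed) (use assms d_closed in auto)

lemma op_power_closed_N:
  assumes "keys \<beta> \<subseteq> {..<n}" "v \<in> N" shows "op_power d \<beta> v \<in> N"
  by (rule op_power_closed) (use assms d_N in auto)

text \<open>
  In an operator power the factors stand in a fixed order, so moving \<open>d i\<close> to the front requires
  operators that commute, whereas the \<open>d i\<close> commute only modulo \<open>N\<close> and only for \<open>i < n\<close>.  The operators
  \<open>dd\<close> which they induce on cosets, continued by the identity, commute without exception.
\<close>

lemma op_power_Suc_cong:
  assumes \<beta>: "keys \<beta> \<subseteq> {..<n}" and i: "i < n" and v: "v \<in> C"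
  shows "op_power d (\<beta> + single i 1) v \<asymp> d i (op_power d \<beta> v)"
proof -
  define dd where "dd i X = (if i < n \<and> X \<in> coset N ` C then coset N (d i (SOME v. v \<in> C \<and> X = coset N v)) else X)"
    for i X
  have dd: "dd i (coset N v) = coset N (d i v)" if "i < n" "v \<in> C" for i v
  proof -
    define w where "w = (SOME w. w \<in> C \<and> coset N v = coset N w)"
    have "w \<in> C \<and> coset N v = coset N w" unfolding w_def by (rule someI[of _ v]) (use that in simp)
    then have "v \<asymp> w" by (simp add: coset_cong)
    then have "coset N (d i v) = coset N (d i w)" using d_cong[OF that(1)] by (simp add: coset_cong)
    with that show ?thesis by (simp add: dd_def w_def)
  qed
  have comm: "dd i (dd j X) = dd j (dd i X)" for i j X
  proof (cases "i < n \<and> j < n \<and> X \<in> coset N ` C")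
    case True
    then obtain w where w: "w \<in> C" "X = coset N w" by auto
    have "d i (d j w) \<asymp> d j (d i w)" using True w relations by simp
    then show ?thesis using True w by (simp add: dd d_closed coset_cong)
  next
    case False
    have out: "dd i X = X" if "\<not> i < n" for i X using that by (simp add: dd_def)
    have out2: "dd i X = X" if "X \<notin> coset N ` C" for i using that by (simp add: dd_def)
    show ?thesis using False out out2 by metis
  qed
  have pw: "w \<in> C \<Longrightarrow> (d i ^^ k) w \<in> C \<and> coset N ((d i ^^ k) w) = (dd i ^^ k) (coset N w)" if "i < n" for i k w
    by (induction k) (use that in \<open>auto simp: dd d_closed simp flip: dd\<close>)
  have "set xs \<subseteq> {..<n} \<Longrightarrow> foldr (\<lambda>i. d i ^^ e i) xs v \<in> C \<and>
      coset N (foldr (\<lambda>i. d i ^^ e i) xs v) = foldr (\<lambda>i. dd i ^^ e i) xs (coset N v)" for xs e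
    by (induction xs) (use v pw in auto)
  then have op: "coset N (op_power d \<gamma> v) = op_power dd \<gamma> (coset N v)" if "keys \<gamma> \<subseteq> {..<n}" for \<gamma>
    using that by (simp add: op_power_def)
  have "keys (\<beta> + single i 1) \<subseteq> {..<n}" using \<beta> i keys_add[of \<beta> "single i 1"] by auto
  then have "coset N (op_power d (\<beta> + single i 1) v) = dd i (op_power dd \<beta> (coset N v))"
    by (simp only: op op_power_Suc[of dd, OF comm])
  also have "\<dots> = coset N (d i (op_power d \<beta> v))"
    by (simp only: op[OF \<beta>, symmetric] dd[OF i op_power_closed_C[OF \<beta> v]])
  finally show ?thesis by (simp add: coset_cong)
qed

lemma act_single:
  assumes "keys \<beta> \<subseteq> {..<n}" "v \<in> C"
  shows "act (single \<beta> p) v \<asymp> s p (op_power d \<beta> v)"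
proof (cases "p = 0")
  case True
  have "- s 0 (op_power d \<beta> v) \<in> N" by (intro add_subgroup_minus N s_0 op_power_closed_C assms)
  then show ?thesis by (simp add: True normal_act_def cong_def)
qed (simp add: normal_act_def cong_refl)

text \<open>A vanishing coefficient contributes \<open>s 0 v\<close>, which need not be \<open>0\<close> but lies in \<open>N\<close>.  The set over
  which a normal form is summed may therefore be enlarged modulo \<open>N\<close>, as is needed to add normal forms
  with different supports.\<close>

lemma act_superset:
  assumes "finite S" "keys P \<subseteq> S" "\<And>\<beta>. \<beta> \<in> S \<Longrightarrow> keys \<beta> \<subseteq> {..<n}" "v \<in> C"
  shows "act P v \<asymp> (\<Sum>\<beta>\<in>S. s (lookup P \<beta>) (op_power d \<beta> v))"
proof -
  have "(\<Sum>\<beta>\<in>S. s (lookup P \<beta>) (op_power d \<beta> v)) =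
      (\<Sum>\<beta>\<in>S - keys P. s (lookup P \<beta>) (op_power d \<beta> v)) + act P v"
    unfolding normal_act_def by (rule sum.subset_diff) (use assms in auto)
  moreover have "(\<Sum>\<beta>\<in>S - keys P. s (lookup P \<beta>) (op_power d \<beta> v)) \<in> N"
    by (rule add_subgroup_sum[OF N]) (use assms op_power_closed_C s_0 in \<open>auto simp: in_keys_iff\<close>)
  ultimately show ?thesis using add_subgroup_minus[OF N] by (fastforce simp: cong_def)
qed

lemma act_add_left:
  assumes P: "P \<in> W n" and Q: "Q \<in> W n" and v: "v \<in> C"
  shows "act (P + Q) v \<asymp> act P v + act Q v"
proof -
  let ?S = "keys P \<union> keys Q" and ?t = "\<lambda>R. \<Sum>\<beta>\<in>keys P \<union> keys Q. s (lookup R \<beta>) (op_power d \<beta> v)"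
  have k: "keys \<beta> \<subseteq> {..<n}" if "\<beta> \<in> ?S" for \<beta> using that weyl_carrierD(1)[OF P] weyl_carrierD(1)[OF Q] by blast
  have pol: "lookup R \<beta> \<in> pols n" if "R \<in> W n" for R \<beta>
    using weyl_carrierD(2)[OF that, of \<beta>] by (cases "\<beta> \<in> keys R") (auto simp: in_keys_iff pols_zero)
  have "?t (P + Q) - (?t P + ?t Q) =
      (\<Sum>\<beta>\<in>?S. s (lookup P \<beta> + lookup Q \<beta>) (op_power d \<beta> v) -
        (s (lookup P \<beta>) (op_power d \<beta> v) + s (lookup Q \<beta>) (op_power d \<beta> v)))"
    by (simp only: lookup_add sum_subtractf sum.distrib)
  also have "\<dots> \<in> N"
    by (intro add_subgroup_sum N s_plus pol P Q op_power_closed_C k v)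
  finally have t: "?t (P + Q) \<asymp> ?t P + ?t Q" unfolding cong_def .
  have sup: "act R v \<asymp> ?t R" if "keys R \<subseteq> ?S" for R
    by (intro act_superset that k v) auto
  have "act (P + Q) v \<asymp> ?t (P + Q)" by (rule sup) (rule keys_add)
  also note t
  also have "?t P + ?t Q \<asymp> act P v + act Q v" by (intro add_cong cong_sym[OF sup]) auto
  finally show ?thesis .
qed

lemma act_add_right: "act P (v + w) = act P v + act P w"
  by (rule normal_act_add_right) (rule s_add, rule d_add)

lemma act_diff_right: "act P (v - w) = act P v - act P w"
  using act_add_right[of P "v - w" w] by simp

lemma act_closed: "P \<in> W n \<Longrightarrow> v \<in> C \<Longrightarrow> act P v \<in> C"
  unfolding normal_act_def
  by (intro add_subgroup_sum C s_closed op_power_closed_C) (auto dest: weyl_carrierD)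

lemma act_N: "P \<in> W n \<Longrightarrow> v \<in> N \<Longrightarrow> act P v \<in> N"
  unfolding normal_act_def
  by (intro add_subgroup_sum N s_N op_power_closed_N) (auto dest: weyl_carrierD)

lemma act_weyl_pol: "v \<in> C \<Longrightarrow> act (weyl_pol p) v \<asymp> s p v"
  using act_single[of 0 v p] by (simp add: weyl_pol_def)

lemma act_one: "v \<in> C \<Longrightarrow> act 1 v \<asymp> v"
  using cong_trans[OF act_weyl_pol relations(3), of v] by (simp add: weyl_pol_1)

lemma act_pol:
  assumes p: "p \<in> pols n" and Q: "Q \<in> W n" and v: "v \<in> C"
  shows "act (weyl_pol p \<star> Q) v \<asymp> s p (act Q v)"
  using Q
proof (induction rule: weyl_single_induct)
  case (single \<beta> q)
  have "act (weyl_pol p \<star> single \<beta> q) v \<asymp> s (p * q) (op_power d \<beta> v)"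
    using act_single[OF single(1) v] by (simp add: weyl_pol_mult)
  also have "\<dots> \<asymp> s p (s q (op_power d \<beta> v))"
    by (intro relations p single op_power_closed_C v)
  also have "\<dots> \<asymp> s p (act (single \<beta> q) v)"
    by (intro s_cong p cong_sym[OF act_single] single v)
  finally show ?case .
next
  case (add P Q)
  have "act (weyl_pol p \<star> (P + Q)) v \<asymp> act (weyl_pol p \<star> P) v + act (weyl_pol p \<star> Q) v"
    unfolding weyl_mult_add_right by (intro act_add_left weyl_closed add weyl_pol_closed p v)
  also have "\<dots> \<asymp> s p (act P v) + s p (act Q v)" by (intro add_cong add)
  also have "\<dots> = s p (act P v + act Q v)" by (simp add: s_add)
  also have "\<dots> \<asymp> s p (act (P + Q) v)" by (intro s_cong p cong_sym[OF act_add_left] add v)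
  finally show ?case .
qed

lemma act_del:
  assumes i: "i < n" and Q: "Q \<in> W n" and v: "v \<in> C"
  shows "act (weyl_del i \<star> Q) v \<asymp> d i (act Q v)"
  using Q
proof (induction rule: weyl_single_induct)
  case (single \<beta> q)
  have k: "keys (\<beta> + single i 1) \<subseteq> {..<n}" using single i keys_add[of \<beta> "single i 1"] by auto
  have "act (weyl_del i \<star> single \<beta> q) v = act (single (\<beta> + single i 1) q + single \<beta> (pdiff i q)) v"
    by (simp add: weyl_del_mult)
  also have "\<dots> \<asymp> act (single (\<beta> + single i 1) q) v + act (single \<beta> (pdiff i q)) v"
    by (intro act_add_left weyl_carrier_single k single pols_pdiff v)
  also have "\<dots> \<asymp> s q (op_power d (\<beta> + single i 1) v) + s (pdiff i q) (op_power d \<beta> v)"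
    by (intro add_cong act_single k single v)
  also have "\<dots> \<asymp> s q (d i (op_power d \<beta> v)) + s (pdiff i q) (op_power d \<beta> v)"
    by (intro add_cong s_cong op_power_Suc_cong single i v cong_refl)
  also have "\<dots> \<asymp> d i (s q (op_power d \<beta> v))"
    by (intro cong_sym[OF relations(5)] single i op_power_closed_C v)
  also have "\<dots> \<asymp> d i (act (single \<beta> q) v)"
    by (intro d_cong i cong_sym[OF act_single] single v)
  finally show ?case .
next
  case (add P Q)
  have "act (weyl_del i \<star> (P + Q)) v \<asymp> act (weyl_del i \<star> P) v + act (weyl_del i \<star> Q) v"
    unfolding weyl_mult_add_right by (intro act_add_left weyl_closed add weyl_del_closed i v)
  also have "\<dots> \<asymp> d i (act P v) + d i (act Q v)" by (intro add_cong add)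
  also have "\<dots> = d i (act P v + act Q v)" by (simp add: d_add)
  also have "\<dots> \<asymp> d i (act (P + Q) v)" by (intro d_cong i cong_sym[OF act_add_left] add v)
  finally show ?case .
qed

lemma act_weyl_del: "i < n \<Longrightarrow> v \<in> C \<Longrightarrow> act (weyl_del i) v \<asymp> d i v"
  using cong_trans[OF act_del[of i 1 v] d_cong[OF _ act_one]] by (simp add: weyl_mult_1_right)

text \<open>Polynomials and single derivations can be pulled out of a normal form (\<open>act_pol\<close> and
  \<open>act_del\<close>, the latter by the Leibniz relation), and these generate the Weyl algebra.\<close>

lemma act_mult:
  assumes P: "P \<in> W n" and Q: "Q \<in> W n" and v: "v \<in> C"
  shows "act (P \<star> Q) v \<asymp> act P (act Q v)"
  using P
proof (induction rule: weyl_gen_induct)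
  case one
  show ?case using cong_sym[OF act_one[OF act_closed[OF Q v]]] by (simp add: weyl_mult_1_left)
next
  case (add P P')
  have "act ((P + P') \<star> Q) v \<asymp> act (P \<star> Q) v + act (P' \<star> Q) v"
    unfolding weyl_mult_add_left by (intro act_add_left weyl_closed add Q v)
  also have "\<dots> \<asymp> act P (act Q v) + act P' (act Q v)" by (intro add_cong add)
  also have "\<dots> \<asymp> act (P + P') (act Q v)" by (intro cong_sym[OF act_add_left] add act_closed Q v)
  finally show ?case .
next
  case (pol p P)
  have "act (weyl_pol p \<star> P \<star> Q) v \<asymp> s p (act (P \<star> Q) v)"
    unfolding weyl_mult_assoc by (intro act_pol pol weyl_closed Q v)
  also have "\<dots> \<asymp> s p (act P (act Q v))" by (intro s_cong pol)
  also have "\<dots> \<asymp> act (weyl_pol p \<star> P) (act Q v)" by (intro cong_sym[OF act_pol] pol act_closed Q v)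
  finally show ?case .
next
  case (del i P)
  have "act (weyl_del i \<star> P \<star> Q) v \<asymp> d i (act (P \<star> Q) v)"
    unfolding weyl_mult_assoc by (intro act_del del weyl_closed Q v)
  also have "\<dots> \<asymp> d i (act P (act Q v))" by (intro d_cong del)
  also have "\<dots> \<asymp> act (weyl_del i \<star> P) (act Q v)" by (intro cong_sym[OF act_del] del act_closed Q v)
  finally show ?case .
qed

context
  fixes M :: "('k weyl, 'v, 'z) module_scheme"
  assumes M: "carrier M = C" "add M = (+)" "smult M = act"
begin

lemma quot_carrier: "carrier (quot_module M N) = coset N ` C"
  and quot_zero: "\<zero>\<^bsub>quot_module M N\<^esub> = N"
  and quot_add: "coset N v \<oplus>\<^bsub>quot_module M N\<^esub> coset N w = coset N (v + w)"
  using quot_module_simps[OF M(2), of N] M(1) N by auto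

lemma quot_smult:
  assumes "P \<in> W n" shows "P \<odot>\<^bsub>quot_module M N\<^esub> coset N v = coset N (act P v)"
  using quot_module_smult[of N M P v] act_diff_right act_N[OF assms] N by (simp add: M)

lemma quot_weyl_pol:
  "p \<in> pols n \<Longrightarrow> v \<in> C \<Longrightarrow> weyl_pol p \<odot>\<^bsub>quot_module M N\<^esub> coset N v = coset N (s p v)"
  using act_weyl_pol[of v p] by (simp add: quot_smult coset_cong)

lemma quot_weyl_del:
  "i < n \<Longrightarrow> v \<in> C \<Longrightarrow> weyl_del i \<odot>\<^bsub>quot_module M N\<^esub> coset N v = coset N (d i v)"
  using act_weyl_del[of i v] by (simp add: quot_smult coset_cong)

lemma left_module_quot: "left_module (weyl_algebra n) (quot_module M N)"
proof (intro left_module.intro left_module_axioms.intro)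
  let ?Q = "quot_module M N"
  show "ring (weyl_algebra n :: 'k weyl ring)" by (rule ring_weyl_algebra)
  have N_coset: "N = coset N 0" by (simp add: coset_def)
  show "abelian_group ?Q"
  proof (rule abelian_groupI)
    show "\<zero>\<^bsub>?Q\<^esub> \<in> carrier ?Q"
      unfolding quot_zero quot_carrier by (subst N_coset) (auto intro: add_subgroup_zero[OF C])
    fix x assume "x \<in> carrier ?Q"
    then obtain v where v: "v \<in> C" "x = coset N v" by (auto simp: quot_carrier)
    show "\<zero>\<^bsub>?Q\<^esub> \<oplus>\<^bsub>?Q\<^esub> x = x"
      unfolding quot_zero v by (subst (2) N_coset) (simp add: quot_add)
    show "\<exists>y\<in>carrier ?Q. y \<oplus>\<^bsub>?Q\<^esub> x = \<zero>\<^bsub>?Q\<^esub>"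
    proof
      show "coset N (- v) \<in> carrier ?Q" using v by (auto simp: quot_carrier add_subgroup_minus C)
      show "coset N (- v) \<oplus>\<^bsub>?Q\<^esub> x = \<zero>\<^bsub>?Q\<^esub>"
        unfolding quot_zero v by (subst (3) N_coset) (simp add: quot_add)
    qed
  qed (auto simp: quot_carrier quot_add add_subgroup_add C ac_simps)
  fix x assume x: "x \<in> carrier ?Q"
  obtain v where v: "v \<in> C" "x = coset N v" using x by (auto simp: quot_carrier)
  show "\<one>\<^bsub>weyl_algebra n\<^esub> \<odot>\<^bsub>?Q\<^esub> x = x"
    using v act_one by (simp add: quot_smult weyl_algebra_simps coset_cong)
  fix P :: "'k weyl" assume P: "P \<in> W n"
  show "P \<odot>\<^bsub>?Q\<^esub> x \<in> carrier ?Q" using v P by (auto simp: quot_smult quot_carrier act_closed)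
  fix Q :: "'k weyl" assume Q: "Q \<in> W n"
  show "(P \<oplus>\<^bsub>weyl_algebra n\<^esub> Q) \<odot>\<^bsub>?Q\<^esub> x = P \<odot>\<^bsub>?Q\<^esub> x \<oplus>\<^bsub>?Q\<^esub> Q \<odot>\<^bsub>?Q\<^esub> x"
    using v P Q act_add_left by (simp add: quot_smult quot_add weyl_algebra_simps weyl_closed coset_cong)
  show "(P \<otimes>\<^bsub>weyl_algebra n\<^esub> Q) \<odot>\<^bsub>?Q\<^esub> x = P \<odot>\<^bsub>?Q\<^esub> (Q \<odot>\<^bsub>?Q\<^esub> x)"
    using v P Q act_mult by (simp add: quot_smult weyl_algebra_simps weyl_closed coset_cong)
next
  fix P :: "'k weyl" and x y assume "P \<in> W n" "x \<in> carrier (quot_module M N)" "y \<in> carrier (quot_module M N)"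
  then show "P \<odot>\<^bsub>quot_module M N\<^esub> (x \<oplus>\<^bsub>quot_module M N\<^esub> y) =
      P \<odot>\<^bsub>quot_module M N\<^esub> x \<oplus>\<^bsub>quot_module M N\<^esub> P \<odot>\<^bsub>quot_module M N\<^esub> y"
    by (auto simp: quot_carrier quot_add quot_smult act_add_right)
qed

end

end

section \<open>Left ideals of the Weyl algebra\<close>

text \<open>Left ideals are used through the operations of the type rather than those of the ring record.\<close>

lemma left_ideal_weyl_iff:
  fixes I :: "'k::field weyl set"
  shows "left_ideal I (weyl_algebra n) \<longleftrightarrow>
    I \<subseteq> W n \<and> add_subgroup I \<and> (\<forall>P\<in>W n. \<forall>Q\<in>I. P \<star> Q \<in> I)" (is "?l \<longleftrightarrow> ?r")
proof
  interpret R: ring "weyl_algebra n :: 'k weyl ring" by (rule ring_weyl_algebra)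
  have neg: "\<ominus>\<^bsub>weyl_algebra n\<^esub> P = - P" if "P \<in> W n" for P :: "'k weyl"
    by (rule R.minus_equality) (use that in \<open>simp_all add: weyl_closed weyl_algebra_simps\<close>)
  {
    assume ?l
    then interpret left_ideal I "weyl_algebra n" .
    show ?r
    proof (intro conjI add_subgroupI ballI)
      show I: "I \<subseteq> W n" by (rule a_subset)
      show "0 \<in> I" using zero_closed by (simp add: weyl_algebra_simps)
      show "x - y \<in> I" if "x \<in> I" "y \<in> I" for x y
        using a_closed[of x "- y"] a_inv_closed[of y] that I neg[of y] by (auto simp: weyl_algebra_simps)
      show "P \<star> Q \<in> I" if "P \<in> W n" "Q \<in> I" for P Q
        using I_l_closed[OF that(2,1)] by (simp add: weyl_algebra_simps)
    qed
  next
    assume r: ?r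
    show ?l
    proof (intro left_ideal.intro additive_subgroup.intro left_ideal_axioms.intro
        group.subgroupI R.ring_axioms R.a_group)
      fix P assume "P \<in> I"
      moreover then have "inv\<^bsub>add_monoid (weyl_algebra n)\<^esub> P = - P"
        using r neg[of P] by (auto simp: a_inv_def)
      ultimately show "inv\<^bsub>add_monoid (weyl_algebra n)\<^esub> P \<in> I"
        using r by (simp add: add_subgroup_minus)
    qed (use r in \<open>auto simp: weyl_algebra_simps add_subgroup_add dest: add_subgroup_zero\<close>)
  }
qed

lemma gen_left_ideal_least:
  "left_ideal I R \<Longrightarrow> S \<subseteq> I \<Longrightarrow> gen_left_ideal R S \<subseteq> I"
  by (auto simp: gen_left_ideal_def)

lemma gen_left_ideal_superset: "S \<subseteq> gen_left_ideal R S"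
  by (auto simp: gen_left_ideal_def)

lemma left_ideal_gen_left_ideal:
  assumes "S \<subseteq> W n"
  shows "left_ideal (gen_left_ideal (weyl_algebra n) S) (weyl_algebra n)"
proof -
  have "left_ideal (W n) (weyl_algebra n)"
    by (simp add: left_ideal_weyl_iff add_subgroup_W weyl_closed)
  then have "gen_left_ideal (weyl_algebra n) S \<subseteq> W n" using assms by (rule gen_left_ideal_least)
  then show ?thesis
    by (auto simp: left_ideal_weyl_iff gen_left_ideal_def add_subgroup_def)
qed

section \<open>The substitution \<open>\<partial>\<^sub>i \<mapsto> \<theta>\<^sub>i\<close>\<close>

lemma theta_mult:
  "theta n f i \<star> Q = weyl_del i \<star> Q -
     weyl_pol (pdiff i f) \<star> (weyl_del n \<star> (weyl_pol (pvar n ^ 2) \<star> Q))"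
  by (simp add: theta_def weyl_distribs weyl_mult_assoc)

lemma tf1_pols: "f \<in> pols n \<Longrightarrow> tf1 n f \<in> pols (Suc n)"
  unfolding tf1_def using pols_mono[of f n "Suc n"] by (intro pols_diff pols_mult pvar_pols pols_one) auto

lemma pdiff_tf1:
  "f \<in> pols n \<Longrightarrow> pdiff n (tf1 n f) = f"
  "i < n \<Longrightarrow> pdiff i (tf1 n f) = pvar n * pdiff i f"
  by (simp_all add: tf1_def pdiff_mult pdiff_pvar pols_pdiff_eq_0 pdiff_add pdiff_minus
      flip: add_uminus_conv_diff)

lemma theta_closed:
  assumes "f \<in> pols n" "i < n" shows "theta n f i \<in> W (Suc n)"
  unfolding theta_def using assms
  by (intro weyl_closed weyl_pol_closed weyl_del_closed pols_power pvar_pols)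
     (auto intro: pols_mono[OF pols_pdiff])

lemma theta_pol:
  assumes "f \<in> pols n" "p \<in> pols n"
  shows "theta n f i \<star> (weyl_pol p \<star> Q) = weyl_pol p \<star> (theta n f i \<star> Q) + weyl_pol (pdiff i p) \<star> Q"
  using assms by (simp add: theta_mult weyl_del_pol_mult weyl_pol_pol_mult weyl_distribs
      pols_pdiff_eq_0 pdiff_mult weyl_mult_0_left mult_ac)

text \<open>Here \<open>\<theta>\<^sub>i = \<partial>\<^sub>i - f\<^sub>i E\<close> where \<open>E = \<partial>\<^sub>t t\<^sup>2\<close> commutes with all \<open>\<partial>\<^sub>j\<close> and \<open>f\<^sub>j\<close>, so that the commutator
  reduces to the symmetry of the second derivatives of \<open>f\<close>.\<close>

lemma theta_commute:
  assumes "f \<in> pols n" "i < n" "j < n"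
  shows "theta n f i \<star> (theta n f j \<star> Q) = theta n f j \<star> (theta n f i \<star> Q)"
proof -
  define E where "E Q = weyl_del n \<star> (weyl_pol (pvar n ^ 2) \<star> Q)" for Q :: "'a weyl"
  have th: "theta n f i \<star> Q = weyl_del i \<star> Q - weyl_pol (pdiff i f) \<star> E Q" for i Q
    by (simp add: theta_mult E_def)
  have E_diff: "E (P - Q) = E P - E Q" for P Q by (simp add: E_def weyl_distribs)
  have E_pol: "E (weyl_pol (pdiff k f) \<star> Q) = weyl_pol (pdiff k f) \<star> E Q" for k Q
    using pols_pdiff_eq_0[OF pols_pdiff[OF assms(1)], of n k]
    by (simp add: E_def weyl_del_pol_mult weyl_pol_pol_mult weyl_distribs pdiff_mult mult_ac)
  have E_del: "E (weyl_del k \<star> Q) = weyl_del k \<star> E Q" if "k < n" for k Q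
  proof -
    have "pdiff k (pvar n ^ 2 :: 'a mpol) = 0"
      using that pdiff_power[of k "pvar n" 1] by (simp add: pdiff_pvar numeral_2_eq_2)
    then show ?thesis
      by (simp add: E_def weyl_del_pol_mult weyl_distribs weyl_del_del_mult[of n k] weyl_mult_0_left
          pdiff_commute[of k n])
  qed
  have "theta n f k \<star> (theta n f l \<star> Q) =
      weyl_del k \<star> (weyl_del l \<star> Q) - weyl_pol (pdiff l f) \<star> (weyl_del k \<star> E Q)
      - weyl_pol (pdiff k (pdiff l f)) \<star> E Q - weyl_pol (pdiff k f) \<star> (weyl_del l \<star> E Q)
      + weyl_pol (pdiff k f) \<star> (weyl_pol (pdiff l f) \<star> E (E Q))" if "k < n" "l < n" for k l
    using that by (simp add: th E_diff E_pol E_del weyl_distribs weyl_del_pol_mult)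
  from this[of i j] this[of j i] assms show ?thesis
    by (simp add: weyl_del_del_mult[of j i] pdiff_commute[of j i] weyl_pol_pol_mult mult.commute)
qed

text \<open>The commutator of \<open>\<theta>\<^sub>i\<close> with \<open>t f - 1\<close> is a multiple of \<open>t f - 1\<close>: geometrically, \<open>\<theta>\<^sub>i\<close> is tangent
  to the hypersurface \<open>t f = 1\<close>.\<close>

lemma tf1_theta:
  assumes f: "f \<in> pols n" and i: "i < n"
  shows "weyl_pol (tf1 n f) \<star> (theta n f i \<star> Q) =
    theta n f i \<star> (weyl_pol (tf1 n f) \<star> Q) + weyl_pol (pvar n * pdiff i f) \<star> (weyl_pol (tf1 n f) \<star> Q)"
proof -
  let ?s = "tf1 n f" and ?t = "pvar n :: 'a mpol"
  have "theta n f i \<star> (weyl_pol ?s \<star> Q) = weyl_pol ?s \<star> (weyl_del i \<star> Q) + weyl_pol (?t * pdiff i f) \<star> Q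
      - weyl_pol (pdiff i f) \<star> (weyl_del n \<star> (weyl_pol ?s \<star> (weyl_pol (?t ^ 2) \<star> Q)))"
    using i by (simp add: theta_mult weyl_del_pol_mult pdiff_tf1 weyl_pol_pol_mult mult.commute)
  also have "\<dots> = weyl_pol ?s \<star> (theta n f i \<star> Q) + weyl_pol (?t * pdiff i f) \<star> Q
      - weyl_pol (pdiff i f * f * ?t ^ 2) \<star> Q"
    unfolding weyl_del_pol_mult[of n ?s] pdiff_tf1(1)[OF f] theta_mult
    by (simp add: weyl_distribs weyl_pol_pol_mult mult_ac)
  also have "weyl_pol (pdiff i f * f * ?t ^ 2) = weyl_pol (?t * pdiff i f * ?s) + weyl_pol (?t * pdiff i f)"
    by (simp add: tf1_def algebra_simps power2_eq_square flip: weyl_pol_add)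
  finally show ?thesis
    by (simp add: weyl_distribs weyl_pol_pol_mult)
qed

text \<open>Substituting \<open>\<theta>\<^sub>i\<close> for \<open>\<partial>\<^sub>i\<close> is the action on \<open>1\<close> of a second module structure over the smaller Weyl
  algebra, in which \<open>\<partial>\<^sub>i\<close> acts as left multiplication by \<open>\<theta>\<^sub>i\<close>.  This makes \<open>\<tau>\<close> multiplicative.\<close>

lemma weyl_operators_theta:
  assumes f: "f \<in> pols n"
  shows "weyl_operators n (W (Suc n)) {0} (\<lambda>p Q. weyl_pol p \<star> Q) (\<lambda>i Q. theta n f i \<star> Q)"
proof unfold_locales
  show "weyl_pol p \<star> Q \<in> W (Suc n)" if "p \<in> pols n" "Q \<in> W (Suc n)" for p Q
    using that pols_mono[of p n "Suc n"] by (simp add: weyl_carrier_mult)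
  show "theta n f i \<star> Q \<in> W (Suc n)" if "i < n" "Q \<in> W (Suc n)" for i Q
    by (rule weyl_carrier_mult[OF theta_closed[OF f that(1)] that(2)])
  show "theta n f i \<star> (theta n f j \<star> Q) - theta n f j \<star> (theta n f i \<star> Q) \<in> {0}" if "i < n" "j < n" for i j Q
    using theta_commute[OF f that] by simp
  show "theta n f i \<star> (weyl_pol p \<star> Q) - (weyl_pol p \<star> (theta n f i \<star> Q) + weyl_pol (pdiff i p) \<star> Q) \<in> {0}"
    if "p \<in> pols n" for i p Q
    using theta_pol[OF f that] by simp
qed (auto simp: add_subgroup_W add_subgroup_zero_set weyl_carrier_zero weyl_pol_1 weyl_mult_1_left
  weyl_pol_add weyl_pol_pol_mult weyl_mult_add_left weyl_mult_add_right)

lemma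
  assumes f: "f \<in> pols n"
  shows tau_closed: "P \<in> W n \<Longrightarrow> tau n f P \<in> W (Suc n)"
    and tau_1: "tau n f 1 = 1"
    and tau_add: "P \<in> W n \<Longrightarrow> Q \<in> W n \<Longrightarrow> tau n f (P + Q) = tau n f P + tau n f Q"
    and tau_pol: "p \<in> pols n \<Longrightarrow> Q \<in> W n \<Longrightarrow> tau n f (weyl_pol p \<star> Q) = weyl_pol p \<star> tau n f Q"
    and tau_del: "i < n \<Longrightarrow> Q \<in> W n \<Longrightarrow> tau n f (weyl_del i \<star> Q) = theta n f i \<star> tau n f Q"
proof -
  interpret weyl_operators n "W (Suc n)" "{0}" "\<lambda>p Q. weyl_pol p \<star> Q" "\<lambda>i Q. theta n f i \<star> Q"
    by (rule weyl_operators_theta[OF f])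
  have t: "tau n f P = act P 1" for P by (simp add: tau_def)
  show "P \<in> W n \<Longrightarrow> tau n f P \<in> W (Suc n)" unfolding t by (rule act_closed) auto
  show "tau n f 1 = 1" using act_one[of 1] by (simp add: t cong_def)
  show "P \<in> W n \<Longrightarrow> Q \<in> W n \<Longrightarrow> tau n f (P + Q) = tau n f P + tau n f Q"
    using act_add_left[of P Q 1] by (simp add: t cong_def)
  show "p \<in> pols n \<Longrightarrow> Q \<in> W n \<Longrightarrow> tau n f (weyl_pol p \<star> Q) = weyl_pol p \<star> tau n f Q"
    using act_pol[of p Q 1] by (simp add: t cong_def)
  show "i < n \<Longrightarrow> Q \<in> W n \<Longrightarrow> tau n f (weyl_del i \<star> Q) = theta n f i \<star> tau n f Q"
    using act_del[of i Q 1] by (simp add: t cong_def)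
qed

lemma tau_diff:
  assumes "f \<in> pols n" "P \<in> W n" "Q \<in> W n" shows "tau n f (P - Q) = tau n f P - tau n f Q"
  using tau_add[OF assms(1) weyl_diff_closed[OF assms(2,3)] assms(3)] by simp

lemma tau_mult:
  assumes f: "f \<in> pols n" and P: "P \<in> W n" and Q: "Q \<in> W n"
  shows "tau n f (P \<star> Q) = tau n f P \<star> tau n f Q"
  using P
proof (induction rule: weyl_gen_induct)
  case one
  show ?case by (simp only: weyl_mult_1_left tau_1[OF f])
next
  case (add P P')
  then show ?case
    by (simp only: weyl_mult_add_left tau_add[OF f] weyl_carrier_mult Q)
next
  case (pol p P)
  have "tau n f (weyl_pol p \<star> (P \<star> Q)) = weyl_pol p \<star> tau n f (P \<star> Q)"
    by (rule tau_pol[OF f pol(1) weyl_carrier_mult[OF pol(2) Q]])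
  then show ?case unfolding weyl_mult_assoc pol(3) tau_pol[OF f pol(1,2)] .
next
  case (del i P)
  have "tau n f (weyl_del i \<star> (P \<star> Q)) = theta n f i \<star> tau n f (P \<star> Q)"
    by (rule tau_del[OF f del(1) weyl_carrier_mult[OF del(2) Q]])
  then show ?case unfolding weyl_mult_assoc del(3) tau_del[OF f del(1,2)] .
qed

section \<open>Left ideals of \<open>D\<^sub>Y\<close> that contain \<open>t f - 1\<close>\<close>

lemma pols_Suc_induct [consumes 1, case_names monom add]:
  assumes p: "p \<in> pols (Suc n)"
    and monom: "\<And>c j. c \<in> pols n \<Longrightarrow> H (c * pvar n ^ j)"
    and add: "\<And>p q. p \<in> pols (Suc n) \<Longrightarrow> q \<in> pols (Suc n) \<Longrightarrow> H p \<Longrightarrow> H q \<Longrightarrow> H (p + q)"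
  shows "H (p :: 'k::field mpol)"
proof -
  have pw: "pvar n ^ j = (single (single n j) 1 :: 'k mpol)" for j
    by (induction j) (simp_all add: pvar_def mult_single single_add[symmetric])
  have single: "H (single m c)" if m: "keys m \<subseteq> {..<Suc n}" for m and c :: 'k
  proof -
    define m' where "m' = m - single n (lookup m n)"
    have m': "lookup m' i = (if i = n then 0 else lookup m i)" for i
      by (simp add: m'_def lookup_minus lookup_single when_def)
    have "m = m' + single n (lookup m n)"
      by (rule poly_mapping_eqI) (simp add: m' lookup_add lookup_single when_def)
    then have "single m c = single m' c * pvar n ^ lookup m n"
      by (simp add: pw mult_single)
    moreover have "keys m' \<subseteq> {..<n}"
    proof
      fix i assume "i \<in> keys m'"
      then have "i \<noteq> n" "i \<in> keys m" by (auto simp: in_keys_iff m' split: if_splits)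
      then show "i \<in> {..<n}" using m by auto
    qed
    then have "single m' c \<in> pols n" by (cases "c = 0") (auto simp: pols_def)
    ultimately show ?thesis using monom by simp
  qed
  have "(\<Sum>m\<in>S. single m (lookup p m)) \<in> pols (Suc n) \<and> H (\<Sum>m\<in>S. single m (lookup p m))"
    if "finite S" "S \<subseteq> keys p" for S
    using that
  proof (induction S rule: finite_induct)
    case empty
    show ?case using monom[of 0 0] by (simp add: pols_zero)
  next
    case (insert m S)
    then have "keys m \<subseteq> {..<Suc n}" using p by (auto simp: pols_def)
    then have "single m (lookup p m) \<in> pols (Suc n) \<and> H (single m (lookup p m))"
      using single by (auto simp: pols_def)
    with insert show ?case by (auto intro!: add pols_add)
  qed
  from this[of "keys p"] show ?thesis using sum_single[of p] by simp
qed

text \<open>Since \<open>t f \<equiv> 1\<close>, clearing the powers of \<open>t\<close> makes a polynomial in \<open>(x,t)\<close> congruent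
  to one in \<open>x\<close>.\<close>

lemma pols_Suc_reduce:
  assumes f: "f \<in> pols n" and p: "p \<in> pols (Suc n)"
  shows "\<exists>d. \<exists>p'\<in>pols n. \<exists>q\<in>pols (Suc n). f ^ d * p = p' + q * tf1 n f"
  using p
proof (induction rule: pols_Suc_induct)
  case (monom c j)
  let ?t = "pvar n :: 'a mpol"
  have t: "?t \<in> pols (Suc n)" by (simp add: pvar_pols)
  have f': "f \<in> pols (Suc n)" and c': "c \<in> pols (Suc n)" using f monom pols_mono by (metis le_add1 plus_1_eq_Suc add.commute)+
  have "\<exists>q\<in>pols (Suc n). (?t * f) ^ j = 1 + q * tf1 n f" for j
  proof (induction j)
    case 0
    show ?case by (rule bexI[of _ 0]) (simp_all add: pols_zero)
  next
    case (Suc j)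
    then obtain q where q: "q \<in> pols (Suc n)" "(?t * f) ^ j = 1 + q * tf1 n f" by blast
    show ?case
      by (rule bexI[of _ "q * (?t * f) + 1"])
         (simp_all add: q pols_add pols_mult pols_one t f', simp add: tf1_def algebra_simps)
  qed
  then obtain q where q: "q \<in> pols (Suc n)" "(?t * f) ^ j = 1 + q * tf1 n f" by blast
  have "f ^ j * (c * ?t ^ j) = c * (?t * f) ^ j" by (simp add: power_mult_distrib mult_ac)
  also have "\<dots> = c + (c * q) * tf1 n f" unfolding q(2) by (simp add: algebra_simps)
  finally show ?case using monom pols_mult[OF c' q(1)] by blast
next
  case (add p q)
  then obtain d p' p'' e q' q'' where *: "p' \<in> pols n" "p'' \<in> pols (Suc n)" "f ^ d * p = p' + p'' * tf1 n f"
    "q' \<in> pols n" "q'' \<in> pols (Suc n)" "f ^ e * q = q' + q'' * tf1 n f" by blast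
  have f': "f \<in> pols (Suc n)" using f by (rule pols_mono) simp
  have "f ^ (d + e) * (p + q) = f ^ e * (f ^ d * p) + f ^ d * (f ^ e * q)"
    by (simp add: power_add algebra_simps)
  also have "\<dots> = (f ^ e * p' + f ^ d * q') + (f ^ e * p'' + f ^ d * q'') * tf1 n f"
    unfolding * by (simp add: algebra_simps)
  finally have eq: "f ^ (d + e) * (p + q) = (f ^ e * p' + f ^ d * q') + (f ^ e * p'' + f ^ d * q'') * tf1 n f" .
  have "f ^ e * p' + f ^ d * q' \<in> pols n" "f ^ e * p'' + f ^ d * q'' \<in> pols (Suc n)"
    by (intro pols_add pols_mult pols_power * f f')+
  with eq show ?case by blast
qed

inductive_set del_span :: "nat \<Rightarrow> 'k::field weyl set \<Rightarrow> 'k weyl set" for n T where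
  base: "A \<in> T \<Longrightarrow> A \<in> del_span n T"
| add: "P \<in> del_span n T \<Longrightarrow> Q \<in> del_span n T \<Longrightarrow> P + Q \<in> del_span n T"
| del: "P \<in> del_span n T \<Longrightarrow> weyl_del n \<star> P \<in> del_span n T"

abbreviation del_pow :: "nat \<Rightarrow> nat \<Rightarrow> 'k::field weyl \<Rightarrow> 'k weyl" where
  "del_pow n k \<equiv> ((\<star>) (weyl_del n)) ^^ k"

lemma del_pow_add: "del_pow n k (P + Q) = del_pow n k P + del_pow n k Q"
  by (induction k) (simp_all add: weyl_mult_add_right)

lemma del_pow_0 [simp]: "del_pow n k 0 = 0"
  by (induction k) simp_all

text \<open>Zero coefficients are allowed and \<open>T\<close> is closed under addition, so two expansions can be brought
  to the same length.\<close>

lemma del_span_expand: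
  assumes Q: "Q \<in> del_span n T" and T0: "0 \<in> T" and T: "\<And>P Q. P \<in> T \<Longrightarrow> Q \<in> T \<Longrightarrow> P + Q \<in> T"
  shows "\<exists>m A. (\<forall>k. A k \<in> T) \<and> Q = (\<Sum>k<m. del_pow n k (A k))"
proof -
  have "\<exists>m A. (\<forall>k. A k \<in> T) \<and> (\<forall>k\<ge>m. A k = 0) \<and> Q = (\<Sum>k<m. del_pow n k (A k))"
    using Q
  proof (induction rule: del_span.induct)
    case (base A)
    show ?case
      by (rule exI[of _ 1], rule exI[of _ "\<lambda>k. if k = 0 then A else 0"]) (auto simp: base T0)
  next
    case (add P Q)
    then obtain m A l B where *: "\<forall>k. A k \<in> T" "\<forall>k\<ge>m. A k = 0" "P = (\<Sum>k<m. del_pow n k (A k))"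
      "\<forall>k. B k \<in> T" "\<forall>k\<ge>l. B k = 0" "Q = (\<Sum>k<l. del_pow n k (B k))" by blast
    have "P = (\<Sum>k<max m l. del_pow n k (A k))" "Q = (\<Sum>k<max m l. del_pow n k (B k))"
      unfolding * by (rule sum.mono_neutral_left; use * in auto)+
    then have "P + Q = (\<Sum>k<max m l. del_pow n k (A k + B k))"
      by (simp add: del_pow_add sum.distrib)
    then show ?case using * T
      by (intro exI[of _ "max m l"] exI[of _ "\<lambda>k. A k + B k"]) auto
  next
    case (del P)
    then obtain m A where *: "\<forall>k. A k \<in> T" "\<forall>k\<ge>m. A k = 0" "P = (\<Sum>k<m. del_pow n k (A k))" by blast
    define B where "B k = (case k of 0 \<Rightarrow> 0 | Suc k \<Rightarrow> A k)" for k
    have "weyl_del n \<star> P = (\<Sum>k<Suc m. del_pow n k (B k))"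
      by (simp only: sum.lessThan_Suc_shift) (simp add: B_def * weyl_mult_sum_right)
    moreover have "\<forall>k. B k \<in> T" "\<forall>k\<ge>Suc m. B k = 0" using * T0 by (auto simp: B_def split: nat.split)
    ultimately show ?case by blast
  qed
  then show ?thesis by blast
qed

text \<open>
  The ideal \<open>J\<close> of the theorem is analysed as an arbitrary left ideal of \<open>D\<^sub>Y\<close> that contains
  \<open>t f - 1\<close>; its other generators enter in the comparison with an annihilator.
\<close>

locale tf1_ideal =
  fixes n :: nat and f :: "'k::field_char_0 mpol" and J :: "'k weyl set"
  assumes f: "f \<in> pols n"
    and J: "left_ideal J (weyl_algebra (Suc n))"
    and tf1_J: "weyl_pol (tf1 n f) \<in> J"
begin

abbreviation "S \<equiv> tf1 n f"
abbreviation "t \<equiv> pvar n :: 'k mpol"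

lemma J_sub: "add_subgroup J" and J_W: "J \<subseteq> W (Suc n)"
  and J_mult: "P \<in> W (Suc n) \<Longrightarrow> Q \<in> J \<Longrightarrow> P \<star> Q \<in> J"
  using J by (auto simp: left_ideal_weyl_iff)

lemmas J_closed = add_subgroup_closed[OF J_sub]

lemma f_Suc: "f \<in> pols (Suc n)" and t_pols: "t \<in> pols (Suc n)" and S_pols: "S \<in> pols (Suc n)"
  using f by (auto intro: pols_mono pvar_pols tf1_pols)

lemma pol_J: "p \<in> pols (Suc n) \<Longrightarrow> Q \<in> J \<Longrightarrow> weyl_pol p \<star> Q \<in> J"
  by (simp add: J_mult)

lemma del_J: "Q \<in> J \<Longrightarrow> weyl_del n \<star> Q \<in> J"
  by (simp add: J_mult)

text \<open>On the classes killed by \<open>t f - 1\<close>, multiplication with \<open>t\<close> is inverse to that with \<open>f\<close>.\<close>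

lemma J_cancel_f:
  assumes "weyl_pol S \<star> A \<in> J" "weyl_pol (f ^ k) \<star> A \<in> J"
  shows "A \<in> J"
proof -
  have "weyl_pol ((t * f) ^ k) \<star> A - A \<in> J"
  proof (induction k)
    case 0
    show ?case by (simp add: weyl_pol_1 weyl_mult_1_left J_closed)
  next
    case (Suc k)
    have "(t * f) ^ Suc k = (t * f) ^ k * S + (t * f) ^ k"
      by (simp add: tf1_def algebra_simps)
    then have "weyl_pol ((t * f) ^ Suc k) \<star> A = weyl_pol ((t * f) ^ k) \<star> (weyl_pol S \<star> A) + weyl_pol ((t * f) ^ k) \<star> A"
      by (simp only: weyl_pol_pol_mult weyl_pol_add weyl_mult_add_left)
    moreover have "weyl_pol ((t * f) ^ k) \<star> (weyl_pol S \<star> A) \<in> J"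
      by (intro pol_J pols_power pols_mult t_pols f_Suc assms)
    ultimately show ?case using Suc J_closed(4) by (simp add: add_diff_eq[symmetric])
  qed
  moreover have "weyl_pol ((t * f) ^ k) \<star> A \<in> J"
    using pol_J[OF pols_power[OF t_pols] assms(2), of k] by (simp add: weyl_pol_pol_mult power_mult_distrib)
  ultimately show ?thesis using J_closed(2)[of "weyl_pol ((t * f) ^ k) \<star> A" "weyl_pol ((t * f) ^ k) \<star> A - A"] by simp
qed

text \<open>The operators that modulo \<open>J\<close> are killed by \<open>t f - 1\<close> and become of the form \<open>\<tau>(P)\<close> after
  multiplication with a power of \<open>f\<close>; modulo \<open>J\<close> they are the operators \<open>t\<^sup>e \<tau>(P)\<close>.\<close>

definition reduced :: "'k weyl set" where
  "reduced = {A \<in> W (Suc n). weyl_pol S \<star> A \<in> J \<and> (\<exists>k. \<exists>P\<in>W n. weyl_pol (f ^ k) \<star> A - tau n f P \<in> J)}"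

lemma reducedI:
  "A \<in> W (Suc n) \<Longrightarrow> weyl_pol S \<star> A \<in> J \<Longrightarrow> P \<in> W n \<Longrightarrow> weyl_pol (f ^ k) \<star> A - tau n f P \<in> J \<Longrightarrow> A \<in> reduced"
  by (auto simp: reduced_def)

lemma reducedE:
  assumes "A \<in> reduced"
  obtains k P where "A \<in> W (Suc n)" "weyl_pol S \<star> A \<in> J" "P \<in> W n"
    "\<And>l. weyl_pol (f ^ (l + k)) \<star> A - tau n f (weyl_pol (f ^ l) \<star> P) \<in> J"
proof -
  from assms obtain k P where *: "A \<in> W (Suc n)" "weyl_pol S \<star> A \<in> J" "P \<in> W n"
    "weyl_pol (f ^ k) \<star> A - tau n f P \<in> J" by (auto simp: reduced_def)
  have "weyl_pol (f ^ (l + k)) \<star> A - tau n f (weyl_pol (f ^ l) \<star> P) \<in> J" for l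
    using pol_J[OF pols_power[OF f_Suc] *(4), of l] tau_pol[OF f pols_power[OF f] *(3), of l]
    by (simp add: weyl_mult_diff_right weyl_pol_pol_mult power_add)
  with * that show thesis by blast
qed

lemma J_reduced: "A \<in> J \<Longrightarrow> A \<in> reduced"
  using J_W pol_J[OF S_pols, of A] tau_diff[OF f weyl_1_closed weyl_1_closed]
  by (intro reducedI[of A 0 0]) (auto simp: weyl_carrier_zero weyl_pol_1 weyl_mult_1_left)

lemma one_reduced: "1 \<in> reduced"
  by (rule reducedI[of 1 1 0]) (auto simp: weyl_mult_1_right tf1_J weyl_pol_1 tau_1[OF f] J_closed)

lemma reduced_add:
  assumes "A \<in> reduced" "B \<in> reduced" shows "A + B \<in> reduced"
proof -
  obtain k P where A: "A \<in> W (Suc n)" "weyl_pol S \<star> A \<in> J" "P \<in> W n"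
    "\<And>l. weyl_pol (f ^ (l + k)) \<star> A - tau n f (weyl_pol (f ^ l) \<star> P) \<in> J" by (rule reducedE[OF assms(1)]) (rule that)
  obtain j Q where B: "B \<in> W (Suc n)" "weyl_pol S \<star> B \<in> J" "Q \<in> W n"
    "\<And>l. weyl_pol (f ^ (l + j)) \<star> B - tau n f (weyl_pol (f ^ l) \<star> Q) \<in> J" by (rule reducedE[OF assms(2)]) (rule that)
  let ?P = "weyl_pol (f ^ j) \<star> P" and ?Q = "weyl_pol (f ^ k) \<star> Q"
  have PQ: "?P \<in> W n" "?Q \<in> W n" using A B f by (auto intro!: weyl_carrier_mult weyl_pol_closed pols_power)
  have "weyl_pol (f ^ (j + k)) \<star> (A + B) - tau n f (?P + ?Q) =
      (weyl_pol (f ^ (j + k)) \<star> A - tau n f ?P) + (weyl_pol (f ^ (k + j)) \<star> B - tau n f ?Q)"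
    by (simp add: tau_add[OF f PQ] weyl_mult_add_right add.commute[of j k])
  also have "\<dots> \<in> J" by (intro J_closed A B)
  finally show ?thesis
    by (intro reducedI[of _ "?P + ?Q"]) (use A B PQ in \<open>auto simp: weyl_carrier_add weyl_mult_add_right J_closed\<close>)
qed

lemma reduced_pol:
  assumes p: "p \<in> pols (Suc n)" and "A \<in> reduced" shows "weyl_pol p \<star> A \<in> reduced"
proof -
  obtain k P where A: "A \<in> W (Suc n)" "weyl_pol S \<star> A \<in> J" "P \<in> W n"
    "\<And>l. weyl_pol (f ^ (l + k)) \<star> A - tau n f (weyl_pol (f ^ l) \<star> P) \<in> J" by (rule reducedE[OF assms(2)]) (rule that)
  obtain d p' q where d: "p' \<in> pols n" "q \<in> pols (Suc n)" "f ^ d * p = p' + q * S"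
    using pols_Suc_reduce[OF f p] by blast
  have fp: "f ^ (d + k) * p = p' * f ^ k + q * f ^ k * S"
    using arg_cong[OF d(3), of "\<lambda>r. f ^ k * r"] by (simp add: power_add algebra_simps)
  have tP: "tau n f P \<in> W (Suc n)" by (rule tau_closed[OF f A(3)])
  have p': "p' \<in> pols (Suc n)" using d by (auto intro: pols_mono)
  have "weyl_pol (f ^ (d + k)) \<star> (weyl_pol p \<star> A) - tau n f (weyl_pol p' \<star> P) =
     weyl_pol p' \<star> (weyl_pol (f ^ k) \<star> A - tau n f P) + weyl_pol (q * f ^ k) \<star> (weyl_pol S \<star> A)"
    by (simp add: weyl_pol_pol_mult fp weyl_pol_add weyl_distribs tau_pol[OF f d(1) A(3)])
  also have "\<dots> \<in> J"
  proof (rule J_closed(4))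
    have "weyl_pol (f ^ k) \<star> A - tau n f P \<in> J" using A(4)[of 0] by (simp add: weyl_pol_1 weyl_mult_1_left)
    then show "weyl_pol p' \<star> (weyl_pol (f ^ k) \<star> A - tau n f P) \<in> J" by (rule pol_J[OF p'])
    show "weyl_pol (q * f ^ k) \<star> (weyl_pol S \<star> A) \<in> J"
      by (rule pol_J[OF pols_mult[OF d(2) pols_power[OF f_Suc]] A(2)])
  qed
  finally have "weyl_pol (f ^ (d + k)) \<star> (weyl_pol p \<star> A) - tau n f (weyl_pol p' \<star> P) \<in> J" .
  moreover have "weyl_pol S \<star> (weyl_pol p \<star> A) \<in> J"
    using pol_J[OF p A(2)] by (simp add: weyl_pol_pol_mult mult.commute)
  ultimately show ?thesis
    using A p d by (intro reducedI[of _ "weyl_pol p' \<star> P"]) (auto intro: weyl_carrier_mult)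
qed

text \<open>Moving \<open>\<theta>\<^sub>i\<close> past a power of \<open>f\<close> costs one power:
  \<open>f\<^sup>k\<^sup>+\<^sup>1 \<theta>\<^sub>i = \<theta>\<^sub>i f\<^sup>k\<^sup>+\<^sup>1 - (k + 1) f\<^sub>i f\<^sup>k\<close>.  This is why \<open>f\<^sup>k A\<close> is compared with \<open>\<tau>(P)\<close> for large \<open>k\<close>.\<close>

lemma reduced_theta:
  assumes i: "i < n" and "A \<in> reduced" shows "theta n f i \<star> A \<in> reduced"
proof -
  obtain k P where A: "A \<in> W (Suc n)" "weyl_pol S \<star> A \<in> J" "P \<in> W n"
    "\<And>l. weyl_pol (f ^ (l + k)) \<star> A - tau n f (weyl_pol (f ^ l) \<star> P) \<in> J" by (rule reducedE[OF assms(2)]) (rule that)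
  note th = theta_closed[OF f i]
  let ?g = "of_nat (Suc k) * pdiff i f"
  have g: "?g \<in> pols n" by (intro pols_mult pols_of_nat pols_pdiff f)
  have fP: "weyl_pol f \<star> P \<in> W n" by (rule weyl_carrier_mult[OF weyl_pol_closed[OF f] A(3)])
  let ?Q = "weyl_del i \<star> (weyl_pol f \<star> P) - weyl_pol ?g \<star> P"
  have Q: "?Q \<in> W n"
    by (intro weyl_diff_closed weyl_carrier_mult weyl_del_closed weyl_pol_closed f g i A)
  have tQ: "tau n f ?Q = theta n f i \<star> tau n f (weyl_pol f \<star> P) - weyl_pol ?g \<star> tau n f P"
    by (simp only: tau_diff[OF f weyl_carrier_mult[OF weyl_del_closed[OF i] fP] weyl_carrier_mult[OF weyl_pol_closed[OF g] A(3)]]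
      tau_del[OF f i fP] tau_pol[OF f g A(3)])
  have "weyl_pol (f ^ Suc k) \<star> (theta n f i \<star> A) =
      theta n f i \<star> (weyl_pol (f ^ Suc k) \<star> A) - weyl_pol (?g * f ^ k) \<star> A"
    unfolding theta_pol[OF f pols_power[OF f]] pdiff_power by (simp add: mult_ac)
  then have "weyl_pol (f ^ Suc k) \<star> (theta n f i \<star> A) - tau n f ?Q =
      theta n f i \<star> (weyl_pol (f ^ (1 + k)) \<star> A - tau n f (weyl_pol (f ^ 1) \<star> P)) -
      weyl_pol ?g \<star> (weyl_pol (f ^ k) \<star> A - tau n f P)"
    unfolding tQ by (simp add: weyl_distribs weyl_pol_pol_mult del: of_nat_Suc)
  also have "\<dots> \<in> J"
  proof (rule J_closed(2))
    show "theta n f i \<star> (weyl_pol (f ^ (1 + k)) \<star> A - tau n f (weyl_pol (f ^ 1) \<star> P)) \<in> J"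
      by (rule J_mult[OF th A(4)])
    have "weyl_pol (f ^ k) \<star> A - tau n f P \<in> J" using A(4)[of 0] by (simp add: weyl_pol_1 weyl_mult_1_left)
    then show "weyl_pol ?g \<star> (weyl_pol (f ^ k) \<star> A - tau n f P) \<in> J"
      by (rule pol_J[OF pols_mono[OF g le_SucI[OF le_refl]]])
  qed
  finally have "weyl_pol (f ^ Suc k) \<star> (theta n f i \<star> A) - tau n f ?Q \<in> J" .
  moreover have "weyl_pol S \<star> (theta n f i \<star> A) \<in> J"
    unfolding tf1_theta[OF f i]
    by (intro J_closed J_mult[OF th] pol_J A pols_mult t_pols pols_mono[OF pols_pdiff[OF f]]) simp
  ultimately show ?thesis by (intro reducedI[OF weyl_carrier_mult[OF th A(1)] _ Q])
qed

lemma del_span_pol: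
  assumes "Q \<in> del_span n reduced" "p \<in> pols (Suc n)"
  shows "weyl_pol p \<star> Q \<in> del_span n reduced"
  using assms
proof (induction arbitrary: p rule: del_span.induct)
  case (base A)
  then show ?case by (intro del_span.base reduced_pol)
next
  case (add P Q)
  then show ?case unfolding weyl_mult_add_right by (intro del_span.add) auto
next
  case (del Q)
  have "weyl_pol p \<star> (weyl_del n \<star> Q) = weyl_del n \<star> (weyl_pol p \<star> Q) + weyl_pol (- pdiff n p) \<star> Q"
    by (simp add: weyl_del_pol_mult weyl_pol_minus weyl_mult_minus_left)
  then show ?case
    using del by (auto intro!: del_span.add del_span.del del.IH pols_minus pols_pdiff)
qed

text \<open>Only \<open>i < n\<close> needs an argument: \<open>\<partial>\<^sub>i = \<theta>\<^sub>i + f\<^sub>i \<partial>\<^sub>t t\<^sup>2\<close> reduces \<open>\<partial>\<^sub>i\<close> to operators that are known to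
  preserve the span.\<close>

lemma del_span_del:
  assumes "Q \<in> del_span n reduced" "i < Suc n"
  shows "weyl_del i \<star> Q \<in> del_span n reduced"
proof (cases "i = n")
  case True
  then show ?thesis using assms by (simp add: del_span.del)
next
  case False
  then have i: "i < n" using assms by simp
  show ?thesis using assms(1)
  proof (induction rule: del_span.induct)
    case (base A)
    have "weyl_del i \<star> A = theta n f i \<star> A +
        weyl_pol (pdiff i f) \<star> (weyl_del n \<star> (weyl_pol (t ^ 2) \<star> A))"
      by (simp add: theta_mult)
    moreover have "weyl_pol (pdiff i f) \<star> (weyl_del n \<star> (weyl_pol (t ^ 2) \<star> A)) \<in> del_span n reduced"
      by (intro del_span_pol del_span.del del_span.base[OF base] pols_power t_pols pols_pdiff f_Suc)
    ultimately show ?case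
      by (simp add: del_span.add del_span.base[OF reduced_theta[OF i base]])
  next
    case (add P Q)
    then show ?case unfolding weyl_mult_add_right by (intro del_span.add)
  next
    case (del Q)
    then show ?case unfolding weyl_del_del_mult[of i n] by (intro del_span.del)
  qed
qed

lemma W_del_span: "Q \<in> W (Suc n) \<Longrightarrow> Q \<in> del_span n reduced"
  by (induction rule: weyl_gen_induct)
     (auto intro: del_span.base one_reduced del_span.add del_span_pol del_span_del)

text \<open>
  From \<open>(t f - 1) \<partial>\<^sub>t\<^sup>k = \<partial>\<^sub>t\<^sup>k (t f - 1) - k f \<partial>\<^sub>t\<^sup>k\<^sup>-\<^sup>1\<close>: each factor \<open>t f - 1\<close> removes one \<open>\<partial>\<^sub>t\<close> and leaves a factor
  \<open>- k f\<close>.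
\<close>

lemma S_del_pow:
  assumes A: "A \<in> W (Suc n)" "weyl_pol S \<star> A \<in> J"
  shows "weyl_pol (S ^ Suc k) \<star> del_pow n k A \<in> J"
    and "weyl_pol (S ^ k) \<star> del_pow n k A - weyl_pol ((-1) ^ k * fact k * f ^ k) \<star> A \<in> J"
proof -
  have comm: "weyl_pol S \<star> del_pow n k A = del_pow n k (weyl_pol S \<star> A) - weyl_pol (of_nat k * f) \<star> del_pow n (k - 1) A" for k
  proof (induction k)
    case (Suc k)
    have "weyl_pol S \<star> del_pow n (Suc k) A =
        weyl_del n \<star> (weyl_pol S \<star> del_pow n k A) - weyl_pol f \<star> del_pow n k A"
      by (simp add: weyl_del_pol_mult pdiff_tf1 f)
    also have "\<dots> = del_pow n (Suc k) (weyl_pol S \<star> A)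
        - weyl_del n \<star> (weyl_pol (of_nat k * f) \<star> del_pow n (k - 1) A) - weyl_pol f \<star> del_pow n k A"
      unfolding Suc by (simp add: weyl_distribs)
    also have "weyl_del n \<star> (weyl_pol (of_nat k * f) \<star> del_pow n (k - 1) A) = weyl_pol (of_nat k * f) \<star> del_pow n k A"
      using pols_pdiff_eq_0[OF pols_mult[OF pols_of_nat f], of n k]
      by (cases k) (simp_all add: weyl_del_pol_mult weyl_mult_0_left)
    finally show ?case by (simp add: weyl_distribs weyl_pol_add algebra_simps)
  qed (simp add: weyl_mult_0_left)
  have in_J: "weyl_pol p \<star> del_pow n k (weyl_pol S \<star> A) \<in> J" if "p \<in> pols (Suc n)" for p k
    by (rule pol_J[OF that]) (induction k, auto intro: A del_J)
  show "weyl_pol (S ^ Suc k) \<star> del_pow n k A \<in> J" for k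
  proof (induction k)
    case (Suc k)
    have "weyl_pol (S ^ Suc (Suc k)) \<star> del_pow n (Suc k) A =
        weyl_pol (S ^ Suc k) \<star> (weyl_pol S \<star> del_pow n (Suc k) A)"
      by (simp only: weyl_pol_pol_mult power_Suc mult_ac)
    also have "\<dots> = weyl_pol (S ^ Suc k) \<star> del_pow n (Suc k) (weyl_pol S \<star> A) -
        weyl_pol (of_nat (Suc k) * f) \<star> (weyl_pol (S ^ Suc k) \<star> del_pow n k A)"
      unfolding comm by (simp only: weyl_mult_diff_right weyl_pol_pol_mult mult_ac diff_Suc_1)
    also have "\<dots> \<in> J"
      by (intro J_closed in_J pol_J Suc pols_power S_pols pols_mult pols_of_nat f_Suc)
    finally show ?case .
  qed (simp add: A)
  show "weyl_pol (S ^ k) \<star> del_pow n k A - weyl_pol ((-1) ^ k * fact k * f ^ k) \<star> A \<in> J"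
  proof (induction k)
    case 0
    show ?case by (simp add: J_closed)
  next
    case (Suc k)
    let ?c = "- (of_nat (Suc k) * f)"
    have c: "(-1) ^ Suc k * fact (Suc k) * f ^ Suc k = ?c * ((-1) ^ k * fact k * f ^ k)"
      by (simp add: algebra_simps)
    have "weyl_pol (S ^ Suc k) \<star> del_pow n (Suc k) A = weyl_pol (S ^ k) \<star> (weyl_pol S \<star> del_pow n (Suc k) A)"
      by (simp only: weyl_pol_pol_mult power_Suc mult_ac)
    also have "\<dots> = weyl_pol (S ^ k) \<star> del_pow n (Suc k) (weyl_pol S \<star> A) +
        weyl_pol ?c \<star> (weyl_pol (S ^ k) \<star> del_pow n k A)"
      unfolding comm by (simp only: weyl_distribs weyl_pol_minus weyl_pol_pol_mult mult_ac diff_Suc_1 diff_conv_add_uminus)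
    finally have "weyl_pol (S ^ Suc k) \<star> del_pow n (Suc k) A - weyl_pol ((-1) ^ Suc k * fact (Suc k) * f ^ Suc k) \<star> A =
        weyl_pol (S ^ k) \<star> del_pow n (Suc k) (weyl_pol S \<star> A) +
        weyl_pol ?c \<star> (weyl_pol (S ^ k) \<star> del_pow n k A - weyl_pol ((-1) ^ k * fact k * f ^ k) \<star> A)"
      unfolding c by (simp only: weyl_mult_diff_right weyl_pol_pol_mult add_diff_eq)
    also have "\<dots> \<in> J"
      by (intro J_closed in_J pol_J Suc pols_power S_pols pols_mult pols_of_nat pols_minus f_Suc)
    finally show ?case .
  qed
qed

text \<open>
  Multiplying \<open>\<Sum>\<^sub>k\<^sub>\<le>\<^sub>m \<partial>\<^sub>t\<^sup>k A\<^sub>k \<in> L\<close> by \<open>(t f - 1)\<^sup>m\<close> isolates \<open>(-1)\<^sup>m m! f\<^sup>m A\<^sub>m\<close>, so the hypothesis on reduced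
  operators applies to the top coefficient; after its removal the sum is shorter.
\<close>

lemma eq_if_reduced_subset:
  assumes L: "left_ideal L (weyl_algebra (Suc n))" and JL: "J \<subseteq> L" and red: "reduced \<inter> L \<subseteq> J"
  shows "L = J"
proof
  show "J \<subseteq> L" by (rule JL)
  have L_sub: "add_subgroup L" and L_mult: "P \<in> W (Suc n) \<Longrightarrow> Q \<in> L \<Longrightarrow> P \<star> Q \<in> L" and LW: "L \<subseteq> W (Suc n)" for P Q
    using L by (auto simp: left_ideal_weyl_iff)
  have main: "(\<Sum>k<m. del_pow n k (A k)) \<in> J" if "\<And>k. A k \<in> reduced" "(\<Sum>k<m. del_pow n k (A k)) \<in> L" for m A
    using that
  proof (induction m)
    case 0
    show ?case by (simp add: J_closed)
  next
    case (Suc m)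
    let ?R = "\<Sum>k<m. del_pow n k (A k)" and ?B = "del_pow n m (A m)"
    have A: "A k \<in> W (Suc n)" "weyl_pol S \<star> A k \<in> J" for k
      using Suc.prems(1)[of k] by (auto elim: reducedE)
    have "weyl_pol (S ^ m) \<star> del_pow n k (A k) \<in> J" if "k < m" for k
    proof -
      have "weyl_pol (S ^ m) \<star> del_pow n k (A k) = weyl_pol (S ^ (m - Suc k)) \<star> (weyl_pol (S ^ Suc k) \<star> del_pow n k (A k))"
        using that by (simp only: weyl_pol_pol_mult flip: power_add) simp
      then show ?thesis using pol_J[OF pols_power[OF S_pols] S_del_pow(1)[OF A]] by simp
    qed
    then have R: "weyl_pol (S ^ m) \<star> ?R \<in> J"
      unfolding weyl_mult_sum_right by (intro add_subgroup_sum J_sub) auto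
    \<comment> \<open>only the top term survives the multiplication with \<open>S ^ m\<close>\<close>
    let ?c = "(-1) ^ m * fact m :: 'k mpol"
    have "weyl_pol (S ^ m) \<star> (?R + ?B) \<in> L"
      using Suc.prems(2) by (intro L_mult weyl_pol_closed pols_power S_pols) simp
    then have "weyl_pol (S ^ m) \<star> ?B \<in> L"
      using add_subgroup_diff[OF L_sub _ subsetD[OF JL R], of "weyl_pol (S ^ m) \<star> (?R + ?B)"]
      by (simp add: weyl_mult_add_right)
    then have "weyl_pol (?c * f ^ m) \<star> A m \<in> L"
      using add_subgroup_diff[OF L_sub _ subsetD[OF JL S_del_pow(2)[OF A]], of "weyl_pol (S ^ m) \<star> ?B" m m] by simp
    moreover have c: "?c \<in> pols (Suc n)"
    proof -
      have "(of_nat (fact m) :: 'k mpol) \<in> pols (Suc n)" by (rule pols_of_nat)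
      then show ?thesis by (intro pols_mult pols_power pols_minus pols_one) (simp only: of_nat_fact)
    qed
    then have "weyl_pol (?c * f ^ m) \<star> A m \<in> reduced"
      using reduced_pol[OF pols_mult[OF c pols_power[OF f_Suc]] Suc.prems(1)] by blast
    ultimately have cA: "weyl_pol (?c * f ^ m) \<star> A m \<in> J" using red by auto
    \<comment> \<open>the inverse of \<open>?c\<close>, which exists in characteristic zero\<close>
    let ?d = "(-1) ^ m * single 0 (inverse (fact m)) :: 'k mpol"
    have "single 0 (inverse (fact m)) * fact m = (1 :: 'k mpol)"
    proof -
      have "(of_nat (fact m) :: 'k mpol) = single 0 (of_nat (fact m))" by (rule of_nat_eq_single)
      then have "(fact m :: 'k mpol) = single 0 (fact m)" by (simp only: of_nat_fact)
      then show ?thesis by (simp add: mult_single)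
    qed
    moreover have "?d * ?c = ((-1) ^ m * (-1) ^ m) * (single 0 (inverse (fact m)) * fact m)"
      by (simp only: mult_ac)
    ultimately have dc: "?d * ?c = 1"
      by (simp flip: power_mult_distrib)
    have d: "?d \<in> pols (Suc n)"
      by (intro pols_mult pols_power pols_minus pols_one) (auto simp: pols_def)
    have "weyl_pol (f ^ m) \<star> A m \<in> J"
      using pol_J[OF d cA] dc by (simp only: weyl_pol_pol_mult mult.assoc[symmetric] mult_1_left)
    then have "A m \<in> J" by (rule J_cancel_f[OF A(2)])
    then have "del_pow n k (A m) \<in> J" for k by (induction k) (auto intro: del_J)
    then have B: "?B \<in> J" .
    then have "?R \<in> L"
      using add_subgroup_diff[OF L_sub Suc.prems(2) subsetD[OF JL B]] by simp
    then have "?R \<in> J" using Suc by blast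
    then show ?case using B by (simp add: J_closed)
  qed
  show "L \<subseteq> J"
  proof
    fix Q assume Q: "Q \<in> L"
    then have "Q \<in> del_span n reduced" using LW by (blast intro: W_del_span)
    from del_span_expand[OF this J_reduced[OF J_closed(1)] reduced_add]
    obtain m A where "\<forall>k. A k \<in> reduced" "Q = (\<Sum>k<m. del_pow n k (A k))" by blast
    with Q show "Q \<in> J" using main by blast
  qed
qed

end

section \<open>Left modules and a criterion for the annihilator\<close>

context left_module
begin

lemma smult_zero_left: "x \<in> carrier M \<Longrightarrow> \<zero> \<odot>\<^bsub>M\<^esub> x = \<zero>\<^bsub>M\<^esub>"
  using smult_l_distr[of \<zero> \<zero> x] smult_closed[of \<zero> x] by (simp add: M.add.l_cancel_one)

lemma smult_zero_right: "a \<in> carrier R \<Longrightarrow> a \<odot>\<^bsub>M\<^esub> \<zero>\<^bsub>M\<^esub> = \<zero>\<^bsub>M\<^esub>"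
  using smult_r_distr[of a "\<zero>\<^bsub>M\<^esub>" "\<zero>\<^bsub>M\<^esub>"] smult_closed[of a "\<zero>\<^bsub>M\<^esub>"]
  by (simp add: M.add.l_cancel_one)

lemma smult_minus_left:
  assumes "a \<in> carrier R" "x \<in> carrier M" shows "(\<ominus> a) \<odot>\<^bsub>M\<^esub> x = \<ominus>\<^bsub>M\<^esub> (a \<odot>\<^bsub>M\<^esub> x)"
proof -
  have "(\<ominus> a) \<odot>\<^bsub>M\<^esub> x \<oplus>\<^bsub>M\<^esub> a \<odot>\<^bsub>M\<^esub> x = \<zero>\<^bsub>M\<^esub>"
    using smult_l_distr[of "\<ominus> a" a x] assms by (simp add: R.l_neg smult_zero_left)
  then show ?thesis using assms smult_closed by (simp add: M.minus_equality)
qed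

text \<open>A cyclic module is the quotient of the ring by the annihilator of its generator: \<open>x\<close>
  corresponds to the coset of all scalars that map the generator to \<open>x\<close>.\<close>

lemma cyclic_iso_quotient:
  assumes v: "v \<in> carrier M" and cyc: "carrier M = cyclic_submodule R M v"
  shows "left_module_iso R M (quot_module (regular_module R) (annihilator R M v)) \<noteq> {}"
proof -
  let ?I = "annihilator R M v" and ?R = "regular_module R"
  let ?Q = "quot_module ?R ?I"
  define \<phi> where "\<phi> x = {a \<in> carrier R. a \<odot>\<^bsub>M\<^esub> v = x}" for x
  have I: "b \<in> ?I \<longleftrightarrow> b \<in> carrier R \<and> b \<odot>\<^bsub>M\<^esub> v = \<zero>\<^bsub>M\<^esub>" for b by (simp add: annihilator_def)
  have coset: "?I +>\<^bsub>?R\<^esub> a = \<phi> (a \<odot>\<^bsub>M\<^esub> v)" if a: "a \<in> carrier R" for a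
  proof (intro subset_antisym subsetI)
    fix b assume "b \<in> ?I +>\<^bsub>?R\<^esub> a"
    then obtain h where h: "h \<in> ?I" "b = h \<oplus> a" by (auto simp: a_r_coset_def r_coset_def regular_module_def)
    then show "b \<in> \<phi> (a \<odot>\<^bsub>M\<^esub> v)" using a v by (simp add: \<phi>_def I smult_l_distr smult_closed)
  next
    fix b assume b: "b \<in> \<phi> (a \<odot>\<^bsub>M\<^esub> v)"
    then have "b \<oplus> \<ominus> a \<in> ?I" "b = (b \<oplus> \<ominus> a) \<oplus> a"
      using a v by (auto simp: \<phi>_def I smult_l_distr smult_minus_left smult_closed M.r_neg R.a_assoc R.l_neg)
    then show "b \<in> ?I +>\<^bsub>?R\<^esub> a" by (auto simp: a_r_coset_def r_coset_def regular_module_def)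
  qed
  have Q_carrier: "carrier ?Q = \<phi> ` carrier M"
  proof -
    have "carrier ?Q = (\<lambda>a. ?I +>\<^bsub>?R\<^esub> a) ` carrier R"
      by (auto simp: quot_module_def A_RCOSETS_def RCOSETS_def a_r_coset_def regular_module_def)
    also have "\<dots> = (\<lambda>a. \<phi> (a \<odot>\<^bsub>M\<^esub> v)) ` carrier R" using coset by simp
    also have "\<dots> = \<phi> ` carrier M" by (simp add: cyc cyclic_submodule_def image_image)
    finally show ?thesis .
  qed
  have ex: "\<exists>a\<in>carrier R. a \<odot>\<^bsub>M\<^esub> v = x" if "x \<in> carrier M" for x
    using that cyc by (auto simp: cyclic_submodule_def)
  have inj: "inj_on \<phi> (carrier M)"
  proof (rule inj_onI)
    fix x y assume "x \<in> carrier M" "\<phi> x = \<phi> y"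
    moreover from ex[OF this(1)] obtain a where "a \<in> \<phi> x" by (auto simp: \<phi>_def)
    ultimately show "x = y" by (auto simp: \<phi>_def)
  qed
  have add: "\<phi> (x \<oplus>\<^bsub>M\<^esub> y) = \<phi> x \<oplus>\<^bsub>?Q\<^esub> \<phi> y" if x: "x \<in> carrier M" and y: "y \<in> carrier M" for x y
  proof -
    obtain b where b: "b \<in> carrier R" "b \<odot>\<^bsub>M\<^esub> v = y" using ex[OF y] by blast
    have "\<phi> x \<oplus>\<^bsub>?Q\<^esub> \<phi> y = {a \<oplus> b |a b. a \<in> \<phi> x \<and> b \<in> \<phi> y}"
      by (auto simp: quot_module_def set_add_def set_mult_def regular_module_def)
    also have "\<dots> = \<phi> (x \<oplus>\<^bsub>M\<^esub> y)"
    proof (intro subset_antisym subsetI)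
      fix c assume c: "c \<in> \<phi> (x \<oplus>\<^bsub>M\<^esub> y)"
      then have "c \<oplus> \<ominus> b \<in> \<phi> x" "c = (c \<oplus> \<ominus> b) \<oplus> b"
        using b v x y by (auto simp: \<phi>_def smult_l_distr smult_minus_left smult_closed M.r_neg M.a_assoc R.a_assoc R.l_neg)
      moreover have "b \<in> \<phi> y" using b by (simp add: \<phi>_def)
      ultimately show "c \<in> {a \<oplus> b |a b. a \<in> \<phi> x \<and> b \<in> \<phi> y}" by blast
    qed (use v in \<open>auto simp: \<phi>_def smult_l_distr\<close>)
    finally show ?thesis by simp
  qed
  have smult: "\<phi> (a \<odot>\<^bsub>M\<^esub> x) = a \<odot>\<^bsub>?Q\<^esub> \<phi> x" if a: "a \<in> carrier R" and x: "x \<in> carrier M" for a x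
  proof -
    have "a \<odot>\<^bsub>?Q\<^esub> \<phi> x = (\<Union>b\<in>\<phi> x. ?I +>\<^bsub>?R\<^esub> (a \<otimes> b))"
      by (simp add: quot_module_def regular_module_def)
    also have "\<dots> = (\<Union>b\<in>\<phi> x. \<phi> (a \<odot>\<^bsub>M\<^esub> x))"
      by (rule SUP_cong) (use a v in \<open>auto simp: coset \<phi>_def smult_assoc\<close>)
    also have "\<dots> = \<phi> (a \<odot>\<^bsub>M\<^esub> x)" using ex[OF x] by (auto simp: \<phi>_def)
    finally show ?thesis by simp
  qed
  have "\<phi> \<in> left_module_iso R M ?Q"
    using inj add smult by (auto simp: left_module_iso_def bij_betw_def Q_carrier)
  then show ?thesis by blast
qed

end

lemma left_ideal_annihilator:
  assumes "left_module (weyl_algebra n) M" "v \<in> carrier M"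
  shows "left_ideal (annihilator (weyl_algebra n) M v) (weyl_algebra n)"
proof -
  interpret left_module "weyl_algebra n" M by (rule assms)
  have neg: "\<ominus>\<^bsub>weyl_algebra n\<^esub> P = - P" if "P \<in> W n" for P :: "'a weyl"
    by (rule R.minus_equality) (use that in \<open>simp_all add: weyl_closed weyl_algebra_simps\<close>)
  have diff: "(P - Q) \<odot>\<^bsub>M\<^esub> v = P \<odot>\<^bsub>M\<^esub> v \<ominus>\<^bsub>M\<^esub> Q \<odot>\<^bsub>M\<^esub> v" if "P \<in> W n" "Q \<in> W n" for P Q
    using smult_l_distr[of P "- Q" v] smult_minus_left[of Q v] that assms(2) neg[of Q]
    by (simp add: weyl_algebra_simps weyl_closed M.minus_eq)
  show ?thesis
    using smult_zero_left[OF assms(2)] assms(2) smult_assoc[of _ _ v]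
    by (auto simp: left_ideal_weyl_iff annihilator_def weyl_algebra_simps weyl_closed diff M.r_neg
        smult_zero_right M.minus_eq intro!: add_subgroupI)
qed

lemma weyl_module_relations:
  assumes M: "left_module (weyl_algebra n) M"
  shows "p \<in> pols n \<Longrightarrow> q \<in> pols n \<Longrightarrow> m \<in> carrier M \<Longrightarrow>
      weyl_pol p \<odot>\<^bsub>M\<^esub> (weyl_pol q \<odot>\<^bsub>M\<^esub> m) = weyl_pol (p * q) \<odot>\<^bsub>M\<^esub> m"
    and "p \<in> pols n \<Longrightarrow> i < n \<Longrightarrow> m \<in> carrier M \<Longrightarrow> weyl_del i \<odot>\<^bsub>M\<^esub> (weyl_pol p \<odot>\<^bsub>M\<^esub> m) =
      weyl_pol p \<odot>\<^bsub>M\<^esub> (weyl_del i \<odot>\<^bsub>M\<^esub> m) \<oplus>\<^bsub>M\<^esub> weyl_pol (pdiff i p) \<odot>\<^bsub>M\<^esub> m"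
    and "i < n \<Longrightarrow> j < n \<Longrightarrow> m \<in> carrier M \<Longrightarrow>
      weyl_del i \<odot>\<^bsub>M\<^esub> (weyl_del j \<odot>\<^bsub>M\<^esub> m) = weyl_del j \<odot>\<^bsub>M\<^esub> (weyl_del i \<odot>\<^bsub>M\<^esub> m)"
proof -
  interpret left_module "weyl_algebra n" M by (rule M)
  note assoc = smult_assoc[symmetric, unfolded weyl_algebra_simps]
  show "weyl_pol p \<odot>\<^bsub>M\<^esub> (weyl_pol q \<odot>\<^bsub>M\<^esub> m) = weyl_pol (p * q) \<odot>\<^bsub>M\<^esub> m"
    if "p \<in> pols n" "q \<in> pols n" "m \<in> carrier M"
    using that by (simp add: assoc weyl_relations(1))
  show "weyl_del i \<odot>\<^bsub>M\<^esub> (weyl_pol p \<odot>\<^bsub>M\<^esub> m) =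
      weyl_pol p \<odot>\<^bsub>M\<^esub> (weyl_del i \<odot>\<^bsub>M\<^esub> m) \<oplus>\<^bsub>M\<^esub> weyl_pol (pdiff i p) \<odot>\<^bsub>M\<^esub> m"
    if "p \<in> pols n" "i < n" "m \<in> carrier M"
    using that smult_l_distr[of "weyl_pol p \<star> weyl_del i" "weyl_pol (pdiff i p)" m]
    by (simp add: assoc weyl_relations(3) weyl_carrier_mult pols_pdiff weyl_algebra_simps)
  show "weyl_del i \<odot>\<^bsub>M\<^esub> (weyl_del j \<odot>\<^bsub>M\<^esub> m) = weyl_del j \<odot>\<^bsub>M\<^esub> (weyl_del i \<odot>\<^bsub>M\<^esub> m)"
    if "i < n" "j < n" "m \<in> carrier M"
    using that by (simp add: assoc weyl_relations(2)[of i j])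
qed

text \<open>
  The situation common to both tensor products: \<open>e m\<close> is \<open>\<delta> \<otimes> m\<close>.  The elements \<open>e m\<close> are killed
  by \<open>t f - 1\<close>, the operators \<open>\<theta>\<^sub>i\<close> act on them as \<open>\<partial>\<^sub>i\<close> does on \<open>m\<close>, and they generate \<open>E\<close>.
\<close>

locale delta_embedding =
  fixes n :: nat and f :: "'k::field_char_0 mpol"
    and M :: "('k weyl, 'm, 'y) module_scheme" and E :: "('k weyl, 'e, 'z) module_scheme"
    and e :: "'m \<Rightarrow> 'e"
  assumes M: "left_module (weyl_algebra n) M" and E: "left_module (weyl_algebra (Suc n)) E"
    and f: "f \<in> pols n"
    and e_closed: "\<And>m. m \<in> carrier M \<Longrightarrow> e m \<in> carrier E"
    and e_add: "\<And>m m'. m \<in> carrier M \<Longrightarrow> m' \<in> carrier M \<Longrightarrow> e (m \<oplus>\<^bsub>M\<^esub> m') = e m \<oplus>\<^bsub>E\<^esub> e m'"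
    and e_pol: "\<And>p m. p \<in> pols n \<Longrightarrow> m \<in> carrier M \<Longrightarrow> weyl_pol p \<odot>\<^bsub>E\<^esub> e m = e (weyl_pol p \<odot>\<^bsub>M\<^esub> m)"
    and e_theta: "\<And>i m. i < n \<Longrightarrow> m \<in> carrier M \<Longrightarrow> theta n f i \<odot>\<^bsub>E\<^esub> e m = e (weyl_del i \<odot>\<^bsub>M\<^esub> m)"
    and e_tf1: "\<And>m. m \<in> carrier M \<Longrightarrow> weyl_pol (tf1 n f) \<odot>\<^bsub>E\<^esub> e m = \<zero>\<^bsub>E\<^esub>"
    and e_kernel: "\<And>m. m \<in> carrier M \<Longrightarrow> e m = \<zero>\<^bsub>E\<^esub> \<Longrightarrow> \<exists>k. weyl_pol (f ^ k) \<odot>\<^bsub>M\<^esub> m = \<zero>\<^bsub>M\<^esub>"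
    and e_generates: "\<And>S. S \<subseteq> carrier E \<Longrightarrow> e ` carrier M \<subseteq> S \<Longrightarrow>
      (\<And>x y. x \<in> S \<Longrightarrow> y \<in> S \<Longrightarrow> x \<oplus>\<^bsub>E\<^esub> y \<in> S) \<Longrightarrow>
      (\<And>P x. P \<in> W (Suc n) \<Longrightarrow> x \<in> S \<Longrightarrow> P \<odot>\<^bsub>E\<^esub> x \<in> S) \<Longrightarrow> S = carrier E"
begin

sublocale M: left_module "weyl_algebra n" M by (rule M)
sublocale E: left_module "weyl_algebra (Suc n)" E by (rule E)

lemma e_tau: "P \<in> W n \<Longrightarrow> m \<in> carrier M \<Longrightarrow> tau n f P \<odot>\<^bsub>E\<^esub> e m = e (P \<odot>\<^bsub>M\<^esub> m)"
proof (induction rule: weyl_gen_induct)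
  case one
  then show ?case using E.smult_one[OF e_closed] M.smult_one by (simp add: tau_1[OF f] weyl_algebra_simps)
next
  case (add P Q)
  then show ?case
    using E.smult_l_distr[OF tau_closed[OF f] tau_closed[OF f] e_closed, of P Q m] M.smult_l_distr[of P Q m]
    by (simp add: tau_add[OF f] weyl_algebra_simps e_add M.smult_closed)
next
  case (pol p P)
  then have "p \<in> pols (Suc n)" by (auto intro: pols_mono)
  with pol show ?case
    using E.smult_assoc[OF weyl_pol_closed tau_closed[OF f] e_closed, of p P m] M.smult_assoc[of "weyl_pol p" P m]
    by (simp add: tau_pol[OF f] weyl_algebra_simps e_pol M.smult_closed)
next
  case (del i P)
  then show ?case
    using E.smult_assoc[OF theta_closed[OF f] tau_closed[OF f] e_closed, of i P m] M.smult_assoc[of "weyl_del i" P m]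
    by (simp add: tau_del[OF f] weyl_algebra_simps e_theta M.smult_closed)
qed

lemma e_zero: "e \<zero>\<^bsub>M\<^esub> = \<zero>\<^bsub>E\<^esub>"
  using e_add[OF M.M.zero_closed M.M.zero_closed] e_closed[OF M.M.zero_closed]
  by (simp add: E.M.add.l_cancel_one)

context
  fixes u :: 'm and G :: "'k weyl set"
  assumes u: "u \<in> carrier M" and cyclic: "carrier M = cyclic_submodule (weyl_algebra n) M u"
    and G: "G \<subseteq> W n" and G_gen: "gen_left_ideal (weyl_algebra n) G = annihilator (weyl_algebra n) M u"
begin

abbreviation "J \<equiv> J_ideal n f G"

lemma J_gens: "tau n f ` G \<union> {weyl_pol (tf1 n f)} \<subseteq> W (Suc n)"
  using G tau_closed[OF f] tf1_pols[OF f] by auto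

lemma left_ideal_J: "left_ideal J (weyl_algebra (Suc n))"
  unfolding J_ideal_def by (rule left_ideal_gen_left_ideal[OF J_gens])

lemma J_gensD: "weyl_pol (tf1 n f) \<in> J" "P \<in> G \<Longrightarrow> tau n f P \<in> J"
  using gen_left_ideal_superset[of "tau n f ` G \<union> {weyl_pol (tf1 n f)}" "weyl_algebra (Suc n)"]
  by (auto simp: J_ideal_def)

lemma tf1_ideal_J: "tf1_ideal n f J"
  by (intro tf1_ideal.intro f left_ideal_J J_gensD)

text \<open>The operators that \<open>\<tau>\<close> maps into \<open>J\<close> form a left ideal because \<open>\<tau>\<close> is multiplicative, so it is
  enough to consider the generators of the annihilator of \<open>u\<close>.\<close>

lemma tau_annihilator_J:
  assumes "P \<in> annihilator (weyl_algebra n) M u" shows "tau n f P \<in> J"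
proof -
  interpret J: tf1_ideal n f J by (rule tf1_ideal_J)
  have "left_ideal {P \<in> W n. tau n f P \<in> J} (weyl_algebra n)"
    unfolding left_ideal_weyl_iff
    using J.J_closed(1) tau_diff[OF f weyl_1_closed weyl_1_closed]
    by (auto intro!: add_subgroupI simp: weyl_closed tau_diff[OF f] tau_mult[OF f] J.J_closed J.J_mult tau_closed[OF f])
  moreover have "G \<subseteq> {P \<in> W n. tau n f P \<in> J}" using G J_gensD by auto
  ultimately have "gen_left_ideal (weyl_algebra n) G \<subseteq> {P \<in> W n. tau n f P \<in> J}"
    by (rule gen_left_ideal_least)
  then show ?thesis using assms G_gen by auto
qed

lemma J_subset_annihilator: "J \<subseteq> annihilator (weyl_algebra (Suc n)) E (e u)"
  unfolding J_ideal_def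
proof (rule gen_left_ideal_least)
  show "left_ideal (annihilator (weyl_algebra (Suc n)) E (e u)) (weyl_algebra (Suc n))"
    by (rule left_ideal_annihilator[OF E e_closed[OF u]])
  have "P \<odot>\<^bsub>M\<^esub> u = \<zero>\<^bsub>M\<^esub>" if "P \<in> G" for P
    using that G_gen gen_left_ideal_superset[of G "weyl_algebra n"] by (auto simp: annihilator_def)
  then show "tau n f ` G \<union> {weyl_pol (tf1 n f)} \<subseteq> annihilator (weyl_algebra (Suc n)) E (e u)"
    using J_gens G by (auto simp: annihilator_def e_tau u e_zero e_tf1)
qed

text \<open>By \<open>eq_if_reduced_subset\<close> only \<open>A\<close> with \<open>f\<^sup>k A \<equiv> \<tau>(P)\<close> matters.  If \<open>A (e u) = 0\<close>, then
  \<open>e (P u) = 0\<close>, hence \<open>f\<^sup>l P u = 0\<close> and \<open>f\<^sup>l\<^sup>+\<^sup>k A \<equiv> \<tau>(f\<^sup>l P) \<equiv> 0\<close>; finally \<open>f\<close> is cancelled.\<close>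

theorem J_eq_annihilator: "J = annihilator (weyl_algebra (Suc n)) E (e u)"
proof -
  interpret J: tf1_ideal n f J by (rule tf1_ideal_J)
  let ?L = "annihilator (weyl_algebra (Suc n)) E (e u)"
  have L: "left_ideal ?L (weyl_algebra (Suc n))" by (rule left_ideal_annihilator[OF E e_closed[OF u]])
  then have L_sub: "add_subgroup ?L" and L_mult: "P \<in> W (Suc n) \<Longrightarrow> Q \<in> ?L \<Longrightarrow> P \<star> Q \<in> ?L" for P Q
    by (auto simp: left_ideal_weyl_iff)
  have "A \<in> J" if red: "A \<in> J.reduced" and AL: "A \<in> ?L" for A
  proof -
    obtain k P where A: "A \<in> W (Suc n)" "weyl_pol (tf1 n f) \<star> A \<in> J" and P: "P \<in> W n"
      and AP: "\<And>l. weyl_pol (f ^ (l + k)) \<star> A - tau n f (weyl_pol (f ^ l) \<star> P) \<in> J"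
      by (rule J.reducedE[OF red]) (rule that)
    have "weyl_pol (f ^ k) \<star> A \<in> ?L" by (intro L_mult weyl_pol_closed pols_power J.f_Suc AL)
    moreover have "weyl_pol (f ^ k) \<star> A - tau n f P \<in> ?L"
      using AP[of 0] J_subset_annihilator by (auto simp: weyl_pol_1 weyl_mult_1_left)
    ultimately have "tau n f P \<in> ?L"
      using add_subgroup_diff[OF L_sub, of "weyl_pol (f ^ k) \<star> A" "weyl_pol (f ^ k) \<star> A - tau n f P"] by simp
    then have "e (P \<odot>\<^bsub>M\<^esub> u) = \<zero>\<^bsub>E\<^esub>" using e_tau[OF P u] by (simp add: annihilator_def)
    then obtain l where l: "weyl_pol (f ^ l) \<odot>\<^bsub>M\<^esub> (P \<odot>\<^bsub>M\<^esub> u) = \<zero>\<^bsub>M\<^esub>"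
      using e_kernel[OF M.smult_closed[OF P u]] by blast
    have fl: "weyl_pol (f ^ l) \<in> W n" by (intro weyl_pol_closed pols_power f)
    have "weyl_pol (f ^ l) \<star> P \<in> annihilator (weyl_algebra n) M u"
      using l M.smult_assoc[OF fl P u] weyl_carrier_mult[OF fl P] by (simp add: annihilator_def weyl_algebra_simps)
    then have "tau n f (weyl_pol (f ^ l) \<star> P) \<in> J" by (rule tau_annihilator_J)
    then have "weyl_pol (f ^ (l + k)) \<star> A \<in> J"
      using J.J_closed(4)[OF AP[of l], of "tau n f (weyl_pol (f ^ l) \<star> P)"] by simp
    then show "A \<in> J" by (rule J.J_cancel_f[OF A(2)])
  qed
  then show ?thesis
    using J.eq_if_reduced_subset[OF L J_subset_annihilator] by blast
qed

text \<open>Every \<open>m\<close> is \<open>P u\<close>, and \<open>e (P u) = \<tau>(P) (e u)\<close>.\<close>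

theorem E_cyclic: "carrier E = cyclic_submodule (weyl_algebra (Suc n)) E (e u)"
proof -
  have "cyclic_submodule (weyl_algebra (Suc n)) E (e u) = carrier E"
  proof (rule e_generates)
    let ?S = "cyclic_submodule (weyl_algebra (Suc n)) E (e u)"
    have v: "e u \<in> carrier E" by (rule e_closed[OF u])
    show "?S \<subseteq> carrier E" using v by (auto simp: cyclic_submodule_def E.smult_closed)
    show "e ` carrier M \<subseteq> ?S"
    proof
      fix x assume "x \<in> e ` carrier M"
      then obtain P where "P \<in> W n" "x = e (P \<odot>\<^bsub>M\<^esub> u)" by (auto simp: cyclic cyclic_submodule_def)
      then show "x \<in> ?S"
        using e_tau[of P u] u tau_closed[OF f, of P]
        by (auto simp: cyclic_submodule_def intro!: image_eqI[of _ _ "tau n f P"])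
    qed
    show "x \<oplus>\<^bsub>E\<^esub> y \<in> ?S" if xy: "x \<in> ?S" "y \<in> ?S" for x y
    proof -
      obtain P Q where *: "P \<in> W (Suc n)" "x = P \<odot>\<^bsub>E\<^esub> e u" "Q \<in> W (Suc n)" "y = Q \<odot>\<^bsub>E\<^esub> e u"
        using xy by (auto simp: cyclic_submodule_def)
      then have "x \<oplus>\<^bsub>E\<^esub> y = (P + Q) \<odot>\<^bsub>E\<^esub> e u"
        using E.smult_l_distr[OF *(1,3) v] by (simp add: weyl_algebra_simps)
      then show ?thesis using weyl_carrier_add[OF *(1,3)] by (auto simp: cyclic_submodule_def)
    qed
    show "P \<odot>\<^bsub>E\<^esub> x \<in> ?S" if P: "P \<in> W (Suc n)" and x: "x \<in> ?S" for P x
    proof -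
      obtain Q where *: "Q \<in> W (Suc n)" "x = Q \<odot>\<^bsub>E\<^esub> e u" using x by (auto simp: cyclic_submodule_def)
      then have "P \<odot>\<^bsub>E\<^esub> x = (P \<star> Q) \<odot>\<^bsub>E\<^esub> e u"
        using E.smult_assoc[OF P *(1) v] by (simp add: weyl_algebra_simps)
      then show ?thesis using weyl_carrier_mult[OF P *(1)] by (auto simp: cyclic_submodule_def)
    qed
  qed
  then show ?thesis by simp
qed

end

end

section \<open>Localizations of the polynomial ring\<close>

abbreviation rat :: "'k::field mpol \<Rightarrow> 'k ratfun" where
  "rat p \<equiv> Fraction_Field.Fract p 1"

lemma rat_simps:
  "rat (p + q) = rat p + rat q" "rat (p - q) = rat p - rat q" "rat (- p) = - rat p"
  "rat (p * q) = rat p * rat q" "rat 0 = 0" "rat 1 = 1" "rat p = rat q \<longleftrightarrow> p = q"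
  by (simp_all add: Zero_fract_def One_fract_def eq_fract)

lemma rat_eq_0_iff [simp]: "rat p = 0 \<longleftrightarrow> p = 0"
  using rat_simps(7)[of p 0] by (simp add: rat_simps(5))

lemma rat_power: "rat (p ^ k) = rat p ^ k"
  by (induction k) (simp_all add: rat_simps)

lemma rat_of_nat: "rat (of_nat k) = of_nat k"
  by (induction k) (simp_all add: rat_simps)

lemma rat_sum: "rat (sum g S) = (\<Sum>x\<in>S. rat (g x))"
  by (rule additive_sum) (rule rat_simps)

lemma Fract_eq_divide: "Fraction_Field.Fract p q = rat p / rat q"
  by simp

lemma rat_divide_eq_iff:
  "s \<noteq> 0 \<Longrightarrow> s' \<noteq> 0 \<Longrightarrow> rat p / rat s = rat p' / rat s' \<longleftrightarrow> p * s' = p' * s"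
  by (simp add: eq_fract)

lemma rdiff_divide:
  "s \<noteq> 0 \<Longrightarrow> rdiff i (rat p / rat s) = rat (pdiff i p * s - p * pdiff i s) / rat (s * s)"
  using rdiff_Fract[of s i p] by simp

lemma rdiff_rat: "rdiff i (rat p) = rat (pdiff i p)"
  using rdiff_Fract[of 1 i p] by simp

lemma ratfun_cases [case_names divide]:
  fixes x :: "'k::field ratfun"
  obtains p s where "s \<noteq> 0" "x = rat p / rat s"
  by (cases x) (use Fract_eq_divide in metis)

lemma rdiff_add: "rdiff i (x + y) = rdiff i x + rdiff i y"
proof -
  obtain a b where x: "b \<noteq> 0" "x = rat a / rat b" by (rule ratfun_cases)
  obtain c d where y: "d \<noteq> 0" "y = rat c / rat d" by (rule ratfun_cases)
  have "x + y = rat (a * d + c * b) / rat (b * d)"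
    using x y by (simp add: rat_simps field_simps del: divide_fract mult_fract add_fract)
  then have e: "rdiff i (x + y) = rat (pdiff i (a * d + c * b) * (b * d) - (a * d + c * b) * pdiff i (b * d)) / rat (b * d * (b * d))"
    using x y by (simp only: rdiff_divide mult_eq_0_iff simp_thms)
  show ?thesis
    unfolding e unfolding x(2) y(2) rdiff_divide[OF x(1)] rdiff_divide[OF y(1)]
    using x(1) y(1) by (simp add: pdiff_add pdiff_mult rat_simps field_simps del: divide_fract mult_fract add_fract)
qed

lemma rdiff_mult: "rdiff i (x * y) = rdiff i x * y + x * rdiff i y"
proof -
  obtain a b where x: "b \<noteq> 0" "x = rat a / rat b" by (rule ratfun_cases)
  obtain c d where y: "d \<noteq> 0" "y = rat c / rat d" by (rule ratfun_cases)
  have "x * y = rat (a * c) / rat (b * d)"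
    using x y by (simp add: rat_simps del: divide_fract mult_fract)
  then have e: "rdiff i (x * y) = rat (pdiff i (a * c) * (b * d) - (a * c) * pdiff i (b * d)) / rat (b * d * (b * d))"
    using x y by (simp only: rdiff_divide mult_eq_0_iff simp_thms)
  show ?thesis
    unfolding e unfolding x(2) y(2) rdiff_divide[OF x(1)] rdiff_divide[OF y(1)]
    using x(1) y(1) by (simp add: pdiff_mult rat_simps field_simps del: divide_fract mult_fract add_fract)
qed

text \<open>The commutator of two derivations is a derivation; it vanishes on polynomials and therefore on
  quotients of polynomials.\<close>

lemma rdiff_commute: "rdiff i (rdiff j x) = rdiff j (rdiff i x)"
proof -
  obtain a b where x: "b \<noteq> 0" "x = rat a / rat b" by (rule ratfun_cases)
  then have ab: "x * rat b = rat a" by (simp del: divide_fract mult_fract)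
  have "rdiff i (rdiff j (x * rat b)) = rdiff j (rdiff i (x * rat b))"
    unfolding ab by (simp add: rdiff_rat pdiff_commute)
  then have "rdiff i (rdiff j x) * rat b = rdiff j (rdiff i x) * rat b"
    by (simp add: rdiff_mult rdiff_add rdiff_rat pdiff_commute[of i j] del: mult_fract)
  then show ?thesis using x by simp
qed

definition mult_set :: "nat \<Rightarrow> 'k::field mpol set \<Rightarrow> bool" where
  "mult_set n S \<longleftrightarrow> S \<subseteq> pols n \<and> 0 \<notin> S \<and> 1 \<in> S \<and> (\<forall>s\<in>S. \<forall>s'\<in>S. s * s' \<in> S)"

lemma localization_iff: "x \<in> localization n S \<longleftrightarrow> (\<exists>p\<in>pols n. \<exists>s\<in>S. x = rat p / rat s)"
  by (auto simp: localization_def)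

lemma localizationI: "p \<in> pols n \<Longrightarrow> s \<in> S \<Longrightarrow> rat p / rat s \<in> localization n S"
  unfolding localization_iff by blast

lemma localization_mono: "S \<subseteq> S' \<Longrightarrow> localization n S \<subseteq> localization n S'"
  by (auto simp: localization_def)

context
  fixes n :: nat and S :: "'k::field mpol set"
  assumes S: "mult_set n S"
begin

lemma mult_setD: "s \<in> S \<Longrightarrow> s \<in> pols n" "s \<in> S \<Longrightarrow> s \<noteq> 0" "1 \<in> S" "s \<in> S \<Longrightarrow> s' \<in> S \<Longrightarrow> s * s' \<in> S"
  using S by (auto simp: mult_set_def)

lemma localization_rat: "p \<in> pols n \<Longrightarrow> rat p \<in> localization n S"
  using localizationI[OF _ mult_setD(3), of p] by (simp add: rat_simps)

lemma add_subgroup_localization: "add_subgroup (localization n S)"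
proof (rule add_subgroupI)
  show "0 \<in> localization n S" using localization_rat[OF pols_zero] by (simp add: rat_simps)
  fix x y assume "x \<in> localization n S" "y \<in> localization n S"
  then obtain p s q s' where *: "p \<in> pols n" "s \<in> S" "x = rat p / rat s" "q \<in> pols n" "s' \<in> S" "y = rat q / rat s'"
    unfolding localization_iff by blast
  then have "s \<noteq> 0" "s' \<noteq> 0" using mult_setD(2) by auto
  then have "x - y = rat (p * s' - q * s) / rat (s * s')"
    unfolding *(3,6) by (simp add: rat_simps field_simps del: divide_fract mult_fract diff_fract)
  then show "x - y \<in> localization n S"
    using * mult_setD by (auto intro!: localizationI pols_diff pols_mult simp del: divide_fract)
qed

lemma localization_mult:
  assumes "x \<in> localization n S" "y \<in> localization n S" shows "x * y \<in> localization n S"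
proof -
  obtain p s q s' where *: "p \<in> pols n" "s \<in> S" "x = rat p / rat s" "q \<in> pols n" "s' \<in> S" "y = rat q / rat s'"
    using assms unfolding localization_iff by blast
  then have "x * y = rat (p * q) / rat (s * s')"
    by (simp add: rat_simps del: divide_fract mult_fract)
  then show ?thesis
    using * mult_setD by (auto intro!: localizationI pols_mult simp del: divide_fract)
qed

lemma localization_rdiff:
  assumes "x \<in> localization n S" shows "rdiff i x \<in> localization n S"
proof -
  obtain p s where *: "p \<in> pols n" "s \<in> S" "x = rat p / rat s"
    using assms unfolding localization_iff by blast
  then show ?thesis
    using mult_setD by (auto simp: rdiff_divide intro!: localizationI pols_diff pols_mult pols_pdiff simp del: divide_fract)
qed

end

lemma weyl_operators_ratfun:
  assumes S: "mult_set n S" and S': "mult_set n S'" and "S' \<subseteq> S"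
  shows "weyl_operators n (localization n S) (localization n S') (\<lambda>p x. rat p * x) rdiff"
  using localization_mono[OF assms(3), of n] add_subgroup_zero[OF add_subgroup_localization[OF S']]
  by unfold_locales
    (auto simp: add_subgroup_localization[OF S] add_subgroup_localization[OF S'] rat_simps algebra_simps
      rdiff_add rdiff_mult rdiff_rat rdiff_commute
      intro!: localization_mult[OF S] localization_mult[OF S'] localization_rat[OF S] localization_rat[OF S']
        localization_rdiff[OF S] localization_rdiff[OF S']
      simp del: mult_fract add_fract diff_fract minus_fract)

lemma op_power_single: "op_power d (single i 1) v = d i v"
  by (simp add: op_power_def)

lemma ratfun_weyl_module_simps [simp]:
  "carrier (ratfun_weyl_module A) = A" "add (ratfun_weyl_module A) = (+)" "zero (ratfun_weyl_module A) = 0"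
  "smult (ratfun_weyl_module A) = normal_act (\<lambda>p x. rat p * x) rdiff"
  by (simp_all add: ratfun_weyl_module_def)

lemma ratfun_weyl_module_smult:
  "weyl_pol p \<odot>\<^bsub>ratfun_weyl_module A\<^esub> x = rat p * x"
  "weyl_del i \<odot>\<^bsub>ratfun_weyl_module A\<^esub> x = rdiff i x"
proof -
  have z: "rat 0 * x = 0" for x :: "'a ratfun" by (simp add: rat_simps)
  show "weyl_pol p \<odot>\<^bsub>ratfun_weyl_module A\<^esub> x = rat p * x"
    by (simp only: ratfun_weyl_module_simps weyl_pol_def normal_act_single[of "\<lambda>p x. rat p * x", OF z] op_power_0)
  show "weyl_del i \<odot>\<^bsub>ratfun_weyl_module A\<^esub> x = rdiff i x"
    by (simp only: ratfun_weyl_module_simps weyl_del_def normal_act_single[of "\<lambda>p x. rat p * x", OF z] op_power_single rat_simps mult_1_left)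
qed

lemma tf1_ne_0: "tf1 n f \<noteq> (0 :: 'k::field mpol)"
proof
  assume "tf1 n f = 0"
  then have "lookup (pvar n * f) 0 = 1" by (simp add: tf1_def)
  moreover have "0 \<notin> keys (pvar n * f)"
  proof
    assume "0 \<in> keys (pvar n * f)"
    then obtain a b where "0 = a + b" "a \<in> keys (pvar n :: 'k mpol)"
      using keys_mult[of "pvar n" f] by blast
    then have "0 = single n (1::nat) + b" by (simp add: pvar_def)
    then have "lookup (single n (1::nat) + b) n = 0" by (metis lookup_zero)
    then show False by (simp add: lookup_add)
  qed
  ultimately show False by (simp add: in_keys_iff)
qed

lemma mult_set_powers:
  assumes f: "f \<in> pols n" "f \<noteq> 0"
  shows "mult_set n {f ^ j |j. True}" "mult_set (Suc n) {f ^ j |j. True}"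
    "mult_set (Suc n) {tf1 n f ^ k |k. True}" "mult_set (Suc n) {f ^ j * tf1 n f ^ k |j k. True}"
    "mult_set (Suc n) {1}"
proof -
  have pw: "mult_set m {g ^ j |j. True}" if "g \<in> pols m" "g \<noteq> 0" for m and g :: "'a mpol"
    using that by (auto simp: mult_set_def pols_power intro: exI[of _ 0] simp flip: power_add)
  have f': "f \<in> pols (Suc n)" using f(1) by (rule pols_mono) simp
  show "mult_set n {f ^ j |j. True}" "mult_set (Suc n) {f ^ j |j. True}" "mult_set (Suc n) {tf1 n f ^ k |k. True}"
    by (intro pw f f' tf1_pols tf1_ne_0)+
  show "mult_set (Suc n) {1}" by (auto simp: mult_set_def pols_one)
  have "\<exists>j k. f ^ a * tf1 n f ^ b * (f ^ c * tf1 n f ^ d) = f ^ j * tf1 n f ^ k" for a b c d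
    by (rule exI[of _ "a + c"], rule exI[of _ "b + d"]) (simp add: power_add mult_ac)
  moreover have "\<exists>j k. f ^ j * tf1 n f ^ k = 1" by (rule exI[of _ 0])+ simp
  ultimately show "mult_set (Suc n) {f ^ j * tf1 n f ^ k |j k. True}"
    using f tf1_ne_0[of n f] tf1_pols[OF f(1)] f'
    by (auto simp: mult_set_def pols_power pols_mult)
qed

section \<open>The residue along \<open>t = 1/f\<close>\<close>

text \<open>The coefficient of \<open>t\<^sup>-\<^sup>1\<close> in the expansion of \<open>t\<^sup>l / (t f - 1)\<^sup>k\<^sup>+\<^sup>1\<close> at \<open>t = \<infinity>\<close> is
  \<open>(l choose k) f\<^sup>-\<^sup>l\<^sup>-\<^sup>1\<close>.  It equals the residue along \<open>t = 1/f\<close>, the only finite pole, and avoids Taylor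
  expansions there.  \<open>res_num\<close> extends it from monomials to polynomials.\<close>

definition res_term :: "nat \<Rightarrow> 'k::field mpol \<Rightarrow> nat \<Rightarrow> (nat \<Rightarrow>\<^sub>0 nat) \<Rightarrow> 'k \<Rightarrow> 'k ratfun" where
  "res_term n f k m c = rat (single (m - single n (lookup m n)) c) *
     (of_nat (lookup m n choose k) / rat f ^ Suc (lookup m n))"

definition res_num :: "nat \<Rightarrow> 'k::field mpol \<Rightarrow> nat \<Rightarrow> 'k mpol \<Rightarrow> 'k ratfun" where
  "res_num n f k p = (\<Sum>m\<in>keys p. res_term n f k m (lookup p m))"

lemma res_num_add: "res_num n f k (p + q) = res_num n f k p + res_num n f k q"
  unfolding res_num_def
  by (rule keys_sum_add) (simp add: res_term_def single_add rat_simps algebra_simps del: add_fract mult_fract)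

lemma res_num_diff: "res_num n f k (p - q) = res_num n f k p - res_num n f k q"
  using res_num_add[of n f k "p - q" q] by simp

lemma res_num_single: "res_num n f k (single m c) = res_term n f k m c"
  by (simp add: res_num_def) (simp add: res_term_def rat_simps)

lemma res_num_mult:
  assumes a: "a \<in> pols n" shows "res_num n f k (a * p) = rat a * res_num n f k p"
proof -
  have mono: "res_num n f k (single m' c' * single m c) = rat (single m' c') * res_num n f k (single m c)"
    if "keys m' \<subseteq> {..<n}" for m' c' m c
  proof -
    have n: "lookup m' n = 0" using that by (auto simp: in_keys_iff)
    have "m' + m - single n (lookup m n) = m' + (m - single n (lookup m n))"
      by (rule poly_mapping_eqI) (auto simp: lookup_add lookup_minus lookup_single when_def n)
    then have *: "rat (single (m' + m - single n (lookup m n)) (c' * c)) =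
        rat (single m' c') * rat (single (m - single n (lookup m n)) c)"
      by (simp only: mult_single flip: rat_simps(4))
    show ?thesis
      by (simp only: res_num_single mult_single res_term_def lookup_add n add_0 * mult.assoc)
  qed
  have mono': "res_num n f k (single m' c' * p) = rat (single m' c') * res_num n f k p"
    if "keys m' \<subseteq> {..<n}" for m' c' p
    by (rule additive_extend[where P = p and F = "\<lambda>p. res_num n f k (single m' c' * p)"
          and G = "\<lambda>p. rat (single m' c') * res_num n f k p"])
      (simp_all add: distrib_left res_num_add mono[OF that] del: add_fract mult_fract)
  have "res_num n f k (a * p) = (\<Sum>m\<in>keys a. res_num n f k (single m (lookup a m) * p))"
    by (subst sum_single[of a]) (simp only: sum_distrib_right additive_sum[of "res_num n f k", OF res_num_add])
  also have "\<dots> = (\<Sum>m\<in>keys a. rat (single m (lookup a m)) * res_num n f k p)"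
    using a by (intro sum.cong mono') (auto simp: pols_def)
  also have "\<dots> = rat a * res_num n f k p"
    by (subst (2) sum_single[of a]) (simp only: rat_sum sum_distrib_right)
  finally show ?thesis .
qed

lemma res_num_tf1_single:
  assumes f: "f \<in> pols n" "f \<noteq> 0"
  shows "res_num n f k (tf1 n f * single m c) =
    rat (single (m - single n (lookup m n)) c) * ((of_nat (Suc (lookup m n) choose k) - of_nat (lookup m n choose k)) / rat f ^ Suc (lookup m n))"
proof -
  let ?l = "lookup m n"
  have m: "single n 1 + m - single n (Suc ?l) = m - single n ?l"
    by (rule poly_mapping_eqI) (auto simp: lookup_add lookup_minus lookup_single when_def)
  have l: "lookup (single n 1 + m) n = Suc ?l" by (simp add: lookup_add)
  have "tf1 n f * single m c = f * (pvar n * single m c) - single m c"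
    by (simp add: tf1_def algebra_simps)
  then have "res_num n f k (tf1 n f * single m c) =
      rat f * res_term n f k (single n 1 + m) c - res_term n f k m c"
    by (simp add: res_num_diff res_num_mult[OF f(1)] res_num_single pvar_def mult_single del: mult_fract One_nat_def)
  also have "rat f * res_term n f k (single n 1 + m) c = rat (single (m - single n ?l) c) * (of_nat (Suc ?l choose k) / rat f ^ Suc ?l)"
    unfolding res_term_def l m using f(2) by (simp add: field_simps del: mult_fract binomial_Suc_Suc)
  finally show ?thesis unfolding res_term_def by (simp only: diff_divide_distrib right_diff_distrib)
qed

text \<open>
  Extending \<open>p / (t f - 1)\<^sup>k\<^sup>+\<^sup>1\<close> by another factor \<open>t f - 1\<close> does not change the coefficient; on monomials
  this is Pascal's identity.
\<close>

lemma res_num_tf1_Suc: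
  assumes f: "f \<in> pols n" "f \<noteq> 0"
  shows "res_num n f (Suc k) (tf1 n f * p) = res_num n f k p"
proof (rule additive_extend[where P = p and F = "\<lambda>p. res_num n f (Suc k) (tf1 n f * p)" and G = "res_num n f k"])
  show "res_num n f (Suc k) (tf1 n f * single m c) = res_num n f k (single m c)" for m c
    unfolding res_num_tf1_single[OF f] by (simp add: res_num_single res_term_def)
qed (simp_all add: res_num_add distrib_left)

lemma res_num_tf1_0:
  assumes f: "f \<in> pols n" "f \<noteq> 0"
  shows "res_num n f 0 (tf1 n f * p) = 0"
proof (rule additive_extend[where P = p and F = "\<lambda>p. res_num n f 0 (tf1 n f * p)" and G = "\<lambda>_. 0"])
  show "res_num n f 0 (tf1 n f * single m c) = 0" for m c
    unfolding res_num_tf1_single[OF f] by simp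
qed (simp_all add: res_num_add distrib_left)

lemma res_num_tf1_power:
  assumes f: "f \<in> pols n" "f \<noteq> 0"
  shows "res_num n f (d + k) (tf1 n f ^ d * p) = res_num n f k p"
  by (induction d) (simp_all add: res_num_tf1_Suc[OF f] mult.assoc)

text \<open>The residue is read off a representation with denominator \<open>f\<^sup>j (t f - 1)\<^sup>k\<^sup>+\<^sup>1\<close>; every element of
  \<open>K[x,t,f\<^sup>-\<^sup>1,(t f - 1)\<^sup>-\<^sup>1]\<close> has one, and the value does not depend on it.\<close>

definition residue_rel :: "nat \<Rightarrow> 'k::field mpol \<Rightarrow> 'k ratfun \<Rightarrow> 'k ratfun \<Rightarrow> bool" where
  "residue_rel n f x c \<longleftrightarrow> (\<exists>p j k. p \<in> pols (Suc n) \<and>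
     x = rat p / rat (f ^ j * tf1 n f ^ Suc k) \<and> c = res_num n f k p / rat f ^ j)"

definition residue :: "nat \<Rightarrow> 'k::field mpol \<Rightarrow> 'k ratfun \<Rightarrow> 'k ratfun" where
  "residue n f x = (SOME c. residue_rel n f x c)"

context
  fixes n :: nat and f :: "'k::field mpol"
  assumes f: "f \<in> pols n" and f0: "f \<noteq> 0"
begin

lemma f_pols_Suc: "f \<in> pols (Suc n)"
  using f by (rule pols_mono) simp

text \<open>Both numerators are brought to the denominator exponent \<open>k + k' + 1\<close> of \<open>t f - 1\<close>, where they agree
  up to powers of \<open>f\<close>.\<close>

lemma residue_rel_unique:
  assumes "residue_rel n f x c" "residue_rel n f x c'" shows "c = c'"
proof -
  from assms obtain p j k q j' k' where
    p: "x = rat p / rat (f ^ j * tf1 n f ^ Suc k)" "c = res_num n f k p / rat f ^ j" and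
    q: "x = rat q / rat (f ^ j' * tf1 n f ^ Suc k')" "c' = res_num n f k' q / rat f ^ j'"
    unfolding residue_rel_def by blast
  have "p * (f ^ j' * tf1 n f ^ Suc k') = q * (f ^ j * tf1 n f ^ Suc k)"
    using p(1) q(1) f0 tf1_ne_0[of n f] by (simp only: rat_divide_eq_iff mult_eq_0_iff power_eq_0_iff simp_thms)
  then have "tf1 n f ^ Suc k' * (f ^ j' * p) = tf1 n f ^ Suc k * (f ^ j * q)"
    by (simp only: mult_ac)
  from arg_cong[OF this, of "res_num n f (Suc (k + k'))"]
  have "res_num n f k (f ^ j' * p) = res_num n f k' (f ^ j * q)"
    using res_num_tf1_power[OF f f0, of "Suc k'" k "f ^ j' * p"] res_num_tf1_power[OF f f0, of "Suc k" k' "f ^ j * q"]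
    by (simp add: add.commute del: power_Suc)
  then have "rat f ^ j' * res_num n f k p = rat f ^ j * res_num n f k' q"
    by (simp only: res_num_mult[OF pols_power[OF f]] rat_power)
  then show ?thesis unfolding p(2) q(2) using f0 by (simp add: field_simps)
qed

lemma residue_eq: "residue_rel n f x c \<Longrightarrow> residue n f x = c"
  unfolding residue_def by (rule some_equality) (auto intro: residue_rel_unique)

lemma residue_eqI:
  "p \<in> pols (Suc n) \<Longrightarrow> x = rat p / rat (f ^ j * tf1 n f ^ Suc k) \<Longrightarrow> residue n f x = res_num n f k p / rat f ^ j"
  by (rule residue_eq) (auto simp only: residue_rel_def)

lemma residue_rel_ex:
  assumes "x \<in> loc_f_tf1 n f" shows "residue_rel n f x (residue n f x)"
proof -
  obtain p j k where *: "p \<in> pols (Suc n)" "x = rat p / rat (f ^ j * tf1 n f ^ k)"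
    using assms unfolding loc_f_tf1_def localization_iff by blast
  have "x = rat (tf1 n f * p) / rat (f ^ j * tf1 n f ^ Suc k)"
    unfolding *(2) by (subst rat_divide_eq_iff) (use f0 tf1_ne_0[of n f] in \<open>auto simp: mult_ac\<close>)
  then have "residue_rel n f x (res_num n f k (tf1 n f * p) / rat f ^ j)"
    unfolding residue_rel_def using pols_mult[OF tf1_pols[OF f] *(1)] by blast
  then show ?thesis using residue_eq by metis
qed

lemma residue_add:
  assumes "x \<in> loc_f_tf1 n f" "y \<in> loc_f_tf1 n f"
  shows "residue n f (x + y) = residue n f x + residue n f y"
proof -
  obtain p j k q j' k' where
    p: "p \<in> pols (Suc n)" "x = rat p / rat (f ^ j * tf1 n f ^ Suc k)" "residue n f x = res_num n f k p / rat f ^ j" and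
    q: "q \<in> pols (Suc n)" "y = rat q / rat (f ^ j' * tf1 n f ^ Suc k')" "residue n f y = res_num n f k' q / rat f ^ j'"
    using residue_rel_ex[OF assms(1)] residue_rel_ex[OF assms(2)] unfolding residue_rel_def by blast
  let ?r = "tf1 n f ^ Suc k' * (f ^ j' * p) + tf1 n f ^ Suc k * (f ^ j * q)"
  have r: "?r \<in> pols (Suc n)"
    by (intro pols_add pols_mult pols_power tf1_pols f f_pols_Suc p q)
  have "x + y = rat ?r / rat (f ^ (j + j') * tf1 n f ^ Suc (Suc (k' + k)))"
    unfolding p q using f0 tf1_ne_0[of n f]
    by (simp add: rat_simps rat_power power_add field_simps del: mult_fract add_fract divide_fract)
  then have "residue n f (x + y) = res_num n f (Suc (k' + k)) ?r / rat f ^ (j + j')"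
    by (rule residue_eqI[OF r, of _ "j + j'" "Suc k' + k", unfolded add_Suc])
  also have "res_num n f (Suc (k' + k)) ?r = rat f ^ j' * res_num n f k p + rat f ^ j * res_num n f k' q"
    using res_num_tf1_power[OF f f0, of "Suc k" k' "f ^ j * q"] res_num_tf1_power[OF f f0, of "Suc k'" k "f ^ j' * p"]
    by (simp only: res_num_add res_num_mult[OF pols_power[OF f]] rat_power add_Suc add.commute[of k k'])
  finally show ?thesis unfolding p(3) q(3) using f0 by (simp add: power_add field_simps)
qed

lemma residue_mult:
  assumes "c \<in> loc_f n f" "x \<in> loc_f_tf1 n f"
  shows "residue n f (c * x) = c * residue n f x"
proof -
  obtain a l where a: "a \<in> pols n" "c = rat a / rat (f ^ l)"
    using assms(1) unfolding loc_f_def localization_iff by blast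
  obtain p j k where
    p: "p \<in> pols (Suc n)" "x = rat p / rat (f ^ j * tf1 n f ^ Suc k)" "residue n f x = res_num n f k p / rat f ^ j"
    using residue_rel_ex[OF assms(2)] unfolding residue_rel_def by blast
  have "c * x = rat (a * p) / rat (f ^ (l + j) * tf1 n f ^ Suc k)"
    unfolding a p by (simp add: rat_simps power_add mult_ac del: mult_fract divide_fract)
  moreover have "a * p \<in> pols (Suc n)" by (intro pols_mult p pols_mono[OF a(1)]) simp
  ultimately have "residue n f (c * x) = res_num n f k (a * p) / rat f ^ (l + j)"
    by (intro residue_eqI)
  also have "\<dots> = c * residue n f x"
    unfolding p(3) a(2) res_num_mult[OF a(1)] by (simp add: rat_power power_add del: mult_fract divide_fract)
  finally show ?thesis .
qed

text \<open>Without pole along \<open>t f = 1\<close> the numerator may be taken divisible by \<open>t f - 1\<close>, with \<open>k = 0\<close>.\<close>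

lemma residue_eq_0:
  assumes "x \<in> loc_f (Suc n) f" shows "residue n f x = 0"
proof -
  obtain a l where a: "a \<in> pols (Suc n)" "x = rat a / rat (f ^ l)"
    using assms(1) unfolding loc_f_def localization_iff by blast
  have "x = rat (tf1 n f * a) / rat (f ^ l * tf1 n f ^ Suc 0)"
    unfolding a using f0 tf1_ne_0[of n f] by (subst rat_divide_eq_iff) auto
  moreover have "tf1 n f * a \<in> pols (Suc n)" by (intro pols_mult tf1_pols f a)
  ultimately have "residue n f x = res_num n f 0 (tf1 n f * a) / rat f ^ l"
    by (intro residue_eqI)
  then show ?thesis by (simp add: res_num_tf1_0[OF f f0])
qed

lemma residue_delta: "residue n f (rat f / rat (tf1 n f)) = 1"
proof -
  have "residue n f (rat f / rat (tf1 n f)) = res_num n f 0 f / rat f ^ 0"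
    by (intro residue_eqI f_pols_Suc) simp
  also have "\<dots> = rat f * res_num n f 0 (single 0 1)"
    using res_num_mult[OF f, of f 0 1] by simp
  also have "\<dots> = 1"
    unfolding res_num_single res_term_def using f0 by (simp add: rat_simps del: mult_fract)
  finally show ?thesis .
qed

lemma residue_closed:
  assumes "x \<in> loc_f_tf1 n f" shows "residue n f x \<in> loc_f n f"
proof -
  note ms = mult_set_powers(1)[OF f f0]
  have inv: "1 / rat f ^ l \<in> loc_f n f" for l
    using localizationI[OF pols_one, of "f ^ l" "{f ^ j |j. True}" n]
    by (auto simp: loc_f_def rat_power rat_simps simp del: divide_fract)
  obtain p j k where p: "p \<in> pols (Suc n)" "residue n f x = res_num n f k p / rat f ^ j"
    using residue_rel_ex[OF assms] unfolding residue_rel_def by blast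
  have "res_term n f k m (lookup p m) \<in> loc_f n f" if "m \<in> keys p" for m
  proof -
    have "keys (m - single n (lookup m n)) \<subseteq> {..<n}"
    proof
      fix i assume "i \<in> keys (m - single n (lookup m n))"
      then have "i \<noteq> n" "i \<in> keys m" by (auto simp: in_keys_iff lookup_minus lookup_single when_def split: if_splits)
      moreover have "keys m \<subseteq> {..<Suc n}" using p(1) that by (auto simp: pols_def)
      ultimately show "i \<in> {..<n}" by (auto simp: less_Suc_eq)
    qed
    then have "single (m - single n (lookup m n)) (lookup p m) \<in> pols n" by (auto simp: pols_def)
    then have "rat (single (m - single n (lookup m n)) (lookup p m)) * rat (of_nat (lookup m n choose k)) * (1 / rat f ^ Suc (lookup m n)) \<in> loc_f n f"
      unfolding loc_f_def
      by (intro localization_mult[OF ms] localization_rat[OF ms] pols_of_nat inv[unfolded loc_f_def])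
    then show ?thesis by (simp add: res_term_def rat_of_nat del: mult_fract)
  qed
  then have "res_num n f k p \<in> loc_f n f"
    unfolding res_num_def loc_f_def
    by (intro add_subgroup_sum add_subgroup_localization[OF ms]) auto
  then have "res_num n f k p * (1 / rat f ^ j) \<in> loc_f n f"
    using inv[of j] unfolding loc_f_def by (rule localization_mult[OF ms])
  then show ?thesis unfolding p by simp
qed

end

section \<open>Tensor products with the Leibniz action\<close>

text \<open>A set closed under addition and the action is closed under subtraction, since \<open>- 1\<close> is in the
  Weyl algebra.\<close>

lemma weyl_submodule_cancel:
  assumes T: "left_module (weyl_algebra n) T"
    and S: "S \<subseteq> carrier T" "\<And>x y. x \<in> S \<Longrightarrow> y \<in> S \<Longrightarrow> x \<oplus>\<^bsub>T\<^esub> y \<in> S"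
      "\<And>P x. P \<in> W n \<Longrightarrow> x \<in> S \<Longrightarrow> P \<odot>\<^bsub>T\<^esub> x \<in> S"
    and x: "x \<in> carrier T" and xy: "x \<oplus>\<^bsub>T\<^esub> y \<in> S" and y: "y \<in> S"
  shows "x \<in> S"
proof -
  interpret T: left_module "weyl_algebra n" T by (rule T)
  have m1: "- 1 \<in> W n" by (rule weyl_minus_closed) simp
  have yT: "y \<in> carrier T" using S(1) y by auto
  have "y \<oplus>\<^bsub>T\<^esub> (- 1) \<odot>\<^bsub>T\<^esub> y = \<zero>\<^bsub>T\<^esub>"
    using T.smult_l_distr[OF weyl_1_closed m1 yT] T.smult_one[OF yT] T.smult_zero_left[OF yT]
    by (simp add: weyl_algebra_simps)
  then have "x = (x \<oplus>\<^bsub>T\<^esub> y) \<oplus>\<^bsub>T\<^esub> (- 1) \<odot>\<^bsub>T\<^esub> y"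
    using x yT T.smult_closed[OF m1 yT] by (simp add: T.M.a_assoc)
  then show ?thesis using S(2)[OF xy S(3)[OF m1 y]] by simp
qed

lemma free_additive_closed:
  assumes c: "keys c \<subseteq> S" and H: "add_subgroup H"
    and diff: "\<And>x y. F (x - y) = F x - F y" and gen: "\<And>a. a \<in> S \<Longrightarrow> F (frag_of a) \<in> H"
  shows "F c \<in> H"
  using c
proof (rule free_Abelian_group_induct)
  show "F 0 \<in> H" using diff[of 0 0] add_subgroup_zero[OF H] by simp
qed (simp_all add: diff gen add_subgroup_diff[OF H])

lemma add_subgroup_free: "add_subgroup {c :: 'a \<Rightarrow>\<^sub>0 int. keys c \<subseteq> S}"
  by (auto intro!: add_subgroupI dest: subsetD[OF keys_diff])

locale tensor_pair =
  fixes R :: "('r, 'x) ring_scheme" and A :: "('r, 'a, 'y) module_scheme" and B :: "('r, 'b, 'z) module_scheme"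
  assumes A_add: "\<And>a a'. a \<in> carrier A \<Longrightarrow> a' \<in> carrier A \<Longrightarrow> a \<oplus>\<^bsub>A\<^esub> a' \<in> carrier A"
    and A_smult: "\<And>r a. r \<in> carrier R \<Longrightarrow> a \<in> carrier A \<Longrightarrow> r \<odot>\<^bsub>A\<^esub> a \<in> carrier A"
    and B_add: "\<And>b b'. b \<in> carrier B \<Longrightarrow> b' \<in> carrier B \<Longrightarrow> b \<oplus>\<^bsub>B\<^esub> b' \<in> carrier B"
    and B_smult: "\<And>r b. r \<in> carrier R \<Longrightarrow> b \<in> carrier B \<Longrightarrow> r \<odot>\<^bsub>B\<^esub> b \<in> carrier B"
begin

abbreviation Free :: "('a \<times> 'b \<Rightarrow>\<^sub>0 int) set" where "Free \<equiv> {c. keys c \<subseteq> carrier A \<times> carrier B}"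
abbreviation Rel :: "('a \<times> 'b \<Rightarrow>\<^sub>0 int) set" where "Rel \<equiv> tensor_relations R A B"

lemma Rel_least:
  assumes H: "add_subgroup H"
    and 1: "\<And>a a' b. a \<in> carrier A \<Longrightarrow> a' \<in> carrier A \<Longrightarrow> b \<in> carrier B \<Longrightarrow>
      frag_of (a \<oplus>\<^bsub>A\<^esub> a', b) - frag_of (a, b) - frag_of (a', b) \<in> H"
    and 2: "\<And>a b b'. a \<in> carrier A \<Longrightarrow> b \<in> carrier B \<Longrightarrow> b' \<in> carrier B \<Longrightarrow>
      frag_of (a, b \<oplus>\<^bsub>B\<^esub> b') - frag_of (a, b) - frag_of (a, b') \<in> H"
    and 3: "\<And>r a b. r \<in> carrier R \<Longrightarrow> a \<in> carrier A \<Longrightarrow> b \<in> carrier B \<Longrightarrow>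
      frag_of (r \<odot>\<^bsub>A\<^esub> a, b) - frag_of (a, r \<odot>\<^bsub>B\<^esub> b) \<in> H"
  shows "Rel \<subseteq> H"
proof
  fix x assume "x \<in> Rel"
  then have "x \<in> H \<and> keys x \<subseteq> carrier A \<times> carrier B"
    unfolding tensor_relations_def
  proof (induction rule: generate.induct)
    case one
    then show ?case using add_subgroup_zero[OF H] by simp
  next
    case (incl h)
    then show ?case
      using 1 2 3 A_add A_smult B_add B_smult
      by (auto simp: keys_frag_of dest!: subsetD[OF keys_diff])
  next
    case (inv h)
    then have "h \<in> H \<and> keys h \<subseteq> carrier A \<times> carrier B"
      using 1 2 3 A_add A_smult B_add B_smult
      by (auto simp: keys_frag_of dest!: subsetD[OF keys_diff])
    then show ?case using add_subgroup_minus[OF H] by simp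
  next
    case (eng h1 h2)
    then show ?case using add_subgroup_add[OF H] keys_add[of h1 h2] by auto
  qed
  then show "x \<in> H" ..
qed

lemma Rel_Free: "Rel \<subseteq> Free"
  by (rule Rel_least)
    (auto simp: keys_frag_of A_add A_smult B_add B_smult add_subgroup_free dest!: subsetD[OF keys_diff])

lemma add_subgroup_Rel: "add_subgroup Rel"
proof (rule add_subgroupI)
  show "0 \<in> Rel" 
    unfolding tensor_relations_def by (rule generate.one[where G = "free_Abelian_group S" for S, simplified])
  fix x y assume xy: "x \<in> Rel" "y \<in> Rel"
  let ?G = "free_Abelian_group (carrier A \<times> carrier B)"
  have "inv\<^bsub>?G\<^esub> y \<in> Rel" unfolding tensor_relations_def
  proof (rule group.generate_m_inv_closed[OF group_free_Abelian_group])
    show "y \<in> generate ?G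
     ({frag_of (a \<oplus>\<^bsub>A\<^esub> a', b) - frag_of (a, b) - frag_of (a', b) |a a' b.
        a \<in> carrier A \<and> a' \<in> carrier A \<and> b \<in> carrier B} \<union>
     {frag_of (a, b \<oplus>\<^bsub>B\<^esub> b') - frag_of (a, b) - frag_of (a, b') |a b b'.
        a \<in> carrier A \<and> b \<in> carrier B \<and> b' \<in> carrier B} \<union>
     {frag_of (r \<odot>\<^bsub>A\<^esub> a, b) - frag_of (a, r \<odot>\<^bsub>B\<^esub> b) |r a b.
        r \<in> carrier R \<and> a \<in> carrier A \<and> b \<in> carrier B})"
      using xy(2) unfolding tensor_relations_def .
  qed (auto simp: keys_frag_of A_add A_smult B_add B_smult dest!: subsetD[OF keys_diff])
  moreover have "inv\<^bsub>?G\<^esub> y = - y" using xy Rel_Free by auto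
  ultimately show "x - y \<in> Rel"
    using generate.eng[of x ?G _ "- y"] xy(1) unfolding tensor_relations_def by simp
qed

lemmas Rel_closed = add_subgroup_closed[OF add_subgroup_Rel]

lemma Rel_left: "a \<in> carrier A \<Longrightarrow> a' \<in> carrier A \<Longrightarrow> b \<in> carrier B \<Longrightarrow>
      frag_of (a \<oplus>\<^bsub>A\<^esub> a', b) - frag_of (a, b) - frag_of (a', b) \<in> Rel"
  unfolding tensor_relations_def by (rule generate.incl) blast

lemma Rel_right: "a \<in> carrier A \<Longrightarrow> b \<in> carrier B \<Longrightarrow> b' \<in> carrier B \<Longrightarrow>
      frag_of (a, b \<oplus>\<^bsub>B\<^esub> b') - frag_of (a, b) - frag_of (a, b') \<in> Rel"
  unfolding tensor_relations_def by (rule generate.incl) blast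

lemma Rel_smult: "r \<in> carrier R \<Longrightarrow> a \<in> carrier A \<Longrightarrow> b \<in> carrier B \<Longrightarrow>
      frag_of (r \<odot>\<^bsub>A\<^esub> a, b) - frag_of (a, r \<odot>\<^bsub>B\<^esub> b) \<in> Rel"
  unfolding tensor_relations_def by (rule generate.incl) blast

text \<open>To map the tensor product somewhere it suffices to map pairs, and to check the relations.\<close>

lemma Rel_image:
  assumes N: "add_subgroup N" and diff: "\<And>x y. F (x - y) = F x - F y"
    and 1: "\<And>a a' b. a \<in> carrier A \<Longrightarrow> a' \<in> carrier A \<Longrightarrow> b \<in> carrier B \<Longrightarrow>
      F (frag_of (a \<oplus>\<^bsub>A\<^esub> a', b)) - F (frag_of (a, b)) - F (frag_of (a', b)) \<in> N"
    and 2: "\<And>a b b'. a \<in> carrier A \<Longrightarrow> b \<in> carrier B \<Longrightarrow> b' \<in> carrier B \<Longrightarrow>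
      F (frag_of (a, b \<oplus>\<^bsub>B\<^esub> b')) - F (frag_of (a, b)) - F (frag_of (a, b')) \<in> N"
    and 3: "\<And>r a b. r \<in> carrier R \<Longrightarrow> a \<in> carrier A \<Longrightarrow> b \<in> carrier B \<Longrightarrow>
      F (frag_of (r \<odot>\<^bsub>A\<^esub> a, b)) - F (frag_of (a, r \<odot>\<^bsub>B\<^esub> b)) \<in> N"
    and c: "c \<in> Rel"
  shows "F c \<in> N"
proof -
  have "F 0 = 0" using diff[of 0 0] by simp
  then have "add_subgroup {c. F c \<in> N}"
    using N by (auto intro!: add_subgroupI simp: diff add_subgroup_closed)
  then have "Rel \<subseteq> {c. F c \<in> N}" using 1 2 3 by (intro Rel_least) (simp_all add: diff)
  then show ?thesis using c by auto
qed

end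

text \<open>
  \<open>A\<close> and \<open>B\<close> are the factors as \<open>R\<close>-modules, \<open>A'\<close> and \<open>B'\<close> the same groups with the actions of Weyl
  algebras.  What makes the Leibniz rule compatible with tensoring over \<open>R\<close> is a family of maps \<open>D i\<close>,
  the derivations of \<open>R\<close>, with respect to which the \<open>\<partial>\<^sub>i\<close> for \<open>i < n\<close> satisfy the product rule on both
  factors; the remaining \<open>\<partial>\<^sub>i\<close> have to be \<open>R\<close>-linear.
\<close>

locale leibniz_tensor = tensor_pair R A B
  for n N :: nat and R :: "('r, 'x) ring_scheme"
    and A :: "('r, 'a, 'y) module_scheme" and B :: "('r, 'b, 'z) module_scheme"
    and A' :: "('k::field weyl, 'a, 'y2) module_scheme" and B' :: "('k weyl, 'b, 'z2) module_scheme"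
    and D :: "nat \<Rightarrow> 'r \<Rightarrow> 'r" +
  assumes n_le_N: "n \<le> N" and A': "left_module (weyl_algebra N) A'"
    and A_carrier: "carrier A' = carrier A" and A_plus: "add A' = add A"
    and D_closed: "\<And>i r. i < n \<Longrightarrow> r \<in> carrier R \<Longrightarrow> D i r \<in> carrier R"
    and pol_A: "\<And>p r a. p \<in> pols N \<Longrightarrow> r \<in> carrier R \<Longrightarrow> a \<in> carrier A \<Longrightarrow>
      weyl_pol p \<odot>\<^bsub>A'\<^esub> (r \<odot>\<^bsub>A\<^esub> a) = r \<odot>\<^bsub>A\<^esub> (weyl_pol p \<odot>\<^bsub>A'\<^esub> a)"
    and del_A: "\<And>i r a. i < n \<Longrightarrow> r \<in> carrier R \<Longrightarrow> a \<in> carrier A \<Longrightarrow>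
      weyl_del i \<odot>\<^bsub>A'\<^esub> (r \<odot>\<^bsub>A\<^esub> a) = r \<odot>\<^bsub>A\<^esub> (weyl_del i \<odot>\<^bsub>A'\<^esub> a) \<oplus>\<^bsub>A\<^esub> D i r \<odot>\<^bsub>A\<^esub> a"
    and del_A': "\<And>i r a. n \<le> i \<Longrightarrow> i < N \<Longrightarrow> r \<in> carrier R \<Longrightarrow> a \<in> carrier A \<Longrightarrow>
      weyl_del i \<odot>\<^bsub>A'\<^esub> (r \<odot>\<^bsub>A\<^esub> a) = r \<odot>\<^bsub>A\<^esub> (weyl_del i \<odot>\<^bsub>A'\<^esub> a)"
    and del_B_closed: "\<And>i b. i < n \<Longrightarrow> b \<in> carrier B \<Longrightarrow> weyl_del i \<odot>\<^bsub>B'\<^esub> b \<in> carrier B"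
    and del_B_add: "\<And>i b b'. i < n \<Longrightarrow> b \<in> carrier B \<Longrightarrow> b' \<in> carrier B \<Longrightarrow>
      weyl_del i \<odot>\<^bsub>B'\<^esub> (b \<oplus>\<^bsub>B\<^esub> b') = weyl_del i \<odot>\<^bsub>B'\<^esub> b \<oplus>\<^bsub>B\<^esub> weyl_del i \<odot>\<^bsub>B'\<^esub> b'"
    and del_B_commute: "\<And>i j b. i < n \<Longrightarrow> j < n \<Longrightarrow> b \<in> carrier B \<Longrightarrow>
      weyl_del i \<odot>\<^bsub>B'\<^esub> (weyl_del j \<odot>\<^bsub>B'\<^esub> b) = weyl_del j \<odot>\<^bsub>B'\<^esub> (weyl_del i \<odot>\<^bsub>B'\<^esub> b)"
    and del_B: "\<And>i r b. i < n \<Longrightarrow> r \<in> carrier R \<Longrightarrow> b \<in> carrier B \<Longrightarrow>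
      weyl_del i \<odot>\<^bsub>B'\<^esub> (r \<odot>\<^bsub>B\<^esub> b) = r \<odot>\<^bsub>B\<^esub> (weyl_del i \<odot>\<^bsub>B'\<^esub> b) \<oplus>\<^bsub>B\<^esub> D i r \<odot>\<^bsub>B\<^esub> b"
begin

interpretation A': left_module "weyl_algebra N" A' by (rule A')

definition s_op :: "'k mpol \<Rightarrow> ('a \<times> 'b \<Rightarrow>\<^sub>0 int) \<Rightarrow> ('a \<times> 'b \<Rightarrow>\<^sub>0 int)" where
  "s_op p = frag_extend (\<lambda>(a, b). frag_of (weyl_pol p \<odot>\<^bsub>A'\<^esub> a, b))"

definition d_op :: "nat \<Rightarrow> ('a \<times> 'b \<Rightarrow>\<^sub>0 int) \<Rightarrow> ('a \<times> 'b \<Rightarrow>\<^sub>0 int)" where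
  "d_op i = frag_extend (\<lambda>(a, b). frag_of (weyl_del i \<odot>\<^bsub>A'\<^esub> a, b) +
        (if i < n then frag_of (a, weyl_del i \<odot>\<^bsub>B'\<^esub> b) else 0))"

lemma leibniz_act_eq: "leibniz_act n A' B' = normal_act s_op d_op"
  unfolding leibniz_act_def s_op_def[abs_def] d_op_def[abs_def] ..

lemma s_of: "s_op p (frag_of (a, b)) = frag_of (weyl_pol p \<odot>\<^bsub>A'\<^esub> a, b)"
  and d_of: "d_op i (frag_of (a, b)) = frag_of (weyl_del i \<odot>\<^bsub>A'\<^esub> a, b) +
     (if i < n then frag_of (a, weyl_del i \<odot>\<^bsub>B'\<^esub> b) else 0)"
  by (simp_all add: s_op_def d_op_def)

lemma s_diff: "s_op p (x - y) = s_op p x - s_op p y" and d_diff: "d_op i (x - y) = d_op i x - d_op i y"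
  and s_add: "s_op p (x + y) = s_op p x + s_op p y" and d_add: "d_op i (x + y) = d_op i x + d_op i y"
  by (simp_all add: s_op_def d_op_def frag_extend_diff frag_extend_add)

lemma ops_0 [simp]: "s_op p 0 = 0" "d_op i 0 = 0"
  by (simp_all add: s_op_def d_op_def)

lemma pol_closed_A: "p \<in> pols N \<Longrightarrow> a \<in> carrier A \<Longrightarrow> weyl_pol p \<odot>\<^bsub>A'\<^esub> a \<in> carrier A"
  and del_closed_A: "i < N \<Longrightarrow> a \<in> carrier A \<Longrightarrow> weyl_del i \<odot>\<^bsub>A'\<^esub> a \<in> carrier A"
  using A'.smult_closed by (auto simp: A_carrier)

lemma smult_add_A: "P \<in> W N \<Longrightarrow> a \<in> carrier A \<Longrightarrow> a' \<in> carrier A \<Longrightarrow>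
    P \<odot>\<^bsub>A'\<^esub> (a \<oplus>\<^bsub>A\<^esub> a') = P \<odot>\<^bsub>A'\<^esub> a \<oplus>\<^bsub>A\<^esub> P \<odot>\<^bsub>A'\<^esub> a'"
  using A'.smult_r_distr[of P a a'] by (simp add: A_carrier A_plus)

lemma smult_plus_A: "P \<in> W N \<Longrightarrow> Q \<in> W N \<Longrightarrow> a \<in> carrier A \<Longrightarrow>
    (P + Q) \<odot>\<^bsub>A'\<^esub> a = P \<odot>\<^bsub>A'\<^esub> a \<oplus>\<^bsub>A\<^esub> Q \<odot>\<^bsub>A'\<^esub> a"
  using A'.smult_l_distr[of P Q a] by (simp add: A_carrier A_plus weyl_algebra_simps)

lemma smult_mult_A: "P \<in> W N \<Longrightarrow> Q \<in> W N \<Longrightarrow> a \<in> carrier A \<Longrightarrow>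
    P \<odot>\<^bsub>A'\<^esub> (Q \<odot>\<^bsub>A'\<^esub> a) = (P \<star> Q) \<odot>\<^bsub>A'\<^esub> a"
  using A'.smult_assoc[of P Q a] by (simp add: A_carrier weyl_algebra_simps)

lemma smult_one_A: "a \<in> carrier A \<Longrightarrow> 1 \<odot>\<^bsub>A'\<^esub> a = a"
  using A'.smult_one[of a] by (simp add: A_carrier weyl_algebra_simps)

lemma frag_in_Free: "a \<in> carrier A \<Longrightarrow> b \<in> carrier B \<Longrightarrow> frag_of (a, b) \<in> Free"
  by (simp add: keys_frag_of)

text \<open>For the relation \<open>r a \<otimes> b = a \<otimes> r b\<close> the product rule produces \<open>D\<^sub>i r a \<otimes> b\<close> on the left and
  \<open>a \<otimes> D\<^sub>i r b\<close> on the right, which are again related.\<close>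

lemma d_op_Rel:
  assumes i: "i < N" and c: "c \<in> Rel" shows "d_op i c \<in> Rel"
  using add_subgroup_Rel d_diff _ _ _ c
proof (rule Rel_image)
  fix a a' b assume ab: "a \<in> carrier A" "a' \<in> carrier A" "b \<in> carrier B"
  let ?d = "\<lambda>a. weyl_del i \<odot>\<^bsub>A'\<^esub> a" and ?e = "\<lambda>b. weyl_del i \<odot>\<^bsub>B'\<^esub> b"
  have "d_op i (frag_of (a \<oplus>\<^bsub>A\<^esub> a', b)) - d_op i (frag_of (a, b)) - d_op i (frag_of (a', b)) =
      (frag_of (?d a \<oplus>\<^bsub>A\<^esub> ?d a', b) - frag_of (?d a, b) - frag_of (?d a', b)) +
      (if i < n then frag_of (a \<oplus>\<^bsub>A\<^esub> a', ?e b) - frag_of (a, ?e b) - frag_of (a', ?e b) else 0)"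
    using ab i by (simp add: d_of smult_add_A algebra_simps)
  also have "\<dots> \<in> Rel"
    using ab i by (auto intro!: Rel_closed(4) Rel_left del_closed_A del_B_closed simp: Rel_closed(1))
  finally show "d_op i (frag_of (a \<oplus>\<^bsub>A\<^esub> a', b)) - d_op i (frag_of (a, b)) - d_op i (frag_of (a', b)) \<in> Rel" .
next
  fix a b b' assume ab: "a \<in> carrier A" "b \<in> carrier B" "b' \<in> carrier B"
  let ?d = "\<lambda>a. weyl_del i \<odot>\<^bsub>A'\<^esub> a" and ?e = "\<lambda>b. weyl_del i \<odot>\<^bsub>B'\<^esub> b"
  have "d_op i (frag_of (a, b \<oplus>\<^bsub>B\<^esub> b')) - d_op i (frag_of (a, b)) - d_op i (frag_of (a, b')) =
      (frag_of (?d a, b \<oplus>\<^bsub>B\<^esub> b') - frag_of (?d a, b) - frag_of (?d a, b')) +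
      (if i < n then frag_of (a, ?e b \<oplus>\<^bsub>B\<^esub> ?e b') - frag_of (a, ?e b) - frag_of (a, ?e b') else 0)"
    using ab i by (simp add: d_of del_B_add algebra_simps)
  also have "\<dots> \<in> Rel"
    using ab i by (auto intro!: Rel_closed(4) Rel_right del_closed_A del_B_closed simp: Rel_closed(1))
  finally show "d_op i (frag_of (a, b \<oplus>\<^bsub>B\<^esub> b')) - d_op i (frag_of (a, b)) - d_op i (frag_of (a, b')) \<in> Rel" .
next
  fix r a b assume ab: "r \<in> carrier R" "a \<in> carrier A" "b \<in> carrier B"
  let ?d = "\<lambda>a. weyl_del i \<odot>\<^bsub>A'\<^esub> a" and ?e = "\<lambda>b. weyl_del i \<odot>\<^bsub>B'\<^esub> b"
  show "d_op i (frag_of (r \<odot>\<^bsub>A\<^esub> a, b)) - d_op i (frag_of (a, r \<odot>\<^bsub>B\<^esub> b)) \<in> Rel"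
  proof (cases "i < n")
    case False
    then show ?thesis
      using ab i Rel_smult[of r "?d a" b] del_closed_A[of i a] by (simp add: d_of del_A')
  next
    case True
    let ?r = "D i r"
    have r: "?r \<in> carrier R" using True ab by (simp add: D_closed)
    have da: "?d a \<in> carrier A" and eb: "?e b \<in> carrier B"
      using ab i True by (simp_all add: del_closed_A del_B_closed)
    have "d_op i (frag_of (r \<odot>\<^bsub>A\<^esub> a, b)) - d_op i (frag_of (a, r \<odot>\<^bsub>B\<^esub> b)) =
      (frag_of (r \<odot>\<^bsub>A\<^esub> ?d a \<oplus>\<^bsub>A\<^esub> ?r \<odot>\<^bsub>A\<^esub> a, b) - frag_of (r \<odot>\<^bsub>A\<^esub> ?d a, b) - frag_of (?r \<odot>\<^bsub>A\<^esub> a, b))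
      + (frag_of (r \<odot>\<^bsub>A\<^esub> ?d a, b) - frag_of (?d a, r \<odot>\<^bsub>B\<^esub> b))
      + (frag_of (?r \<odot>\<^bsub>A\<^esub> a, b) - frag_of (a, ?r \<odot>\<^bsub>B\<^esub> b))
      + (frag_of (r \<odot>\<^bsub>A\<^esub> a, ?e b) - frag_of (a, r \<odot>\<^bsub>B\<^esub> ?e b))
      - (frag_of (a, r \<odot>\<^bsub>B\<^esub> ?e b \<oplus>\<^bsub>B\<^esub> ?r \<odot>\<^bsub>B\<^esub> b) - frag_of (a, r \<odot>\<^bsub>B\<^esub> ?e b) - frag_of (a, ?r \<odot>\<^bsub>B\<^esub> b))"
      using ab i True by (simp add: d_of del_A del_B algebra_simps)
    also have "\<dots> \<in> Rel"
      by (rule Rel_closed(2) Rel_closed(4) Rel_left Rel_right Rel_smult A_smult B_smult ab r da eb)+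
    finally show ?thesis .
  qed
qed

lemma s_op_Rel:
  assumes p: "p \<in> pols N" and c: "c \<in> Rel" shows "s_op p c \<in> Rel"
  using add_subgroup_Rel s_diff _ _ _ c
  by (rule Rel_image)
    (use p in \<open>auto simp: s_of smult_add_A pol_A pol_closed_A intro!: Rel_left Rel_right Rel_smult\<close>)

lemma weyl_operators_tensor: "weyl_operators N Free Rel s_op d_op"
proof unfold_locales
  show "add_subgroup Free" by (rule add_subgroup_free)
  show "add_subgroup Rel" by (rule add_subgroup_Rel)
  show "Rel \<subseteq> Free" by (rule Rel_Free)
  show "s_op p c \<in> Free" if "p \<in> pols N" "c \<in> Free" for p c
    by (rule free_additive_closed[of c "carrier A \<times> carrier B", OF _ add_subgroup_free s_diff])
      (use that in \<open>auto simp: s_of keys_frag_of pol_closed_A\<close>)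
  show "d_op i c \<in> Free" if "i < N" "c \<in> Free" for i c
  proof (rule free_additive_closed[of c "carrier A \<times> carrier B", OF _ add_subgroup_free d_diff])
    fix x assume "x \<in> carrier A \<times> carrier B"
    then obtain a b where x: "x = (a, b)" "a \<in> carrier A" "b \<in> carrier B" by auto
    show "d_op i (frag_of x) \<in> Free"
      unfolding x d_of
      by (intro add_subgroup_add[OF add_subgroup_free])
        (use x that in \<open>auto simp: keys_frag_of del_closed_A del_B_closed\<close>)
  qed (use that in auto)
  show "s_op p c \<in> Rel" if "p \<in> pols N" "c \<in> Rel" for p c using that by (rule s_op_Rel)
  show "d_op i c \<in> Rel" if "i < N" "c \<in> Rel" for i c using that by (rule d_op_Rel)
  show "s_op (p + q) c - (s_op p c + s_op q c) \<in> Rel" if "p \<in> pols N" "q \<in> pols N" "c \<in> Free" for p q c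
  proof (rule free_additive_closed[of c "carrier A \<times> carrier B", OF _ add_subgroup_Rel])
    fix x assume "x \<in> carrier A \<times> carrier B"
    then show "s_op (p + q) (frag_of x) - (s_op p (frag_of x) + s_op q (frag_of x)) \<in> Rel"
      using that Rel_left[OF pol_closed_A pol_closed_A, of p "fst x" q "fst x" "snd x"]
      by (auto simp: s_of weyl_pol_add smult_plus_A diff_diff_eq)
  qed (use that in \<open>auto simp: s_diff\<close>)
  show "s_op (p * q) c - s_op p (s_op q c) \<in> Rel" if "p \<in> pols N" "q \<in> pols N" "c \<in> Free" for p q c
  proof (rule free_additive_closed[of c "carrier A \<times> carrier B", OF _ add_subgroup_Rel])
    fix x assume "x \<in> carrier A \<times> carrier B"
    then show "s_op (p * q) (frag_of x) - s_op p (s_op q (frag_of x)) \<in> Rel"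
      using that by (auto simp: s_of smult_mult_A weyl_relations(1) Rel_closed(1))
  qed (use that in \<open>auto simp: s_diff\<close>)
  show "s_op 1 c - c \<in> Rel" if "c \<in> Free" for c
  proof (rule free_additive_closed[of c "carrier A \<times> carrier B", OF _ add_subgroup_Rel])
    fix x assume "x \<in> carrier A \<times> carrier B"
    then show "s_op 1 (frag_of x) - frag_of x \<in> Rel"
      by (auto simp: s_of weyl_pol_1 smult_one_A Rel_closed(1))
  qed (use that in \<open>auto simp: s_diff\<close>)
  show "d_op i (d_op j c) - d_op j (d_op i c) \<in> Rel" if "i < N" "j < N" "c \<in> Free" for i j c
  proof (rule free_additive_closed[of c "carrier A \<times> carrier B", OF _ add_subgroup_Rel])
    fix x assume "x \<in> carrier A \<times> carrier B"
    then obtain a b where x: "x = (a, b)" "a \<in> carrier A" "b \<in> carrier B" by auto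
    have "weyl_del i \<odot>\<^bsub>A'\<^esub> (weyl_del j \<odot>\<^bsub>A'\<^esub> a) = weyl_del j \<odot>\<^bsub>A'\<^esub> (weyl_del i \<odot>\<^bsub>A'\<^esub> a)"
      using that x by (simp add: smult_mult_A weyl_relations(2)[of i j])
    moreover have "weyl_del i \<odot>\<^bsub>B'\<^esub> (weyl_del j \<odot>\<^bsub>B'\<^esub> b) = weyl_del j \<odot>\<^bsub>B'\<^esub> (weyl_del i \<odot>\<^bsub>B'\<^esub> b)"
      if "i < n" "j < n" using that x by (intro del_B_commute)
    ultimately show "d_op i (d_op j (frag_of x)) - d_op j (d_op i (frag_of x)) \<in> Rel"
      unfolding x by (auto simp: d_of d_add Rel_closed(1) add_ac)
  qed (use that in \<open>auto simp: d_diff\<close>)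
  show "d_op i (s_op p c) - (s_op p (d_op i c) + s_op (pdiff i p) c) \<in> Rel"
    if "i < N" "p \<in> pols N" "c \<in> Free" for i p c
  proof (rule free_additive_closed[of c "carrier A \<times> carrier B", OF _ add_subgroup_Rel])
    fix x assume "x \<in> carrier A \<times> carrier B"
    then obtain a b where x: "x = (a, b)" "a \<in> carrier A" "b \<in> carrier B" by auto
    let ?p = "weyl_pol p" and ?d = "weyl_del i" and ?q = "weyl_pol (pdiff i p)"
    have q: "pdiff i p \<in> pols N" using that by (simp add: pols_pdiff)
    have "?d \<odot>\<^bsub>A'\<^esub> (?p \<odot>\<^bsub>A'\<^esub> a) = ?p \<odot>\<^bsub>A'\<^esub> (?d \<odot>\<^bsub>A'\<^esub> a) \<oplus>\<^bsub>A\<^esub> ?q \<odot>\<^bsub>A'\<^esub> a"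
      using that x q by (simp add: smult_mult_A weyl_relations(3) smult_plus_A weyl_carrier_mult)
    then have "d_op i (s_op p (frag_of x)) - (s_op p (d_op i (frag_of x)) + s_op (pdiff i p) (frag_of x)) =
        frag_of (?p \<odot>\<^bsub>A'\<^esub> (?d \<odot>\<^bsub>A'\<^esub> a) \<oplus>\<^bsub>A\<^esub> ?q \<odot>\<^bsub>A'\<^esub> a, b) - frag_of (?p \<odot>\<^bsub>A'\<^esub> (?d \<odot>\<^bsub>A'\<^esub> a), b) - frag_of (?q \<odot>\<^bsub>A'\<^esub> a, b)"
      unfolding x by (simp add: d_of s_of s_add algebra_simps)
    also have "\<dots> \<in> Rel" using that x q by (intro Rel_left pol_closed_A del_closed_A)
    finally show "d_op i (s_op p (frag_of x)) - (s_op p (d_op i (frag_of x)) + s_op (pdiff i p) (frag_of x)) \<in> Rel" .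
  qed (use that in \<open>auto simp: d_diff s_diff\<close>)
qed (simp_all add: s_add d_add)

abbreviation T where "T \<equiv> tensor_module R A B (leibniz_act n A' B')"
abbreviation tensor (infixl "\<otimes>\<^sub>T" 70) where "a \<otimes>\<^sub>T b \<equiv> pure_tensor R A B a b"

lemma tensor_eq_coset: "a \<otimes>\<^sub>T b = coset Rel (frag_of (a, b))"
  by (simp add: pure_tensor_def coset_def)

sublocale ops: weyl_operators N Free Rel s_op d_op
  by (rule weyl_operators_tensor)

lemma free_pairs_simps:
  "carrier (free_pairs A B act) = Free" "add (free_pairs A B act) = (+)" "smult (free_pairs A B act) = act"
  by (auto simp: free_pairs_def)

lemma T_eq: "T = quot_module (free_pairs A B (normal_act s_op d_op)) Rel"
  by (simp add: tensor_module_def leibniz_act_eq)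

lemma left_module_T: "left_module (weyl_algebra N) T"
  unfolding T_eq by (rule ops.left_module_quot) (simp_all add: free_pairs_simps)

lemma T_carrier: "carrier T = coset Rel ` Free" and T_zero: "\<zero>\<^bsub>T\<^esub> = Rel"
  and T_add: "coset Rel v \<oplus>\<^bsub>T\<^esub> coset Rel w = coset Rel (v + w)"
  unfolding T_eq by (rule ops.quot_carrier ops.quot_zero ops.quot_add; simp add: free_pairs_simps)+

lemma T_pol: "p \<in> pols N \<Longrightarrow> c \<in> Free \<Longrightarrow> weyl_pol p \<odot>\<^bsub>T\<^esub> coset Rel c = coset Rel (s_op p c)"
  and T_del: "i < N \<Longrightarrow> c \<in> Free \<Longrightarrow> weyl_del i \<odot>\<^bsub>T\<^esub> coset Rel c = coset Rel (d_op i c)"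
  unfolding T_eq by (rule ops.quot_weyl_pol ops.quot_weyl_del; simp add: free_pairs_simps)+

lemma tensor_closed: "a \<in> carrier A \<Longrightarrow> b \<in> carrier B \<Longrightarrow> a \<otimes>\<^sub>T b \<in> carrier T"
  unfolding T_carrier tensor_eq_coset by (intro imageI frag_in_Free)

lemma tensor_eq_0_iff: "a \<otimes>\<^sub>T b = \<zero>\<^bsub>T\<^esub> \<longleftrightarrow> frag_of (a, b) \<in> Rel"
  unfolding T_zero tensor_eq_coset by (rule coset_eq_self_iff[OF add_subgroup_Rel])

lemma tensor_add_left: "a \<in> carrier A \<Longrightarrow> a' \<in> carrier A \<Longrightarrow> b \<in> carrier B \<Longrightarrow>
    (a \<oplus>\<^bsub>A\<^esub> a') \<otimes>\<^sub>T b = a \<otimes>\<^sub>T b \<oplus>\<^bsub>T\<^esub> a' \<otimes>\<^sub>T b"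
  using Rel_left[of a a' b] by (simp add: tensor_eq_coset T_add coset_eq_iff add_subgroup_Rel diff_diff_eq)

lemma tensor_add_right: "a \<in> carrier A \<Longrightarrow> b \<in> carrier B \<Longrightarrow> b' \<in> carrier B \<Longrightarrow>
    a \<otimes>\<^sub>T (b \<oplus>\<^bsub>B\<^esub> b') = a \<otimes>\<^sub>T b \<oplus>\<^bsub>T\<^esub> a \<otimes>\<^sub>T b'"
  using Rel_right[of a b b'] by (simp add: tensor_eq_coset T_add coset_eq_iff add_subgroup_Rel diff_diff_eq)

lemma tensor_smult: "r \<in> carrier R \<Longrightarrow> a \<in> carrier A \<Longrightarrow> b \<in> carrier B \<Longrightarrow>
    (r \<odot>\<^bsub>A\<^esub> a) \<otimes>\<^sub>T b = a \<otimes>\<^sub>T (r \<odot>\<^bsub>B\<^esub> b)"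
  using Rel_smult[of r a b] by (simp add: tensor_eq_coset coset_eq_iff add_subgroup_Rel)

lemma tensor_pol: "p \<in> pols N \<Longrightarrow> a \<in> carrier A \<Longrightarrow> b \<in> carrier B \<Longrightarrow>
    weyl_pol p \<odot>\<^bsub>T\<^esub> (a \<otimes>\<^sub>T b) = (weyl_pol p \<odot>\<^bsub>A'\<^esub> a) \<otimes>\<^sub>T b"
  by (simp add: tensor_eq_coset T_pol frag_in_Free s_of)

lemma tensor_del: "i < n \<Longrightarrow> a \<in> carrier A \<Longrightarrow> b \<in> carrier B \<Longrightarrow>
    weyl_del i \<odot>\<^bsub>T\<^esub> (a \<otimes>\<^sub>T b) = (weyl_del i \<odot>\<^bsub>A'\<^esub> a) \<otimes>\<^sub>T b \<oplus>\<^bsub>T\<^esub> a \<otimes>\<^sub>T (weyl_del i \<odot>\<^bsub>B'\<^esub> b)"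
  using n_le_N by (simp add: tensor_eq_coset T_del frag_in_Free d_of T_add)

lemma tensor_del': "n \<le> i \<Longrightarrow> i < N \<Longrightarrow> a \<in> carrier A \<Longrightarrow> b \<in> carrier B \<Longrightarrow>
    weyl_del i \<odot>\<^bsub>T\<^esub> (a \<otimes>\<^sub>T b) = (weyl_del i \<odot>\<^bsub>A'\<^esub> a) \<otimes>\<^sub>T b"
  by (simp add: tensor_eq_coset T_del frag_in_Free d_of)

lemma tensor_zero_left:
  assumes "z \<in> carrier A" "z \<oplus>\<^bsub>A\<^esub> z = z" "b \<in> carrier B" shows "z \<otimes>\<^sub>T b = \<zero>\<^bsub>T\<^esub>"
proof -
  interpret T: left_module "weyl_algebra N" T by (rule left_module_T)
  show ?thesis
    using tensor_add_left[OF assms(1,1,3)] tensor_closed[OF assms(1,3)] assms(2)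
    by (simp add: T.M.add.l_cancel_one)
qed

lemma tensor_zero_right:
  assumes "a \<in> carrier A" "z \<in> carrier B" "z \<oplus>\<^bsub>B\<^esub> z = z" shows "a \<otimes>\<^sub>T z = \<zero>\<^bsub>T\<^esub>"
proof -
  interpret T: left_module "weyl_algebra N" T by (rule left_module_T)
  show ?thesis
    using tensor_add_right[OF assms(1,2,2)] tensor_closed[OF assms(1,2)] assms(3)
    by (simp add: T.M.add.l_cancel_one)
qed

lemma tensor_span:
  assumes sub: "S \<subseteq> carrier T" and pure: "\<And>a b. a \<in> carrier A \<Longrightarrow> b \<in> carrier B \<Longrightarrow> a \<otimes>\<^sub>T b \<in> S"
    and zero: "\<zero>\<^bsub>T\<^esub> \<in> S"
    and add: "\<And>x y. x \<in> S \<Longrightarrow> y \<in> S \<Longrightarrow> x \<oplus>\<^bsub>T\<^esub> y \<in> S"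
    and smult: "\<And>P x. P \<in> W N \<Longrightarrow> x \<in> S \<Longrightarrow> P \<odot>\<^bsub>T\<^esub> x \<in> S"
  shows "S = carrier T"
proof
  show "carrier T \<subseteq> S"
  proof
    fix x assume "x \<in> carrier T"
    then obtain c where c: "keys c \<subseteq> carrier A \<times> carrier B" and x: "x = coset Rel c" by (auto simp: T_carrier)
    show "x \<in> S" unfolding x using c
    proof (rule free_Abelian_group_induct)
      show "coset Rel 0 \<in> S" using zero by (simp add: T_zero coset_def)
      show "coset Rel (frag_of y) \<in> S" if "y \<in> carrier A \<times> carrier B" for y
        using that pure by (auto simp: tensor_eq_coset)
      fix v w assume vw: "keys v \<subseteq> carrier A \<times> carrier B" "keys w \<subseteq> carrier A \<times> carrier B"
        "coset Rel v \<in> S" "coset Rel w \<in> S"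
      have "v - w \<in> Free" using vw by (intro add_subgroup_diff[OF add_subgroup_free]) auto
      then have "coset Rel (v - w) \<in> carrier T" unfolding T_carrier by (rule imageI)
      moreover have "coset Rel (v - w) \<oplus>\<^bsub>T\<^esub> coset Rel w \<in> S" using vw by (simp add: T_add)
      ultimately show "coset Rel (v - w) \<in> S"
        using weyl_submodule_cancel[OF left_module_T sub _ _ _ _ vw(4), of "coset Rel (v - w)"] add smult
        by blast
    qed
  qed
qed (rule sub)

end

section \<open>Quotients of localizations and the element \<open>\<delta>\<close>\<close>

lemma quot_module_add_cong: "add M = add M' \<Longrightarrow> add (quot_module M N) = add (quot_module M' N)"
  by (simp add: quot_module_def set_add_def set_mult_def fun_eq_iff)

lemma restrict_scalars_simps [simp]:
  "carrier (restrict_scalars h M) = carrier M" "add (restrict_scalars h M) = add M"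
  "smult (restrict_scalars h M) a = smult M (h a)"
  by (simp_all add: restrict_scalars_def)

lemma pol_ring_carrier [simp]: "carrier (pol_ring n) = pols n"
  by (simp add: pol_ring_def)

lemma ratfun_ring_carrier [simp]: "carrier (ratfun_ring A) = A"
  by (simp add: ratfun_ring_def)

lemma ratfun_mult_module_simps [simp]:
  "carrier (ratfun_mult_module A) = A" "add (ratfun_mult_module A) = (+)"
  "smult (ratfun_mult_module A) = (*)"
  by (simp_all add: ratfun_mult_module_def)

context
  fixes n :: nat and X Y :: "'k::field ratfun set"
  assumes ops: "weyl_operators n X Y (\<lambda>p x. rat p * x) rdiff"
begin

interpretation weyl_operators n X Y "\<lambda>p x. rat p * x" rdiff by (rule ops)

abbreviation "ratfun_quot \<equiv> quot_module (ratfun_weyl_module X) Y"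

lemma left_module_ratfun_quot: "left_module (weyl_algebra n) ratfun_quot"
  by (rule left_module_quot) simp_all

lemma ratfun_quot_carrier: "carrier ratfun_quot = coset Y ` X"
  and ratfun_quot_zero: "\<zero>\<^bsub>ratfun_quot\<^esub> = Y"
  and ratfun_quot_add: "coset Y x \<oplus>\<^bsub>ratfun_quot\<^esub> coset Y y = coset Y (x + y)"
  by (rule quot_carrier quot_zero quot_add; simp)+

lemma ratfun_quot_pol: "p \<in> pols n \<Longrightarrow> x \<in> X \<Longrightarrow> weyl_pol p \<odot>\<^bsub>ratfun_quot\<^esub> coset Y x = coset Y (rat p * x)"
  and ratfun_quot_del: "i < n \<Longrightarrow> x \<in> X \<Longrightarrow> weyl_del i \<odot>\<^bsub>ratfun_quot\<^esub> coset Y x = coset Y (rdiff i x)"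
  by (rule quot_weyl_pol quot_weyl_del; simp)+

lemmas ratfun_quot_facts = left_module_ratfun_quot ratfun_quot_carrier ratfun_quot_zero ratfun_quot_add
  ratfun_quot_pol ratfun_quot_del

end

abbreviation delta_fun :: "nat \<Rightarrow> 'k::field mpol \<Rightarrow> 'k ratfun" where
  "delta_fun n f \<equiv> Fraction_Field.Fract f (tf1 n f)"

lemma tf1_delta_fun: "rat (tf1 n f) * delta_fun n f = rat f"
  using tf1_ne_0[of n f] by (simp add: eq_fract)

text \<open>Indeed \<open>\<partial>\<^sub>i (f/s) = - f\<^sub>i/s\<^sup>2\<close> and \<open>\<partial>\<^sub>t (t\<^sup>2 f/s) = 1 - 1/s\<^sup>2\<close> for \<open>s = t f - 1\<close>.  So \<open>\<theta>\<^sub>i\<close> maps \<open>f/s\<close> to a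
  polynomial and kills its class.\<close>

lemma theta_delta_fun:
  assumes f: "f \<in> pols n" and i: "i < n"
  shows "rdiff i (delta_fun n f) - rat (pdiff i f) * rdiff n (rat (pvar n ^ 2) * delta_fun n f) = - rat (pdiff i f)"
proof -
  let ?s = "tf1 n f" and ?t = "pvar n :: 'a mpol" and ?g = "pdiff i f"
  have s: "?s \<noteq> 0" by (rule tf1_ne_0)
  have tf: "?t * f = ?s + 1" by (simp add: tf1_def)
  have 1: "rdiff i (delta_fun n f) = rat (- ?g) / rat (?s * ?s)"
  proof -
    have "?g * ?s - f * (?t * ?g) = - ?g" by (simp add: tf1_def algebra_simps)
    then show ?thesis
      by (simp add: rdiff_Fract[OF s] pdiff_tf1(2)[OF i])
  qed
  have "rat (?t ^ 2) * delta_fun n f = Fraction_Field.Fract (?t * (?s + 1)) ?s"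
    by (simp add: power2_eq_square tf[symmetric] mult.assoc)
  also have "rdiff n \<dots> = rat (?s * ?s - 1) / rat (?s * ?s)"
  proof -
    have "pdiff n (?t * (?s + 1)) * ?s - ?t * (?s + 1) * pdiff n ?s = ?s * ?s - 1"
    proof -
      have "pdiff n (?t * (?s + 1)) * ?s - ?t * (?s + 1) * pdiff n ?s = (?s + 1 + ?t * f) * ?s - (?s + 1) * (?t * f)"
        by (simp add: pdiff_mult pdiff_add pdiff_pvar pdiff_tf1(1)[OF f] algebra_simps)
      also have "\<dots> = ?s * ?s - 1" unfolding tf by (simp add: algebra_simps)
      finally show ?thesis .
    qed
    then show ?thesis by (simp add: rdiff_Fract[OF s])
  qed
  finally have 2: "rdiff n (rat (?t ^ 2) * delta_fun n f) = rat (?s * ?s - 1) / rat (?s * ?s)" .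
  have "rat (?s * ?s) \<noteq> 0" using s by simp
  then show ?thesis
    unfolding 1 2 by (simp add: rat_simps field_simps del: divide_fract mult_fract diff_fract minus_fract)
qed

text \<open>This solves \<open>t \<partial>\<^sub>t s\<^sup>-\<^sup>k = - k (s\<^sup>-\<^sup>k + s\<^sup>-\<^sup>k\<^sup>-\<^sup>1)\<close>, where \<open>s = t f - 1\<close>, for the last term; dividing by \<open>k\<close>
  uses characteristic zero.\<close>

lemma Fract_one_tf1_power_Suc:
  fixes f :: "'k::field_char_0 mpol"
  assumes f: "f \<in> pols n" and k: "0 < k"
  shows "\<exists>c\<in>pols (Suc n). Fraction_Field.Fract 1 (tf1 n f ^ Suc k) =
    rat (c * pvar n) * rdiff n (Fraction_Field.Fract 1 (tf1 n f ^ k)) + rat (- 1) * Fraction_Field.Fract 1 (tf1 n f ^ k)"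
proof -
  let ?s = "tf1 n f" and ?t = "pvar n :: 'k mpol"
  let ?c = "single 0 (- inverse (of_nat k)) :: 'k mpol"
  have s: "?s \<noteq> 0" by (rule tf1_ne_0)
  obtain l where l: "k = Suc l" using k by (cases k) auto
  have tf: "?t * f = ?s + 1" by (simp add: tf1_def)
  have ck: "?c * of_nat k = - 1"
    unfolding of_nat_eq_single mult_single using k by (simp add: single_uminus)
  have "rdiff n (Fraction_Field.Fract 1 (?s ^ k)) = Fraction_Field.Fract (- (of_nat k * ?s ^ l * f)) (?s ^ k * ?s ^ k)"
    using s unfolding l by (subst rdiff_Fract) (simp_all add: pdiff_power pdiff_tf1(1)[OF f] del: power_Suc of_nat_Suc)
  also have "\<dots> = Fraction_Field.Fract (- (of_nat k * f)) (?s ^ Suc k)"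
    using s unfolding l by (simp add: eq_fract algebra_simps del: of_nat_Suc)
  finally have "rat (?c * ?t) * rdiff n (Fraction_Field.Fract 1 (?s ^ k)) + rat (- 1) * Fraction_Field.Fract 1 (?s ^ k) =
      Fraction_Field.Fract (- (?c * of_nat k) * (?t * f)) (?s ^ Suc k) + Fraction_Field.Fract (- 1) (?s ^ k)"
    by (simp add: mult_ac)
  also have "\<dots> = Fraction_Field.Fract 1 (?s ^ Suc k)"
    unfolding ck tf using s by (simp add: eq_fract algebra_simps)
  finally show ?thesis
    by (intro bexI[of _ ?c]) (auto simp: pols_def)
qed

text \<open>The first power is \<open>t f/(t f - 1) - 1\<close>; the others follow by \<open>t \<partial>\<^sub>t\<close>.\<close>

lemma delta_generates:
  fixes f :: "'k::field_char_0 mpol"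
  assumes f: "f \<in> pols n"
    and add: "\<And>x y. x \<in> S \<Longrightarrow> y \<in> S \<Longrightarrow> x + y \<in> S"
    and pol: "\<And>p x. p \<in> pols (Suc n) \<Longrightarrow> x \<in> S \<Longrightarrow> rat p * x \<in> S"
    and del: "\<And>x. x \<in> S \<Longrightarrow> rdiff n x \<in> S"
    and delta: "delta_fun n f \<in> S" and one: "1 \<in> S"
  shows "Fraction_Field.Fract 1 (tf1 n f ^ k) \<in> S"
proof (cases "k = 0")
  case True
  then show ?thesis using one by (simp add: One_fract_def)
next
  case False
  let ?s = "tf1 n f" and ?t = "pvar n :: 'k mpol"
  have s: "?s \<noteq> 0" by (rule tf1_ne_0)
  have m1: "- 1 \<in> pols (Suc n)" by (intro pols_minus pols_one)
  have "Fraction_Field.Fract 1 (?s ^ Suc k) \<in> S" for k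
  proof (induction k)
    case 0
    have "Fraction_Field.Fract 1 (?s ^ Suc 0) = rat ?t * delta_fun n f + rat (- 1) * 1"
      using s by (simp add: One_fract_def eq_fract tf1_def)
    then show ?case using add[OF pol[OF pvar_pols delta] pol[OF m1 one], of n] by simp
  next
    case (Suc k)
    obtain c where c: "c \<in> pols (Suc n)" "Fraction_Field.Fract 1 (?s ^ Suc (Suc k)) =
        rat (c * ?t) * rdiff n (Fraction_Field.Fract 1 (?s ^ Suc k)) + rat (- 1) * Fraction_Field.Fract 1 (?s ^ Suc k)"
      using Fract_one_tf1_power_Suc[OF f, of "Suc k"] by auto
    show ?case unfolding c(2)
      by (intro add pol del Suc m1 pols_mult c pvar_pols) simp
  qed
  from this[of "k - 1"] False show ?thesis by simp
qed

text \<open>Multiplication by \<open>t\<close> divides by \<open>f\<close> up to a lower pole order: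
  \<open>t f\<^sup>-\<^sup>j s\<^sup>-\<^sup>k\<^sup>-\<^sup>1 = f\<^sup>-\<^sup>j\<^sup>-\<^sup>1 (s\<^sup>-\<^sup>k\<^sup>-\<^sup>1 + s\<^sup>-\<^sup>k)\<close> for \<open>s = t f - 1\<close>.\<close>

lemma delta_generates_inverse_f:
  fixes f :: "'k::field_char_0 mpol"
  assumes f: "f \<in> pols n" "f \<noteq> 0"
    and add: "\<And>x y. x \<in> S \<Longrightarrow> y \<in> S \<Longrightarrow> x + y \<in> S"
    and pol: "\<And>p x. p \<in> pols (Suc n) \<Longrightarrow> x \<in> S \<Longrightarrow> rat p * x \<in> S"
    and tf1: "\<And>k. Fraction_Field.Fract 1 (tf1 n f ^ k) \<in> S"
    and inv: "\<And>j. Fraction_Field.Fract 1 (f ^ j) \<in> S"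
  shows "Fraction_Field.Fract 1 (f ^ j * tf1 n f ^ k) \<in> S"
proof (induction j arbitrary: k)
  case 0
  then show ?case using tf1 by simp
next
  case (Suc j)
  note outer = Suc.IH
  show ?case
  proof (induction k)
    case 0
    then show ?case using inv[of "Suc j"] by simp
  next
    case (Suc k)
    have "Fraction_Field.Fract 1 (f ^ Suc j * tf1 n f ^ Suc k) =
        rat (pvar n) * Fraction_Field.Fract 1 (f ^ j * tf1 n f ^ Suc k) + rat (- 1) * Fraction_Field.Fract 1 (f ^ Suc j * tf1 n f ^ k)"
    proof -
      let ?D = "f ^ Suc j * tf1 n f ^ Suc k"
      have D: "?D \<noteq> 0" using f(2) tf1_ne_0[of n f] by simp
      have 1: "rat (pvar n) * Fraction_Field.Fract 1 (f ^ j * tf1 n f ^ Suc k) = Fraction_Field.Fract (tf1 n f + 1) ?D"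
        using D by (simp add: eq_fract tf1_def algebra_simps)
      have 2: "rat (- 1) * Fraction_Field.Fract 1 (f ^ Suc j * tf1 n f ^ k) = Fraction_Field.Fract (- tf1 n f) ?D"
        using D by (simp add: eq_fract algebra_simps)
      have "Fraction_Field.Fract 1 d = Fraction_Field.Fract (s + 1) d + Fraction_Field.Fract (- s) d"
        if "d \<noteq> 0" for d s :: "'k mpol"
        using that by (simp add: eq_fract algebra_simps)
      from this[OF D] show ?thesis unfolding 1 2 .
    qed
    then show ?case
      using add[OF pol[OF pvar_pols[of n] outer[of "Suc k"]] pol[OF pols_minus[OF pols_one] Suc.IH]] by simp
  qed
qed

section \<open>The two tensor products\<close>

text \<open>
  Both tensor products have a first factor \<open>X/Y\<close> where \<open>X\<close> is a ring of rational functions with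
  poles along \<open>t f = 1\<close> and \<open>Y\<close> is the subring of functions without such poles.
\<close>

locale delta_tensor = leibniz_tensor n "Suc n" R A B A' B' D
  for n :: nat and R :: "('r, 'x) ring_scheme"
    and A :: "('r, 'k::field_char_0 ratfun set, 'y) module_scheme" and B :: "('r, 'b, 'z) module_scheme"
    and A' :: "('k weyl, 'k ratfun set) module" and B' :: "('k weyl, 'b, 'z2) module_scheme"
    and D :: "nat \<Rightarrow> 'r \<Rightarrow> 'r" +
  fixes f :: "'k mpol" and X Y :: "'k ratfun set"
  assumes f: "f \<in> pols n" and ops: "weyl_operators (Suc n) X Y (\<lambda>p x. rat p * x) rdiff"
    and delta_X: "delta_fun n f \<in> X" and rat_Y: "\<And>p. p \<in> pols (Suc n) \<Longrightarrow> rat p \<in> Y"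
    and A'_eq: "A' = quot_module (ratfun_weyl_module X) Y"
begin

interpretation X: weyl_operators "Suc n" X Y "\<lambda>p x. rat p * x" rdiff by (rule ops)

lemmas A'_facts = ratfun_quot_facts[OF ops, folded A'_eq]

lemma A_eq: "carrier A = coset Y ` X" and A_add_coset: "coset Y x \<oplus>\<^bsub>A\<^esub> coset Y y = coset Y (x + y)"
  using A'_facts(2,4) A_carrier A_plus by metis+

abbreviation delta_class where "delta_class \<equiv> coset Y (delta_fun n f)"

lemma delta_class_closed: "delta_class \<in> carrier A"
  using delta_X by (simp add: A_eq)

lemma tensor_Y:
  assumes y: "y \<in> Y" and b: "b \<in> carrier B" shows "coset Y y \<otimes>\<^sub>T b = \<zero>\<^bsub>T\<^esub>"
proof (rule tensor_zero_left[OF _ _ b])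
  have "coset Y y = coset Y 0" using y by (simp add: coset_eq_iff X.N)
  then show "coset Y y \<oplus>\<^bsub>A\<^esub> coset Y y = coset Y y" by (simp add: A_add_coset)
  show "coset Y y \<in> carrier A" using y X.N_subset by (auto simp: A_eq)
qed

lemma tf1_delta_tensor:
  assumes b: "b \<in> carrier B" shows "weyl_pol (tf1 n f) \<odot>\<^bsub>T\<^esub> (delta_class \<otimes>\<^sub>T b) = \<zero>\<^bsub>T\<^esub>"
proof -
  have "weyl_pol (tf1 n f) \<odot>\<^bsub>A'\<^esub> delta_class = coset Y (rat f)"
    using A'_facts(5)[OF tf1_pols[OF f] delta_X] by (simp only: tf1_delta_fun)
  then show ?thesis
    using tensor_pol[OF tf1_pols[OF f] delta_class_closed b] tensor_Y[OF rat_Y[OF pols_mono[OF f]] b] by simp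
qed

text \<open>\<open>\<theta>\<^sub>i\<close> annihilates \<open>\<delta>\<close>, hence it acts on \<open>\<delta> \<otimes> b\<close> through the second factor.\<close>

lemma theta_delta_tensor:
  assumes i: "i < n" and b: "b \<in> carrier B"
  shows "theta n f i \<odot>\<^bsub>T\<^esub> (delta_class \<otimes>\<^sub>T b) = delta_class \<otimes>\<^sub>T (weyl_del i \<odot>\<^bsub>B'\<^esub> b)"
proof -
  interpret T: left_module "weyl_algebra (Suc n)" T by (rule left_module_T)
  let ?q = "weyl_pol (pdiff i f)" and ?t = "weyl_pol (pvar n ^ 2) :: 'k weyl" and ?d = "weyl_del n :: 'k weyl"
  have q: "pdiff i f \<in> pols (Suc n)" and t: "(pvar n ^ 2 :: 'k mpol) \<in> pols (Suc n)"
    by (auto intro!: pols_mono[OF pols_pdiff[OF f]] pols_power pvar_pols)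
  have "rdiff i (delta_fun n f) - rat (pdiff i f) * rdiff n (rat (pvar n ^ 2) * delta_fun n f) \<in> Y"
    unfolding theta_delta_fun[OF f i] by (intro add_subgroup_minus[OF X.N] rat_Y q)
  then have del: "weyl_del i \<odot>\<^bsub>A'\<^esub> delta_class = ?q \<odot>\<^bsub>A'\<^esub> (?d \<odot>\<^bsub>A'\<^esub> (?t \<odot>\<^bsub>A'\<^esub> delta_class))"
    using i by (simp only: A'_facts(5,6) delta_X q t X.s_closed X.d_closed less_SucI lessI coset_eq_iff[OF X.N])
  note th = theta_closed[OF f i] and W = weyl_pol_closed[OF q] weyl_del_closed[OF lessI] weyl_pol_closed[OF t]
    and d = delta_class_closed
  have x: "delta_class \<otimes>\<^sub>T b \<in> carrier T" by (rule tensor_closed[OF d b])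
  have closed: "weyl_del i \<odot>\<^bsub>A'\<^esub> delta_class \<in> carrier A" "weyl_del i \<odot>\<^bsub>B'\<^esub> b \<in> carrier B"
    using d b i by (simp_all add: del_closed_A del_B_closed)
  have "weyl_del i = theta n f i + ?q \<star> (?d \<star> ?t)" by (simp add: theta_def)
  then have "weyl_del i \<odot>\<^bsub>T\<^esub> (delta_class \<otimes>\<^sub>T b) =
      theta n f i \<odot>\<^bsub>T\<^esub> (delta_class \<otimes>\<^sub>T b) \<oplus>\<^bsub>T\<^esub> (?q \<star> (?d \<star> ?t)) \<odot>\<^bsub>T\<^esub> (delta_class \<otimes>\<^sub>T b)"
    using T.smult_l_distr[OF th weyl_carrier_mult[OF W(1) weyl_carrier_mult[OF W(2,3)]] x]
    by (simp add: weyl_algebra_simps)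
  also have "(?q \<star> (?d \<star> ?t)) \<odot>\<^bsub>T\<^esub> (delta_class \<otimes>\<^sub>T b) = (weyl_del i \<odot>\<^bsub>A'\<^esub> delta_class) \<otimes>\<^sub>T b"
    using T.smult_assoc[OF W(1) weyl_carrier_mult[OF W(2,3)] x] T.smult_assoc[OF W(2,3) x] d b q t
    by (simp add: weyl_algebra_simps del tensor_pol tensor_del' pol_closed_A del_closed_A)
  finally have "theta n f i \<odot>\<^bsub>T\<^esub> (delta_class \<otimes>\<^sub>T b) \<oplus>\<^bsub>T\<^esub> (weyl_del i \<odot>\<^bsub>A'\<^esub> delta_class) \<otimes>\<^sub>T b =
      delta_class \<otimes>\<^sub>T (weyl_del i \<odot>\<^bsub>B'\<^esub> b) \<oplus>\<^bsub>T\<^esub> (weyl_del i \<odot>\<^bsub>A'\<^esub> delta_class) \<otimes>\<^sub>T b"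
    using tensor_del[OF i d b] tensor_closed[OF closed(1) b] tensor_closed[OF d closed(2)]
    by (simp add: T.M.a_comm)
  then show ?thesis
    using tensor_closed[OF closed(1) b] tensor_closed[OF d closed(2)] T.smult_closed[OF th x] by simp
qed

definition absorbed :: "(_ \<Rightarrow>\<^sub>0 int) set set \<Rightarrow> 'b set \<Rightarrow> 'k ratfun set" where
  "absorbed S B0 = {x \<in> X. \<forall>b\<in>B0. coset Y x \<otimes>\<^sub>T b \<in> S}"

context
  fixes S and B0 :: "'b set"
  assumes S: "S \<subseteq> carrier T" and S_add: "\<And>x y. x \<in> S \<Longrightarrow> y \<in> S \<Longrightarrow> x \<oplus>\<^bsub>T\<^esub> y \<in> S"
    and S_smult: "\<And>P x. P \<in> W (Suc n) \<Longrightarrow> x \<in> S \<Longrightarrow> P \<odot>\<^bsub>T\<^esub> x \<in> S"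
    and B0: "B0 \<subseteq> carrier B" and delta_S: "\<And>b. b \<in> B0 \<Longrightarrow> delta_class \<otimes>\<^sub>T b \<in> S"
begin

lemma zero_in_submodule:
  assumes b: "b \<in> B0" shows "\<zero>\<^bsub>T\<^esub> \<in> S"
proof -
  have "b \<in> carrier B" using b B0 by auto
  then show ?thesis
    using S_smult[OF weyl_pol_closed[OF tf1_pols[OF f]] delta_S[OF b]] by (simp only: tf1_delta_tensor)
qed

lemma absorbed_Y: "y \<in> Y \<Longrightarrow> y \<in> absorbed S B0"
proof -
  assume y: "y \<in> Y"
  have "coset Y y \<otimes>\<^sub>T b \<in> S" if "b \<in> B0" for b
    using tensor_Y[OF y subsetD[OF B0 that]] zero_in_submodule[OF that] by simp
  then show ?thesis using y X.N_subset by (auto simp: absorbed_def)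
qed

lemma absorbed_add: "x \<in> absorbed S B0 \<Longrightarrow> y \<in> absorbed S B0 \<Longrightarrow> x + y \<in> absorbed S B0"
  using tensor_add_left[of "coset Y x" "coset Y y"] S_add add_subgroup_add[OF X.C] B0
  by (auto simp: absorbed_def A_eq subset_iff simp flip: A_add_coset)

lemma absorbed_pol:
  assumes p: "p \<in> pols (Suc n)" and x: "x \<in> absorbed S B0" shows "rat p * x \<in> absorbed S B0"
proof -
  have "coset Y (rat p * x) \<otimes>\<^sub>T b = weyl_pol p \<odot>\<^bsub>T\<^esub> (coset Y x \<otimes>\<^sub>T b)" if "b \<in> B0" for b
    using x that B0 tensor_pol[OF p, of "coset Y x" b] A'_facts(5)[OF p, of x] by (auto simp: absorbed_def A_eq)
  then show ?thesis
    using x X.s_closed[OF p, of x] S_smult[OF weyl_pol_closed[OF p]] by (simp add: absorbed_def del: mult_fract)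
qed

lemma absorbed_del:
  assumes x: "x \<in> absorbed S B0" shows "rdiff n x \<in> absorbed S B0"
proof -
  have "coset Y (rdiff n x) \<otimes>\<^sub>T b = weyl_del n \<odot>\<^bsub>T\<^esub> (coset Y x \<otimes>\<^sub>T b)" if "b \<in> B0" for b
    using x that B0 tensor_del'[of n "coset Y x" b] A'_facts(6)[of n x] by (auto simp: absorbed_def A_eq)
  then show ?thesis
    using x X.d_closed[of n x] S_smult[OF weyl_del_closed[of n "Suc n"]] by (simp add: absorbed_def)
qed

lemma absorbed_tf1_inverse: "Fraction_Field.Fract 1 (tf1 n f ^ k) \<in> absorbed S B0"
proof (rule delta_generates[OF f absorbed_add absorbed_pol absorbed_del])
  show "delta_fun n f \<in> absorbed S B0" using delta_S delta_X by (simp add: absorbed_def)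
  show "1 \<in> absorbed S B0" using absorbed_Y[OF rat_Y[OF pols_one]] by (simp add: rat_simps)
qed

end

end

text \<open>Independent of the representative as long as the classes are taken modulo functions without pole
  along \<open>t f = 1\<close>, where the residue vanishes.\<close>

definition class_residue :: "nat \<Rightarrow> 'k::field mpol \<Rightarrow> 'k ratfun set \<Rightarrow> 'k ratfun set \<Rightarrow> 'k ratfun set \<Rightarrow> 'k ratfun" where
  "class_residue n f C N b = residue n f (SOME x. x \<in> C \<and> coset N x = b)"

lemma class_residue_coset:
  assumes f: "f \<in> pols n" "f \<noteq> 0" and N: "add_subgroup N" "N \<subseteq> loc_f (Suc n) f"
    and C: "C \<subseteq> loc_f_tf1 n f" and x: "x \<in> C"
  shows "class_residue n f C N (coset N x) = residue n f x"
proof -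
  define y where "y = (SOME y. y \<in> C \<and> coset N y = coset N x)"
  have "y \<in> C \<and> coset N y = coset N x" unfolding y_def by (rule someI[of _ x]) (use x in simp)
  then have y: "y \<in> C" "y - x \<in> loc_f (Suc n) f" using N by (auto simp: coset_eq_iff)
  have "loc_f (Suc n) f \<subseteq> loc_f_tf1 n f"
    unfolding loc_f_def loc_f_tf1_def by (rule localization_mono) (force intro: exI[of _ 0])
  then have "residue n f (x + (y - x)) = residue n f x + 0"
    using residue_add[OF f, of x "y - x"] residue_eq_0[OF f y(2)] x y C by auto
  then show ?thesis by (simp add: class_residue_def y_def)
qed

text \<open>The setting of the three tensor products attached to \<open>M\<close> and \<open>f\<close>; the generator \<open>u\<close> enters only
  through \<open>delta_embedding\<close>.\<close>

locale localized_module =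
  fixes n :: nat and f :: "'k::field_char_0 mpol" and M :: "('k weyl, 'm) module"
  assumes M: "left_module (weyl_algebra n) M" and f: "f \<in> pols n" and f0: "f \<noteq> 0"
begin

sublocale M: left_module "weyl_algebra n" M by (rule M)

abbreviation "K \<equiv> ratfun_weyl_module (loc_f n f)"

lemmas ms = mult_set_powers[OF f f0]

lemma loc_f_facts:
  "x \<in> loc_f n f \<Longrightarrow> y \<in> loc_f n f \<Longrightarrow> x + y \<in> loc_f n f"
  "x \<in> loc_f n f \<Longrightarrow> y \<in> loc_f n f \<Longrightarrow> x * y \<in> loc_f n f"
  "x \<in> loc_f n f \<Longrightarrow> rdiff i x \<in> loc_f n f" "p \<in> pols n \<Longrightarrow> rat p \<in> loc_f n f" "1 \<in> loc_f n f" "0 \<in> loc_f n f"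
  unfolding loc_f_def
  using add_subgroup_add[OF add_subgroup_localization[OF ms(1)]] localization_mult[OF ms(1)]
    localization_rdiff[OF ms(1)] localization_rat[OF ms(1)] localization_rat[OF ms(1) pols_one]
    add_subgroup_zero[OF add_subgroup_localization[OF ms(1)]]
  by (auto simp: rat_simps)

lemmas M_relations = weyl_module_relations[OF M]

sublocale Mf: leibniz_tensor n n "pol_ring n" "pol_module M" "pol_module K" M K pdiff
  by unfold_locales
    (simp_all add: M.smult_closed loc_f_facts ratfun_weyl_module_smult M_relations(1,2) pols_pdiff
  rdiff_add rdiff_mult rdiff_rat rdiff_commute mult.commute add.commute
  del: ratfun_weyl_module_simps(4) mult_fract add_fract)

lemma Mf_weyl_eq: "Mf_weyl n f M = Mf.T"
  by (simp add: Mf_weyl_def)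

subsection \<open>The kernel of \<open>M \<rightarrow> M[f\<^sup>-\<^sup>1]\<close>\<close>

text \<open>
  A relation in \<open>M[f\<^sup>-\<^sup>1]\<close> involves only finitely many fractions.  For a large power \<open>f\<^sup>e\<close> it is
  therefore mapped to a relation in \<open>M\<close> by \<open>m \<otimes> q \<mapsto> (q f\<^sup>e) m\<close>, although this map makes sense only
  if \<open>q f\<^sup>e\<close> is a polynomial; the value \<open>0\<close> for other \<open>q\<close> is arbitrary.
\<close>

definition clear_denom :: "nat \<Rightarrow> 'm \<times> 'k ratfun \<Rightarrow> 'm" where
  "clear_denom e x = (if \<exists>p\<in>pols n. rat p = snd x * rat f ^ e
     then weyl_pol (THE p. p \<in> pols n \<and> rat p = snd x * rat f ^ e) \<odot>\<^bsub>M\<^esub> fst x else \<zero>\<^bsub>M\<^esub>)"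

lemma clear_denom_eq:
  assumes p: "p \<in> pols n" "rat p = q * rat f ^ e"
  shows "clear_denom e (m, q) = weyl_pol p \<odot>\<^bsub>M\<^esub> m"
proof -
  have "(THE p. p \<in> pols n \<and> rat p = q * rat f ^ e) = p"
    using p by (intro the_equality) (simp_all only: rat_simps(7) simp_thms flip: p(2))
  then show ?thesis using p by (auto simp: clear_denom_def)
qed

lemma clear_denom_closed: "m \<in> carrier M \<Longrightarrow> clear_denom e (m, q) \<in> carrier M"
proof (cases "\<exists>p\<in>pols n. rat p = q * rat f ^ e")
  case True
  assume m: "m \<in> carrier M"
  from True obtain p where "p \<in> pols n" "rat p = q * rat f ^ e" by blast
  with m show ?thesis by (simp only: clear_denom_eq M.smult_closed weyl_pol_closed)
next
  case False
  then show ?thesis by (simp add: clear_denom_def)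
qed

lemma loc_f_clear:
  assumes "q \<in> loc_f n f" shows "\<exists>l. \<forall>e\<ge>l. \<exists>p\<in>pols n. rat p = q * rat f ^ e"
proof -
  obtain a l where a: "a \<in> pols n" "q = rat a / rat (f ^ l)"
    using assms unfolding loc_f_def localization_iff by blast
  have "\<exists>p\<in>pols n. rat p = q * rat f ^ e" if "e \<ge> l" for e
  proof
    show "a * f ^ (e - l) \<in> pols n" by (intro pols_mult pols_power a f)
    show "rat (a * f ^ (e - l)) = q * rat f ^ e"
      unfolding a(2) using f0 that
      by (simp add: rat_simps rat_power power_diff del: mult_fract divide_fract)
  qed
  then show ?thesis by blast
qed

lemma Mf_kernel:
  assumes m: "m \<in> carrier M" and rel: "frag_of (m, 1) \<in> Mf.Rel"
  shows "\<exists>k. weyl_pol (f ^ k) \<odot>\<^bsub>M\<^esub> m = \<zero>\<^bsub>M\<^esub>"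
proof -
  let ?F = "free_Abelian_group (carrier M \<times> loc_f n f)" and ?A = "add_monoid M"
  have "\<exists>h. h \<in> hom ?F ?A \<and> (\<forall>x\<in>carrier M \<times> loc_f n f. h (frag_of x) = clear_denom e x)" for e
  proof -
    have "clear_denom e ` (carrier M \<times> loc_f n f) \<subseteq> carrier ?A" using clear_denom_closed by auto
    from comm_group.free_Abelian_group_universal[OF M.M.a_comm_group this] show ?thesis by metis
  qed
  then obtain h where h: "\<And>e. h e \<in> hom ?F ?A"
    and h_of: "\<And>e m q. m \<in> carrier M \<Longrightarrow> q \<in> loc_f n f \<Longrightarrow> h e (frag_of (m, q)) = clear_denom e (m, q)"
    by (metis mem_Sigma_iff)
  let ?Free = "{c :: 'm \<times> 'k ratfun \<Rightarrow>\<^sub>0 int. keys c \<subseteq> carrier M \<times> loc_f n f}"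
  have h_closed: "h e x \<in> carrier M" if "x \<in> ?Free" for e x
    using hom_in_carrier[OF h[of e], of x] that by simp
  have h_add: "h e (x + y) = h e x \<oplus>\<^bsub>M\<^esub> h e y" if "x \<in> ?Free" "y \<in> ?Free" for e x y
    using hom_mult[OF h[of e], of x y] that by simp
  have h_diff: "h e (x - y) = h e x \<ominus>\<^bsub>M\<^esub> h e y" if xy: "x \<in> ?Free" "y \<in> ?Free" for e x y
  proof -
    have d: "x - y \<in> ?Free" using add_subgroup_diff[OF add_subgroup_free] xy by blast
    have "h e (x - y) \<oplus>\<^bsub>M\<^esub> h e y = h e x" using h_add[OF d xy(2)] by simp
    then show ?thesis
      using h_closed[OF d] h_closed[OF xy(2)] by (metis M.M.add.inv_solve_right M.M.minus_eq h_closed xy(1))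
  qed
  have h_zero: "h e 0 = \<zero>\<^bsub>M\<^esub>" for e using h_diff[of 0 0 e] h_closed[of 0 e] by (simp add: M.M.minus_eq M.M.r_neg)
  define H where "H = {c \<in> ?Free. \<exists>l. \<forall>e\<ge>l. h e c = \<zero>\<^bsub>M\<^esub>}"
  have fr: "frag_of (a, b) \<in> ?Free" if "a \<in> carrier M" "b \<in> loc_f n f" for a b using that by (simp add: keys_frag_of)
  have Free_diff: "x - y \<in> ?Free" if "x \<in> ?Free" "y \<in> ?Free" for x y
    using add_subgroup_diff[OF add_subgroup_free that] .
  have "Mf.Rel \<subseteq> H"
  proof (rule Mf.Rel_least)
    show "add_subgroup H"
    proof (rule add_subgroupI)
      show "0 \<in> H" by (auto simp: H_def h_zero)
      fix x y assume xy: "x \<in> H" "y \<in> H"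
      then obtain l l' where l: "\<And>e. e \<ge> l \<Longrightarrow> h e x = \<zero>\<^bsub>M\<^esub>" "\<And>e. e \<ge> l' \<Longrightarrow> h e y = \<zero>\<^bsub>M\<^esub>"
        by (auto simp: H_def)
      have "h e (x - y) = \<zero>\<^bsub>M\<^esub>" if "e \<ge> max l l'" for e
        using xy l that by (subst h_diff) (auto simp: H_def M.M.minus_eq)
      then show "x - y \<in> H" using xy Free_diff[of x y] unfolding H_def by blast
    qed
  next
    fix a a' b assume "a \<in> carrier (pol_module M)" "a' \<in> carrier (pol_module M)" "b \<in> carrier (pol_module K)"
    then have ab: "a \<in> carrier M" "a' \<in> carrier M" "b \<in> loc_f n f" by simp_all
    obtain l where l: "\<And>e. e \<ge> l \<Longrightarrow> \<exists>p\<in>pols n. rat p = b * rat f ^ e" using loc_f_clear[OF ab(3)] by blast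
    have "h e (frag_of (a \<oplus>\<^bsub>M\<^esub> a', b) - frag_of (a, b) - frag_of (a', b)) = \<zero>\<^bsub>M\<^esub>" if "e \<ge> l" for e
    proof -
      obtain p where p: "p \<in> pols n" "rat p = b * rat f ^ e" using l[OF \<open>e \<ge> l\<close>] by blast
      have "h e (frag_of (a \<oplus>\<^bsub>M\<^esub> a', b) - frag_of (a, b) - frag_of (a', b)) =
          weyl_pol p \<odot>\<^bsub>M\<^esub> (a \<oplus>\<^bsub>M\<^esub> a') \<ominus>\<^bsub>M\<^esub> weyl_pol p \<odot>\<^bsub>M\<^esub> a \<ominus>\<^bsub>M\<^esub> weyl_pol p \<odot>\<^bsub>M\<^esub> a'"
        using ab by (simp only: h_diff Free_diff fr M.M.a_closed h_of clear_denom_eq[OF p])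
      also have "\<dots> = \<zero>\<^bsub>M\<^esub>"
        using ab p M.smult_closed[of "weyl_pol p"] by (simp add: M.smult_r_distr M.M.minus_eq M.M.a_ac M.M.r_neg M.M.r_neg1)
      finally show ?thesis .
    qed
    then show "frag_of (a \<oplus>\<^bsub>pol_module M\<^esub> a', b) - frag_of (a, b) - frag_of (a', b) \<in> H"
      using ab Free_diff fr by (auto simp: H_def)
  next
    fix a b b' assume "a \<in> carrier (pol_module M)" "b \<in> carrier (pol_module K)" "b' \<in> carrier (pol_module K)"
    then have ab: "a \<in> carrier M" "b \<in> loc_f n f" "b' \<in> loc_f n f" by simp_all
    obtain l where l: "\<And>e. e \<ge> l \<Longrightarrow> \<exists>p\<in>pols n. rat p = b * rat f ^ e" using loc_f_clear[OF ab(2)] by blast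
    obtain l' where l': "\<And>e. e \<ge> l' \<Longrightarrow> \<exists>p\<in>pols n. rat p = b' * rat f ^ e" using loc_f_clear[OF ab(3)] by blast
    have "h e (frag_of (a, b + b') - frag_of (a, b) - frag_of (a, b')) = \<zero>\<^bsub>M\<^esub>" if e: "e \<ge> max l l'" for e
    proof -
      obtain p where p: "p \<in> pols n" "rat p = b * rat f ^ e" using l[of e] e by auto
      obtain p' where p': "p' \<in> pols n" "rat p' = b' * rat f ^ e" using l'[of e] e by auto
      have pp': "rat (p + p') = (b + b') * rat f ^ e" by (simp only: rat_simps p p' distrib_right)
      have "h e (frag_of (a, b + b') - frag_of (a, b) - frag_of (a, b')) =
          weyl_pol (p + p') \<odot>\<^bsub>M\<^esub> a \<ominus>\<^bsub>M\<^esub> weyl_pol p \<odot>\<^bsub>M\<^esub> a \<ominus>\<^bsub>M\<^esub> weyl_pol p' \<odot>\<^bsub>M\<^esub> a"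
        using ab by (simp only: h_diff Free_diff fr loc_f_facts h_of clear_denom_eq[OF p] clear_denom_eq[OF p']
          clear_denom_eq[OF pols_add[OF p(1) p'(1)] pp'])
      also have "\<dots> = \<zero>\<^bsub>M\<^esub>"
        using ab p p' M.smult_closed[of _ a] M.smult_l_distr[of "weyl_pol p" "weyl_pol p'" a]
        by (simp add: weyl_pol_add weyl_algebra_simps M.M.minus_eq M.M.a_ac M.M.r_neg M.M.r_neg1)
      finally show ?thesis .
    qed
    then show "frag_of (a, b \<oplus>\<^bsub>pol_module K\<^esub> b') - frag_of (a, b) - frag_of (a, b') \<in> H"
      using ab Free_diff[OF Free_diff[OF fr fr] fr, of a "b + b'" a b a b'] loc_f_facts(1)[of b b']
      unfolding H_def by (auto intro!: exI[of _ "max l l'"])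
  next
    fix r :: "'k mpol" and a b assume "r \<in> carrier (pol_ring n)" "a \<in> carrier (pol_module M)" "b \<in> carrier (pol_module K)"
    then have ab: "r \<in> pols n" "a \<in> carrier M" "b \<in> loc_f n f" by simp_all
    obtain l where l: "\<And>e. e \<ge> l \<Longrightarrow> \<exists>p\<in>pols n. rat p = b * rat f ^ e" using loc_f_clear[OF ab(3)] by blast
    have ra: "weyl_pol r \<odot>\<^bsub>M\<^esub> a \<in> carrier M" using ab by (simp add: M.smult_closed)
    have rb: "rat r * b \<in> loc_f n f" using ab by (intro loc_f_facts)
    have "h e (frag_of (weyl_pol r \<odot>\<^bsub>M\<^esub> a, b) - frag_of (a, rat r * b)) = \<zero>\<^bsub>M\<^esub>" if "e \<ge> l" for e
    proof -
      obtain p where p: "p \<in> pols n" "rat p = b * rat f ^ e" using l[OF \<open>e \<ge> l\<close>] by blast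
      have rp: "rat (p * r) = rat r * b * rat f ^ e" by (simp only: rat_simps p mult_ac)
      have "h e (frag_of (weyl_pol r \<odot>\<^bsub>M\<^esub> a, b) - frag_of (a, rat r * b)) =
          weyl_pol p \<odot>\<^bsub>M\<^esub> (weyl_pol r \<odot>\<^bsub>M\<^esub> a) \<ominus>\<^bsub>M\<^esub> weyl_pol (p * r) \<odot>\<^bsub>M\<^esub> a"
        using ab ra rb by (simp only: h_diff fr h_of clear_denom_eq[OF p] clear_denom_eq[OF pols_mult[OF p(1) ab(1)] rp])
      also have "\<dots> = \<zero>\<^bsub>M\<^esub>"
        using ab p M.smult_closed[of "weyl_pol (p * r)" a] by (simp add: M_relations(1) pols_mult M.M.minus_eq M.M.r_neg)
      finally show ?thesis .
    qed
    then show "frag_of (r \<odot>\<^bsub>pol_module M\<^esub> a, b) - frag_of (a, r \<odot>\<^bsub>pol_module K\<^esub> b) \<in> H"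
      using ab ra rb Free_diff fr
      by (auto simp: H_def ratfun_weyl_module_smult simp del: ratfun_weyl_module_simps(4))
  qed
  then have "frag_of (m, 1) \<in> H" using rel by blast
  then obtain l where l: "\<And>e. e \<ge> l \<Longrightarrow> h e (frag_of (m, 1)) = \<zero>\<^bsub>M\<^esub>" unfolding H_def by blast
  have "rat (f ^ l) = 1 * rat f ^ l" by (simp add: rat_power)
  then have "weyl_pol (f ^ l) \<odot>\<^bsub>M\<^esub> m = h l (frag_of (m, 1))"
    using m loc_f_facts(5) by (simp only: h_of clear_denom_eq[OF pols_power[OF f]])
  with l show ?thesis by auto
qed


subsection \<open>\<open>M[f\<^sup>-\<^sup>1]\<close> as a module over \<open>K[x,f\<^sup>-\<^sup>1]\<close>\<close>

abbreviation scale :: "'k ratfun \<Rightarrow> ('m \<times> 'k ratfun \<Rightarrow>\<^sub>0 int) \<Rightarrow> ('m \<times> 'k ratfun \<Rightarrow>\<^sub>0 int)" where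
  "scale \<equiv> snd_act (ratfun_mult_module (loc_f n f))"

lemma scale_of: "scale r (frag_of (m, q)) = frag_of (m, r * q)"
  by (simp add: snd_act_def)

lemma scale_diff: "scale r (x - y) = scale r x - scale r y"
  by (simp add: snd_act_def frag_extend_diff)

lemma scale_Free:
  assumes "r \<in> loc_f n f" "c \<in> Mf.Free" shows "scale r c \<in> Mf.Free"
proof (rule free_additive_closed[OF _ add_subgroup_free scale_diff])
  fix x assume "x \<in> carrier (pol_module M) \<times> carrier (pol_module K)"
  then show "scale r (frag_of x) \<in> Mf.Free"
    using assms(1) by (auto simp: scale_of keys_frag_of loc_f_facts(2))
qed (use assms in simp)

lemma scale_Rel:
  assumes r: "r \<in> loc_f n f" and c: "c \<in> Mf.Rel" shows "scale r c \<in> Mf.Rel"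
proof (rule Mf.Rel_image[OF Mf.add_subgroup_Rel scale_diff _ _ _ c])
  fix a a' b assume "a \<in> carrier (pol_module M)" "a' \<in> carrier (pol_module M)" "b \<in> carrier (pol_module K)"
  then show "scale r (frag_of (a \<oplus>\<^bsub>pol_module M\<^esub> a', b)) - scale r (frag_of (a, b)) - scale r (frag_of (a', b)) \<in> Mf.Rel"
    using Mf.Rel_left[of a a' "r * b"] loc_f_facts(2)[OF r] by (simp add: scale_of)
next
  fix a b b' assume "a \<in> carrier (pol_module M)" "b \<in> carrier (pol_module K)" "b' \<in> carrier (pol_module K)"
  then show "scale r (frag_of (a, b \<oplus>\<^bsub>pol_module K\<^esub> b')) - scale r (frag_of (a, b)) - scale r (frag_of (a, b')) \<in> Mf.Rel"
    using Mf.Rel_right[of a "r * b" "r * b'"] loc_f_facts(2)[OF r] by (simp add: scale_of distrib_left)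
next
  fix p :: "'k mpol" and a b assume "p \<in> carrier (pol_ring n)" "a \<in> carrier (pol_module M)" "b \<in> carrier (pol_module K)"
  then show "scale r (frag_of (p \<odot>\<^bsub>pol_module M\<^esub> a, b)) - scale r (frag_of (a, p \<odot>\<^bsub>pol_module K\<^esub> b)) \<in> Mf.Rel"
    using Mf.Rel_smult[of p a "r * b"] loc_f_facts(2)[OF r]
    by (simp add: scale_of ratfun_weyl_module_smult mult.left_commute del: ratfun_weyl_module_simps(4) mult_fract)
qed

lemma scale_plus:
  assumes "r \<in> loc_f n f" "r' \<in> loc_f n f" "c \<in> Mf.Free"
  shows "scale (r + r') c - scale r c - scale r' c \<in> Mf.Rel"
proof (rule free_additive_closed[of c "carrier M \<times> loc_f n f", OF _ Mf.add_subgroup_Rel])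
  fix x assume "x \<in> carrier M \<times> loc_f n f"
  then obtain m q where "x = (m, q)" "m \<in> carrier M" "q \<in> loc_f n f" by auto
  then show "scale (r + r') (frag_of x) - scale r (frag_of x) - scale r' (frag_of x) \<in> Mf.Rel"
    using Mf.Rel_right[of m "r * q" "r' * q"] assms by (simp add: scale_of distrib_right loc_f_facts(2))
qed (use assms in \<open>auto simp: scale_diff\<close>)

lemma scale_mult: "scale r (scale r' c) = scale (r * r') c"
proof -
  have "scale r (scale r' c) - scale (r * r') c \<in> {0}"
    by (rule free_additive_closed[of c UNIV, OF _ add_subgroup_zero_set])
      (auto simp: scale_diff scale_of mult.assoc)
  then show ?thesis by simp
qed

lemma scale_del:
  assumes "r \<in> loc_f n f" "i < n" "c \<in> Mf.Free"
  shows "Mf.d_op i (scale r c) - (scale r (Mf.d_op i c) + scale (rdiff i r) c) \<in> Mf.Rel"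
proof (rule free_additive_closed[of c "carrier M \<times> loc_f n f", OF _ Mf.add_subgroup_Rel])
  fix x assume "x \<in> carrier M \<times> loc_f n f"
  then obtain m q where x: "x = (m, q)" "m \<in> carrier M" "q \<in> loc_f n f" by auto
  have add: "scale r (y + z) = scale r y + scale r z" for y z by (simp add: snd_act_def frag_extend_add)
  have "Mf.d_op i (scale r (frag_of x)) - (scale r (Mf.d_op i (frag_of x)) + scale (rdiff i r) (frag_of x)) =
      frag_of (m, r * rdiff i q + rdiff i r * q) - frag_of (m, r * rdiff i q) - frag_of (m, rdiff i r * q)"
    unfolding x(1) using assms(2)
    by (simp add: Mf.d_of scale_of add ratfun_weyl_module_smult rdiff_mult add.commute algebra_simps
        del: ratfun_weyl_module_simps(4))
  also have "\<dots> \<in> Mf.Rel"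
    using Mf.Rel_right[of m "r * rdiff i q" "rdiff i r * q"] x assms by (simp add: loc_f_facts)
  finally show "Mf.d_op i (scale r (frag_of x)) - (scale r (Mf.d_op i (frag_of x)) + scale (rdiff i r) (frag_of x)) \<in> Mf.Rel" .
qed (use assms in \<open>auto simp: scale_diff Mf.d_diff\<close>)

lemma Mf_loc_smult: "r \<in> loc_f n f \<Longrightarrow> r \<odot>\<^bsub>Mf_loc n f M\<^esub> coset Mf.Rel c = coset Mf.Rel (scale r c)"
  unfolding Mf_loc_def tensor_module_def
  by (subst quot_module_smult) (simp_all add: Mf.add_subgroup_Rel free_pairs_def scale_diff scale_Rel)

lemma Mf_loc_add: "add (Mf_loc n f M) = add Mf.T"
  unfolding Mf_loc_def tensor_module_def by (rule quot_module_add_cong) (simp add: free_pairs_def)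

lemma Mf_loc_carrier: "carrier (Mf_loc n f M) = coset Mf.Rel ` Mf.Free"
  unfolding Mf_loc_def tensor_module_def by (subst quot_module_simps) (auto simp: free_pairs_def)

abbreviation \<iota> where "\<iota> \<equiv> iota n f M"

lemma iota_eq: "\<iota> m = coset Mf.Rel (frag_of (m, 1))"
  by (simp add: iota_def Mf.tensor_eq_coset)

lemma frag_Mf_Free: "m \<in> carrier M \<Longrightarrow> q \<in> loc_f n f \<Longrightarrow> frag_of (m, q) \<in> Mf.Free"
  by (simp add: keys_frag_of)

lemma iota_closed: "m \<in> carrier M \<Longrightarrow> \<iota> m \<in> carrier (Mf_loc n f M)"
  unfolding Mf_loc_carrier iota_eq by (intro imageI frag_Mf_Free loc_f_facts)

lemma iota_add: "m \<in> carrier M \<Longrightarrow> m' \<in> carrier M \<Longrightarrow> \<iota> (m \<oplus>\<^bsub>M\<^esub> m') = \<iota> m \<oplus>\<^bsub>Mf_loc n f M\<^esub> \<iota> m'"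
  using Mf.tensor_add_left[of m m' 1] loc_f_facts(5) by (simp add: iota_def Mf_loc_add)

lemma iota_pol: "p \<in> pols n \<Longrightarrow> m \<in> carrier M \<Longrightarrow> rat p \<odot>\<^bsub>Mf_loc n f M\<^esub> \<iota> m = \<iota> (weyl_pol p \<odot>\<^bsub>M\<^esub> m)"
  using Mf.Rel_smult[of p m 1] loc_f_facts(5)
  by (simp add: iota_eq Mf_loc_smult loc_f_facts scale_of coset_eq_iff Mf.add_subgroup_Rel ratfun_weyl_module_smult
      del: ratfun_weyl_module_simps(4))
    (use add_subgroup_minus[OF Mf.add_subgroup_Rel] in fastforce)

lemma rdiff_one: "rdiff i 1 = 0"
  using rdiff_rat[of i 1] by (simp add: rat_simps)

lemma iota_del:
  assumes i: "i < n" and m: "m \<in> carrier M"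
  shows "weyl_del i \<odot>\<^bsub>Mf.T\<^esub> \<iota> m = \<iota> (weyl_del i \<odot>\<^bsub>M\<^esub> m)"
proof -
  interpret T: left_module "weyl_algebra n" Mf.T by (rule Mf.left_module_T)
  have dm: "weyl_del i \<odot>\<^bsub>M\<^esub> m \<in> carrier M" using i m by (simp add: M.smult_closed)
  have z: "Mf.tensor m 0 = \<zero>\<^bsub>Mf.T\<^esub>"
    using m loc_f_facts(6) by (intro Mf.tensor_zero_right) simp_all
  have "weyl_del i \<odot>\<^bsub>Mf.T\<^esub> \<iota> m = Mf.tensor (weyl_del i \<odot>\<^bsub>M\<^esub> m) 1 \<oplus>\<^bsub>Mf.T\<^esub> Mf.tensor m 0"
    unfolding iota_def using i m loc_f_facts(5) Mf.tensor_del[of i m 1]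
    by (simp add: ratfun_weyl_module_smult rdiff_one del: ratfun_weyl_module_simps(4))
  also have "\<dots> = \<iota> (weyl_del i \<odot>\<^bsub>M\<^esub> m)"
    unfolding z iota_def using Mf.tensor_closed[of "weyl_del i \<odot>\<^bsub>M\<^esub> m" 1] dm loc_f_facts(5) by simp
  finally show ?thesis .
qed

subsection \<open>\<open>B\<^sub>Z\<^sub>|\<^sub>Y[f\<^sup>-\<^sup>1] \<otimes> M[f\<^sup>-\<^sup>1]\<close>\<close>

abbreviation CE where "CE \<equiv> loc_f_tf1 n f"
abbreviation NE where "NE \<equiv> loc_f (Suc n) f"

lemma NE_sub: "{f ^ j |j. True} \<subseteq> {f ^ j * tf1 n f ^ k |j k. True}"
  by (force intro: exI[of _ 0])

lemma add_subgroup_NE: "add_subgroup NE"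
  unfolding loc_f_def by (rule add_subgroup_localization[OF ms(2)])

lemma loc_f_Suc: "r \<in> loc_f n f \<Longrightarrow> r \<in> NE"
  unfolding loc_f_def localization_iff by (meson le_SucI order_refl pols_mono)

lemma NE_CE: "NE \<subseteq> CE"
  unfolding loc_f_def loc_f_tf1_def by (rule localization_mono[OF NE_sub])

lemma CE_mult: "x \<in> CE \<Longrightarrow> y \<in> CE \<Longrightarrow> x * y \<in> CE"
  and NE_mult: "x \<in> NE \<Longrightarrow> y \<in> NE \<Longrightarrow> x * y \<in> NE" and NE_rat: "p \<in> pols (Suc n) \<Longrightarrow> rat p \<in> NE"
  and add_subgroup_CE: "add_subgroup CE"
  unfolding loc_f_def loc_f_tf1_def
  by (simp_all only: localization_mult[OF ms(4)] localization_mult[OF ms(2)]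
      localization_rat[OF ms(2)] add_subgroup_localization[OF ms(4)])

lemma rdiff_n_loc_f: "r \<in> loc_f n f \<Longrightarrow> rdiff n r = 0"
proof -
  assume "r \<in> loc_f n f"
  then obtain a l where a: "a \<in> pols n" "r = rat a / rat (f ^ l)"
    unfolding loc_f_def localization_iff by blast
  then have "pdiff n a = 0" "pdiff n (f ^ l) = 0" using f by (auto intro!: pols_pdiff_eq_0 pols_power)
  then show "rdiff n r = 0"
    unfolding a(2) rdiff_divide[OF power_not_zero[OF f0]] by (simp only: mult_zero_left mult_zero_right rat_simps div_0 diff_self)
qed

lemma ops_E: "weyl_operators (Suc n) CE NE (\<lambda>p x. rat p * x) rdiff"
  unfolding loc_f_def loc_f_tf1_def by (rule weyl_operators_ratfun[OF ms(4,2) NE_sub])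

lemmas Bf_facts = ratfun_quot_facts[OF ops_E, folded Bf_weyl_def]

lemma Bf_loc_carrier: "carrier (Bf_loc n f) = coset NE ` CE"
  unfolding Bf_loc_def by (subst quot_module_simps) simp_all

lemma Bf_loc_add: "add (Bf_weyl n f) = add (Bf_loc n f)"
  unfolding Bf_loc_def Bf_weyl_def by (rule quot_module_add_cong) simp

lemma Bf_loc_smult: "r \<in> loc_f n f \<Longrightarrow> r \<odot>\<^bsub>Bf_loc n f\<^esub> coset NE x = coset NE (r * x)"
  unfolding Bf_loc_def
  by (subst quot_module_smult) (simp_all add: add_subgroup_NE right_diff_distrib NE_mult loc_f_Suc)

lemma Bf_loc_plus: "coset NE x \<oplus>\<^bsub>Bf_loc n f\<^esub> coset NE y = coset NE (x + y)"
  using Bf_facts(4)[of x y] by (simp add: Bf_loc_add)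

lemma loc_f_CE: "r \<in> loc_f n f \<Longrightarrow> r \<in> CE"
  using loc_f_Suc NE_CE by auto

lemma delta_in_CE: "delta_fun n f \<in> CE"
  unfolding loc_f_tf1_def localization_def using f by (fastforce intro: pols_mono exI[of _ 0] exI[of _ 1])

sublocale E: delta_tensor n "ratfun_ring (loc_f n f)" "Bf_loc n f" "Mf_loc n f M" "Bf_weyl n f" "Mf_weyl n f M" rdiff f CE NE
proof (intro delta_tensor.intro delta_tensor_axioms.intro f ops_E delta_in_CE NE_rat leibniz_tensor.intro tensor_pair.intro leibniz_tensor_axioms.intro)
  show "left_module (weyl_algebra (Suc n)) (Bf_weyl n f)" by (rule Bf_facts(1))
  show "carrier (Bf_weyl n f) = carrier (Bf_loc n f)" by (simp only: Bf_facts(2) Bf_loc_carrier)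
  show "add (Bf_weyl n f) = add (Bf_loc n f)" by (rule Bf_loc_add)
  interpret T: left_module "weyl_algebra n" Mf.T by (rule Mf.left_module_T)
  show "b \<oplus>\<^bsub>Mf_loc n f M\<^esub> b' \<in> carrier (Mf_loc n f M)"
    if "b \<in> carrier (Mf_loc n f M)" "b' \<in> carrier (Mf_loc n f M)" for b b'
    using that T.M.a_closed by (simp add: Mf_loc_add Mf_loc_carrier Mf.T_carrier)
  show "weyl_del i \<odot>\<^bsub>Mf_weyl n f M\<^esub> (b \<oplus>\<^bsub>Mf_loc n f M\<^esub> b') =
      weyl_del i \<odot>\<^bsub>Mf_weyl n f M\<^esub> b \<oplus>\<^bsub>Mf_loc n f M\<^esub> weyl_del i \<odot>\<^bsub>Mf_weyl n f M\<^esub> b'"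
    if "i < n" "b \<in> carrier (Mf_loc n f M)" "b' \<in> carrier (Mf_loc n f M)" for i b b'
    using that T.smult_r_distr[of "weyl_del i" b b'] by (simp add: Mf_loc_add Mf_loc_carrier Mf.T_carrier Mf_weyl_eq)
  show "weyl_del i \<odot>\<^bsub>Mf_weyl n f M\<^esub> b \<in> carrier (Mf_loc n f M)" if "i < n" "b \<in> carrier (Mf_loc n f M)" for i b
    using that T.smult_closed[of "weyl_del i" b] by (simp add: Mf_loc_carrier Mf.T_carrier Mf_weyl_eq)
  show "weyl_del i \<odot>\<^bsub>Mf_weyl n f M\<^esub> (weyl_del j \<odot>\<^bsub>Mf_weyl n f M\<^esub> b) =
      weyl_del j \<odot>\<^bsub>Mf_weyl n f M\<^esub> (weyl_del i \<odot>\<^bsub>Mf_weyl n f M\<^esub> b)"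
    if "i < n" "j < n" "b \<in> carrier (Mf_loc n f M)" for i j b
    using that by (simp add: Mf_loc_carrier Mf.T_carrier Mf_weyl_eq weyl_module_relations(3)[OF Mf.left_module_T])
  show "r \<odot>\<^bsub>Mf_loc n f M\<^esub> b \<in> carrier (Mf_loc n f M)"
    if "r \<in> carrier (ratfun_ring (loc_f n f))" "b \<in> carrier (Mf_loc n f M)" for r b
    using that scale_Free by (auto simp: Mf_loc_carrier Mf_loc_smult)
  show "weyl_del i \<odot>\<^bsub>Mf_weyl n f M\<^esub> (r \<odot>\<^bsub>Mf_loc n f M\<^esub> b) =
      r \<odot>\<^bsub>Mf_loc n f M\<^esub> (weyl_del i \<odot>\<^bsub>Mf_weyl n f M\<^esub> b) \<oplus>\<^bsub>Mf_loc n f M\<^esub> rdiff i r \<odot>\<^bsub>Mf_loc n f M\<^esub> b"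
    if r: "i < n" "r \<in> carrier (ratfun_ring (loc_f n f))" "b \<in> carrier (Mf_loc n f M)" for i r b
  proof -
    obtain c where c: "c \<in> Mf.Free" "b = coset Mf.Rel c" using r(3) by (auto simp only: Mf_loc_carrier)
    have r': "r \<in> loc_f n f" using r(2) by simp
    have "weyl_del i \<odot>\<^bsub>Mf_weyl n f M\<^esub> (r \<odot>\<^bsub>Mf_loc n f M\<^esub> b) = coset Mf.Rel (Mf.d_op i (scale r c))"
      by (simp only: c(2) Mf_weyl_eq Mf_loc_smult r' Mf.T_del r scale_Free c(1))
    moreover have "r \<odot>\<^bsub>Mf_loc n f M\<^esub> (weyl_del i \<odot>\<^bsub>Mf_weyl n f M\<^esub> b) \<oplus>\<^bsub>Mf_loc n f M\<^esub> rdiff i r \<odot>\<^bsub>Mf_loc n f M\<^esub> b =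
      coset Mf.Rel (scale r (Mf.d_op i c) + scale (rdiff i r) c)"
      by (simp only: c(2) Mf_weyl_eq Mf_loc_smult r' loc_f_facts(3) Mf.T_del r c(1) Mf_loc_add Mf.T_add)
    ultimately show ?thesis
      using scale_del[OF r' r(1) c(1)] by (simp only: coset_eq_iff[OF Mf.add_subgroup_Rel])
  qed
next
  fix x y assume "x \<in> carrier (Bf_loc n f)" "y \<in> carrier (Bf_loc n f)"
  then show "x \<oplus>\<^bsub>Bf_loc n f\<^esub> y \<in> carrier (Bf_loc n f)"
    using add_subgroup_add[OF add_subgroup_CE] by (auto simp: Bf_loc_carrier Bf_loc_plus)
next
  fix r x assume "r \<in> carrier (ratfun_ring (loc_f n f))" "x \<in> carrier (Bf_loc n f)"
  then show "r \<odot>\<^bsub>Bf_loc n f\<^esub> x \<in> carrier (Bf_loc n f)"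
    by (auto simp: Bf_loc_carrier Bf_loc_smult CE_mult loc_f_CE)
next
  fix p :: "'k mpol" and r x assume "p \<in> pols (Suc n)" "r \<in> carrier (ratfun_ring (loc_f n f))" "x \<in> carrier (Bf_loc n f)"
  then show "weyl_pol p \<odot>\<^bsub>Bf_weyl n f\<^esub> (r \<odot>\<^bsub>Bf_loc n f\<^esub> x) = r \<odot>\<^bsub>Bf_loc n f\<^esub> (weyl_pol p \<odot>\<^bsub>Bf_weyl n f\<^esub> x)"
    by (auto simp: Bf_loc_carrier Bf_loc_smult Bf_facts(5) CE_mult loc_f_CE mult.left_commute)
next
  fix i r x assume "i < n" "r \<in> carrier (ratfun_ring (loc_f n f))" "x \<in> carrier (Bf_loc n f)"
  then show "weyl_del i \<odot>\<^bsub>Bf_weyl n f\<^esub> (r \<odot>\<^bsub>Bf_loc n f\<^esub> x) =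
      r \<odot>\<^bsub>Bf_loc n f\<^esub> (weyl_del i \<odot>\<^bsub>Bf_weyl n f\<^esub> x) \<oplus>\<^bsub>Bf_loc n f\<^esub> rdiff i r \<odot>\<^bsub>Bf_loc n f\<^esub> x"
    by (auto simp: Bf_loc_carrier Bf_loc_smult Bf_facts(6) CE_mult loc_f_CE rdiff_mult Bf_loc_plus loc_f_facts add.commute)
next
  fix i r x assume "n \<le> i" "i < Suc n" "r \<in> carrier (ratfun_ring (loc_f n f))" "x \<in> carrier (Bf_loc n f)"
  moreover from this have "i = n" by simp
  ultimately show "weyl_del i \<odot>\<^bsub>Bf_weyl n f\<^esub> (r \<odot>\<^bsub>Bf_loc n f\<^esub> x) = r \<odot>\<^bsub>Bf_loc n f\<^esub> (weyl_del i \<odot>\<^bsub>Bf_weyl n f\<^esub> x)"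
    by (auto simp: Bf_loc_carrier Bf_loc_smult Bf_facts(6) CE_mult loc_f_CE rdiff_mult rdiff_n_loc_f)
qed (simp_all add: loc_f_facts Bf_weyl_def)

lemma Bf_tensor_Mf_eq: "Bf_tensor_Mf n f M = E.T"
  by (simp add: Bf_tensor_Mf_def)


lemma delta_eq: "delta n f = coset NE (delta_fun n f)"
  unfolding delta_def by (rule a_r_coset_eq_coset) simp

lemma E_pol:
  assumes "p \<in> pols n" "m \<in> carrier M"
  shows "weyl_pol p \<odot>\<^bsub>E.T\<^esub> E.tensor (delta n f) (\<iota> m) = E.tensor (delta n f) (\<iota> (weyl_pol p \<odot>\<^bsub>M\<^esub> m))"
proof -
  have p: "p \<in> pols (Suc n)" "rat p \<in> loc_f n f" using assms(1) by (auto intro: pols_mono loc_f_facts)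
  have "weyl_pol p \<odot>\<^bsub>Bf_weyl n f\<^esub> coset NE (delta_fun n f) = rat p \<odot>\<^bsub>Bf_loc n f\<^esub> coset NE (delta_fun n f)"
    by (simp only: Bf_facts(5) Bf_loc_smult p delta_in_CE)
  then show ?thesis
    using E.tensor_pol[OF p(1) E.delta_class_closed iota_closed[OF assms(2)]]
      E.tensor_smult[OF _ E.delta_class_closed iota_closed[OF assms(2)], of "rat p"] p(2) iota_pol[OF assms]
    by (simp add: delta_eq)
qed

text \<open>
  The map \<open>b \<otimes> z \<mapsto> res(b) z\<close> is constructed on pairs, with values in the free group behind
  \<open>M[f\<^sup>-\<^sup>1]\<close>.  This requires choosing representatives for \<open>z\<close>; the choice disappears modulo relations.
\<close>

definition representative :: "('m \<times> 'k ratfun \<Rightarrow>\<^sub>0 int) set \<Rightarrow> ('m \<times> 'k ratfun \<Rightarrow>\<^sub>0 int)" where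
  "representative z = (SOME c. c \<in> Mf.Free \<and> coset Mf.Rel c = z)"

lemma representative:
  assumes "c \<in> Mf.Free"
  shows "representative (coset Mf.Rel c) \<in> Mf.Free" "representative (coset Mf.Rel c) - c \<in> Mf.Rel"
proof -
  have "representative (coset Mf.Rel c) \<in> Mf.Free \<and> coset Mf.Rel (representative (coset Mf.Rel c)) = coset Mf.Rel c"
    unfolding representative_def by (rule someI[of _ c]) (use assms in simp)
  then show "representative (coset Mf.Rel c) \<in> Mf.Free" "representative (coset Mf.Rel c) - c \<in> Mf.Rel"
    by (simp_all add: coset_eq_iff Mf.add_subgroup_Rel)
qed

lemma E_kernel:
  assumes m: "m \<in> carrier M" and 0: "E.tensor (delta n f) (\<iota> m) = \<zero>\<^bsub>E.T\<^esub>"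
  shows "\<exists>k. weyl_pol (f ^ k) \<odot>\<^bsub>M\<^esub> m = \<zero>\<^bsub>M\<^esub>"
proof -
  define F where "F = frag_extend (\<lambda>(b, z). scale (class_residue n f CE NE b) (representative z))"
  have F_of: "F (frag_of (b, z)) = scale (class_residue n f CE NE b) (representative z)" for b z
    by (simp add: F_def)
  have F_diff: "F (x - y) = F x - F y" for x y by (simp add: F_def frag_extend_diff)
  have res: "class_residue n f CE NE (coset NE x) = residue n f x" if "x \<in> CE" for x
    by (rule class_residue_coset[OF f f0 add_subgroup_NE subset_refl subset_refl that])
  note rel = add_subgroup_closed[OF Mf.add_subgroup_Rel]
  have "F (frag_of (delta n f, \<iota> m)) \<in> Mf.Rel"
  proof (rule E.Rel_image[OF Mf.add_subgroup_Rel F_diff])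
    show "frag_of (delta n f, \<iota> m) \<in> E.Rel" using 0 by (simp only: E.tensor_eq_0_iff)
  next
    fix b b' z assume "b \<in> carrier (Bf_loc n f)" "b' \<in> carrier (Bf_loc n f)" "z \<in> carrier (Mf_loc n f M)"
    then obtain x y c where *: "x \<in> CE" "b = coset NE x" "y \<in> CE" "b' = coset NE y" "c \<in> Mf.Free" "z = coset Mf.Rel c"
      by (auto simp only: Bf_loc_carrier Mf_loc_carrier)
    have "x + y \<in> CE" using * add_subgroup_add[OF add_subgroup_CE] by blast
    then show "F (frag_of (b \<oplus>\<^bsub>Bf_loc n f\<^esub> b', z)) - F (frag_of (b, z)) - F (frag_of (b', z)) \<in> Mf.Rel"
      using scale_plus[OF residue_closed[OF f f0 *(1)] residue_closed[OF f f0 *(3)] representative(1)[OF *(5)]] *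
      by (simp only: F_of Bf_loc_plus res residue_add[OF f f0])
  next
    fix b z z' assume "b \<in> carrier (Bf_loc n f)" "z \<in> carrier (Mf_loc n f M)" "z' \<in> carrier (Mf_loc n f M)"
    then obtain x c c' where *: "x \<in> CE" "b = coset NE x" "c \<in> Mf.Free" "z = coset Mf.Rel c" "c' \<in> Mf.Free" "z' = coset Mf.Rel c'"
      by (auto simp only: Bf_loc_carrier Mf_loc_carrier)
    have cc': "c + c' \<in> Mf.Free" using * add_subgroup_add[OF add_subgroup_free] by blast
    let ?r = "\<lambda>c. representative (coset Mf.Rel c)"
    have "(?r (c + c') - (c + c')) - (?r c - c) - (?r c' - c') \<in> Mf.Rel"
      by (intro rel(2) representative(2) cc' *)
    then have "?r (c + c') - ?r c - ?r c' \<in> Mf.Rel" by (simp add: algebra_simps)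
    from scale_Rel[OF residue_closed[OF f f0 *(1)] this]
    show "F (frag_of (b, z \<oplus>\<^bsub>Mf_loc n f M\<^esub> z')) - F (frag_of (b, z)) - F (frag_of (b, z')) \<in> Mf.Rel"
      by (simp only: F_of * res Mf_loc_add Mf.T_add scale_diff)
  next
    fix r b z assume "r \<in> carrier (ratfun_ring (loc_f n f))" "b \<in> carrier (Bf_loc n f)" "z \<in> carrier (Mf_loc n f M)"
    then obtain x c where *: "r \<in> loc_f n f" "x \<in> CE" "b = coset NE x" "c \<in> Mf.Free" "z = coset Mf.Rel c"
      by (auto simp only: Bf_loc_carrier Mf_loc_carrier ratfun_ring_carrier)
    let ?r = "\<lambda>c. representative (coset Mf.Rel c)" and ?x = "residue n f x"
    have x: "?x \<in> loc_f n f" by (rule residue_closed[OF f f0 *(2)])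
    have "scale (r * ?x) (?r c) - scale ?x (?r (scale r c)) =
        scale (r * ?x) (?r c - c) - scale ?x (?r (scale r c) - scale r c)"
      by (simp add: scale_diff scale_mult mult.commute)
    also have "\<dots> \<in> Mf.Rel"
      by (intro rel(2) scale_Rel loc_f_facts(2) representative(2) scale_Free * x)
    finally show "F (frag_of (r \<odot>\<^bsub>Bf_loc n f\<^esub> b, z)) - F (frag_of (b, r \<odot>\<^bsub>Mf_loc n f M\<^esub> z)) \<in> Mf.Rel"
      by (simp only: F_of * res Bf_loc_smult Mf_loc_smult CE_mult loc_f_CE residue_mult[OF f f0])
  qed
  then have 1: "scale 1 (representative (\<iota> m)) \<in> Mf.Rel"
    using residue_delta[OF f f0] by (simp add: F_of delta_eq res[OF delta_in_CE])
  have "scale 1 (representative (\<iota> m) - frag_of (m, 1)) \<in> Mf.Rel"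
    unfolding iota_eq by (intro scale_Rel representative(2) frag_Mf_Free m loc_f_facts)
  from rel(2)[OF 1 this] have "frag_of (m, 1) \<in> Mf.Rel" by (simp add: scale_diff scale_of)
  then show ?thesis by (rule Mf_kernel[OF m])
qed

text \<open>By \<open>b \<otimes> (m \<otimes> q) = q b \<otimes> \<iota>(m)\<close> the second factors can be restricted to \<open>\<iota>(m)\<close>, and then the functions
  absorbed by the submodule include all of \<open>K[x,t,f\<^sup>-\<^sup>1,(t f - 1)\<^sup>-\<^sup>1]\<close>.\<close>

lemma E_generates:
  assumes S: "S \<subseteq> carrier E.T" "(\<lambda>m. E.tensor (delta n f) (\<iota> m)) ` carrier M \<subseteq> S"
    and add: "\<And>x y. x \<in> S \<Longrightarrow> y \<in> S \<Longrightarrow> x \<oplus>\<^bsub>E.T\<^esub> y \<in> S"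
    and smult: "\<And>P x. P \<in> W (Suc n) \<Longrightarrow> x \<in> S \<Longrightarrow> P \<odot>\<^bsub>E.T\<^esub> x \<in> S"
  shows "S = carrier E.T"
proof -
  have delta_S: "E.tensor (coset NE (delta_fun n f)) z \<in> S" if "z \<in> \<iota> ` carrier M" for z
    using S(2) that by (auto simp: delta_eq)
  have iota_sub: "\<iota> ` carrier M \<subseteq> carrier (Mf_loc n f M)" using iota_closed by auto
  note sub = S(1) add smult iota_sub delta_S
  let ?X = "E.absorbed S (\<iota> ` carrier M)"
  have zero: "\<zero>\<^bsub>E.T\<^esub> \<in> S" by (rule E.zero_in_submodule[OF sub imageI[OF M.M.zero_closed]])
  have "Fraction_Field.Fract 1 (f ^ j) \<in> ?X" for j
    by (rule E.absorbed_Y[OF sub], unfold loc_f_def localization_def) (use pols_one in blast)+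
  then have inv: "Fraction_Field.Fract 1 (f ^ j * tf1 n f ^ k) \<in> ?X" for j k
    using E.absorbed_add[OF sub] E.absorbed_pol[OF sub] E.absorbed_tf1_inverse[OF sub]
    by (intro delta_generates_inverse_f[OF f f0])
  have absorbed: "x \<in> ?X" if x: "x \<in> CE" for x
  proof -
    obtain p j k where "p \<in> pols (Suc n)" "x = Fraction_Field.Fract p (f ^ j * tf1 n f ^ k)"
      using x unfolding loc_f_tf1_def localization_def by blast
    then show ?thesis using E.absorbed_pol[OF sub _ inv[of j k], of p] by simp
  qed
  show ?thesis
  proof (rule E.tensor_span[OF S(1) _ zero add smult])
    fix b z assume b: "b \<in> carrier (Bf_loc n f)" and z: "z \<in> carrier (Mf_loc n f M)"
    obtain c where c: "keys c \<subseteq> carrier M \<times> loc_f n f" "z = coset Mf.Rel c" using z by (auto simp: Mf_loc_carrier)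
    have zc: "coset Mf.Rel c \<in> carrier (Mf_loc n f M)" if "keys c \<subseteq> carrier M \<times> loc_f n f" for c
      using that by (simp add: Mf_loc_carrier)
    obtain x where x: "x \<in> CE" "b = coset NE x" using b by (auto simp: Bf_loc_carrier)
    show "E.tensor b z \<in> S" unfolding c(2) using c(1)
    proof (rule free_Abelian_group_induct)
      show "E.tensor b (coset Mf.Rel 0) \<in> S"
        using zero zc[of 0] by (subst E.tensor_zero_right[OF b]) (simp_all add: Mf_loc_add Mf.T_add)
      fix v w assume vw: "keys v \<subseteq> carrier M \<times> loc_f n f" "keys w \<subseteq> carrier M \<times> loc_f n f"
        "E.tensor b (coset Mf.Rel v) \<in> S" "E.tensor b (coset Mf.Rel w) \<in> S"
      have d: "keys (v - w) \<subseteq> carrier M \<times> loc_f n f"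
        using add_subgroup_diff[OF add_subgroup_free] vw by blast
      have "E.tensor b (coset Mf.Rel (v - w)) \<oplus>\<^bsub>E.T\<^esub> E.tensor b (coset Mf.Rel w) = E.tensor b (coset Mf.Rel v)"
        using E.tensor_add_right[OF b zc[OF d] zc[OF vw(2)]] by (simp add: Mf_loc_add Mf.T_add)
      then show "E.tensor b (coset Mf.Rel (v - w)) \<in> S"
        using weyl_submodule_cancel[OF E.left_module_T S(1) _ _ E.tensor_closed[OF b zc[OF d]] _ vw(4)] add smult vw(3)
        by simp
    next
      fix y assume "y \<in> carrier M \<times> loc_f n f"
      then obtain m q where y: "y = (m, q)" "m \<in> carrier M" "q \<in> loc_f n f" by auto
      have "E.tensor b (coset Mf.Rel (frag_of y)) = E.tensor b (q \<odot>\<^bsub>Mf_loc n f M\<^esub> \<iota> m)"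
        using y by (simp add: iota_eq Mf_loc_smult scale_of)
      also have "\<dots> = E.tensor (coset NE (q * x)) (\<iota> m)"
        using E.tensor_smult[of q b "\<iota> m"] y x b iota_closed by (simp add: Bf_loc_smult)
      also have "\<dots> \<in> S"
        using absorbed[OF CE_mult[OF loc_f_CE[OF y(3)] x(1)]] y(2) by (simp add: E.absorbed_def)
      finally show "E.tensor b (coset Mf.Rel (frag_of y)) \<in> S" .
    qed
  qed
qed

sublocale E_delta: delta_embedding n f M E.T "\<lambda>m. E.tensor (delta n f) (\<iota> m)"
proof (intro delta_embedding.intro M E.left_module_T f)
  fix m assume m: "m \<in> carrier M"
  show "E.tensor (delta n f) (\<iota> m) \<in> carrier E.T"
    unfolding delta_eq by (rule E.tensor_closed[OF E.delta_class_closed iota_closed[OF m]])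
  show "E.tensor (delta n f) (\<iota> (m \<oplus>\<^bsub>M\<^esub> m')) = E.tensor (delta n f) (\<iota> m) \<oplus>\<^bsub>E.T\<^esub> E.tensor (delta n f) (\<iota> m')"
    if "m' \<in> carrier M" for m'
    unfolding delta_eq iota_add[OF m that] by (rule E.tensor_add_right[OF E.delta_class_closed iota_closed[OF m] iota_closed[OF that]])
  show "weyl_pol (tf1 n f) \<odot>\<^bsub>E.T\<^esub> E.tensor (delta n f) (\<iota> m) = \<zero>\<^bsub>E.T\<^esub>"
    unfolding delta_eq by (rule E.tf1_delta_tensor[OF iota_closed[OF m]])
  show "theta n f i \<odot>\<^bsub>E.T\<^esub> E.tensor (delta n f) (\<iota> m) = E.tensor (delta n f) (\<iota> (weyl_del i \<odot>\<^bsub>M\<^esub> m))"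
    if i: "i < n" for i
    using E.theta_delta_tensor[OF i iota_closed[OF m]] iota_del[OF i m] by (simp add: delta_eq Mf_weyl_eq)
next
  fix S assume "S \<subseteq> carrier E.T" "(\<lambda>m. E.tensor (delta n f) (\<iota> m)) ` carrier M \<subseteq> S"
    "\<And>x y. x \<in> S \<Longrightarrow> y \<in> S \<Longrightarrow> x \<oplus>\<^bsub>E.T\<^esub> y \<in> S" "\<And>P x. P \<in> W (Suc n) \<Longrightarrow> x \<in> S \<Longrightarrow> P \<odot>\<^bsub>E.T\<^esub> x \<in> S"
  then show "S = carrier E.T" by (rule E_generates)
qed (rule E_pol E_kernel; assumption)+

subsection \<open>\<open>B\<^sub>Z\<^sub>|\<^sub>Y \<otimes> M\<close>\<close>

text \<open>A constant rather than an abbreviation, so that simplification leaves the set of denominators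
  alone.\<close>

definition CF :: "'k ratfun set" where "CF = localization (Suc n) {tf1 n f ^ k |k. True}"
abbreviation NF where "NF \<equiv> localization (Suc n) {1 :: 'k mpol}"

lemma NF_sub: "{1} \<subseteq> {tf1 n f ^ k |k. True}"
  by (auto intro: exI[of _ 0])

lemma CF_CE: "CF \<subseteq> CE"
  unfolding loc_f_tf1_def CF_def by (rule localization_mono) (force intro: exI[of _ 0])

lemma NF_NE: "NF \<subseteq> NE"
  unfolding loc_f_def by (rule localization_mono) (auto intro: exI[of _ 0])

lemma ops_F: "weyl_operators (Suc n) CF NF (\<lambda>p x. rat p * x) rdiff"
  unfolding CF_def by (rule weyl_operators_ratfun[OF ms(3,5) NF_sub])

lemma B_mod_eq: "B_mod n f = quot_module (ratfun_weyl_module CF) NF"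
  by (simp only: B_mod_def CF_def)

lemmas B_facts = ratfun_quot_facts[OF ops_F, folded B_mod_eq]

lemma delta_in_CF: "delta_fun n f \<in> CF"
  unfolding CF_def localization_def using f by (fastforce intro: pols_mono exI[of _ 1])

lemmas CF_mult = localization_mult[OF ms(3), folded CF_def]
  and CF_rat = localization_rat[OF ms(3), folded CF_def] and NF_rat = localization_rat[OF ms(5)]
  and add_subgroup_CF = add_subgroup_localization[OF ms(3), folded CF_def]
  and add_subgroup_NF = add_subgroup_localization[OF ms(5)]

sublocale F: delta_tensor n "pol_ring n" "pol_module (B_mod n f)" "pol_module M" "B_mod n f" M pdiff f CF NF
proof (intro delta_tensor.intro delta_tensor_axioms.intro f ops_F delta_in_CF NF_rat B_mod_eq leibniz_tensor.intro tensor_pair.intro leibniz_tensor_axioms.intro)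
  show "left_module (weyl_algebra (Suc n)) (B_mod n f)" by (rule B_facts(1))
  interpret B: left_module "weyl_algebra (Suc n)" "B_mod n f" by (rule B_facts(1))
  have pols: "p \<in> pols (Suc n)" if "p \<in> pols n" for p :: "'k mpol" using that by (rule pols_mono) simp
  fix b assume b: "b \<in> carrier (pol_module (B_mod n f))"
  show "b \<oplus>\<^bsub>pol_module (B_mod n f)\<^esub> b' \<in> carrier (pol_module (B_mod n f))"
    if "b' \<in> carrier (pol_module (B_mod n f))" for b' using b that by simp
  fix p :: "'k mpol" assume "p \<in> carrier (pol_ring n)"
  then have p: "p \<in> pols n" by simp
  show "p \<odot>\<^bsub>pol_module (B_mod n f)\<^esub> b \<in> carrier (pol_module (B_mod n f))"
    using b p pols by (simp add: B.smult_closed)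
  show "weyl_pol q \<odot>\<^bsub>B_mod n f\<^esub> (p \<odot>\<^bsub>pol_module (B_mod n f)\<^esub> b) = p \<odot>\<^bsub>pol_module (B_mod n f)\<^esub> (weyl_pol q \<odot>\<^bsub>B_mod n f\<^esub> b)"
    if "q \<in> pols (Suc n)" for q
    using b that pols[OF p] by (simp add: weyl_module_relations(1)[OF B_facts(1)] mult.commute)
  have del: "weyl_del i \<odot>\<^bsub>B_mod n f\<^esub> (weyl_pol p \<odot>\<^bsub>B_mod n f\<^esub> b) =
      weyl_pol p \<odot>\<^bsub>B_mod n f\<^esub> (weyl_del i \<odot>\<^bsub>B_mod n f\<^esub> b) \<oplus>\<^bsub>B_mod n f\<^esub> weyl_pol (pdiff i p) \<odot>\<^bsub>B_mod n f\<^esub> b"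
    if "i < Suc n" for i
    using b pols[OF p] by (intro weyl_module_relations(2)[OF B_facts(1)] that) simp_all
  show "weyl_del i \<odot>\<^bsub>B_mod n f\<^esub> (p \<odot>\<^bsub>pol_module (B_mod n f)\<^esub> b) =
      p \<odot>\<^bsub>pol_module (B_mod n f)\<^esub> (weyl_del i \<odot>\<^bsub>B_mod n f\<^esub> b) \<oplus>\<^bsub>pol_module (B_mod n f)\<^esub> pdiff i p \<odot>\<^bsub>pol_module (B_mod n f)\<^esub> b"
    if "i < n" for i using del[of i] that by simp
  show "weyl_del i \<odot>\<^bsub>B_mod n f\<^esub> (p \<odot>\<^bsub>pol_module (B_mod n f)\<^esub> b) = p \<odot>\<^bsub>pol_module (B_mod n f)\<^esub> (weyl_del i \<odot>\<^bsub>B_mod n f\<^esub> b)"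
    if "n \<le> i" "i < Suc n" for i
    using del[OF that(2)] pols_pdiff_eq_0[OF p that(1)] b that B.smult_zero_left[of b]
      B.smult_closed[of "weyl_pol p" "weyl_del i \<odot>\<^bsub>B_mod n f\<^esub> b"] B.smult_closed[of "weyl_del i" b] pols[OF p]
    by (simp add: weyl_algebra_simps)
qed (simp_all add: M.smult_closed M.smult_r_distr M_relations pols_pdiff)

lemma B_tensor_M_eq: "B_tensor_M n f M = F.T"
  by (simp add: B_tensor_M_def)

text \<open>Here \<open>b \<otimes> m \<mapsto> m \<otimes> res(b)\<close> maps the tensor product to \<open>M[f\<^sup>-\<^sup>1]\<close>, so the residue again reduces the
  claim to the kernel of \<open>\<iota>\<close>.\<close>

lemma F_kernel:
  assumes m: "m \<in> carrier M" and 0: "F.tensor F.delta_class m = \<zero>\<^bsub>F.T\<^esub>"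
  shows "\<exists>k. weyl_pol (f ^ k) \<odot>\<^bsub>M\<^esub> m = \<zero>\<^bsub>M\<^esub>"
proof -
  define F where "F = frag_extend (\<lambda>(b, m :: 'm). frag_of (m, class_residue n f CF NF b))"
  have F_of: "F (frag_of (b, m)) = frag_of (m, class_residue n f CF NF b)" for b m
    by (simp add: F_def)
  have F_diff: "F (x - y) = F x - F y" for x y by (simp add: F_def frag_extend_diff)
  have res: "class_residue n f CF NF (coset NF x) = residue n f x" if "x \<in> CF" for x
    by (rule class_residue_coset[OF f f0 add_subgroup_NF NF_NE CF_CE that])
  have closed: "residue n f x \<in> loc_f n f" if "x \<in> CF" for x
    using residue_closed[OF f f0] CF_CE that by blast
  have "F (frag_of (F.delta_class, m)) \<in> Mf.Rel"
  proof (rule F.Rel_image[OF Mf.add_subgroup_Rel F_diff])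
    show "frag_of (F.delta_class, m) \<in> F.Rel" using 0 by (simp only: F.tensor_eq_0_iff)
  next
    fix b b' a assume "b \<in> carrier (pol_module (B_mod n f))" "b' \<in> carrier (pol_module (B_mod n f))" "a \<in> carrier (pol_module M)"
    then obtain x y where *: "x \<in> CF" "b = coset NF x" "y \<in> CF" "b' = coset NF y" "a \<in> carrier M"
      by (auto simp: B_facts(2))
    have xy: "x + y \<in> CF" using * add_subgroup_add[OF add_subgroup_CF] by blast
    have "residue n f (x + y) = residue n f x + residue n f y"
      using * CF_CE by (intro residue_add[OF f f0]) auto
    then show "F (frag_of (b \<oplus>\<^bsub>pol_module (B_mod n f)\<^esub> b', a)) - F (frag_of (b, a)) - F (frag_of (b', a)) \<in> Mf.Rel"
      using Mf.Rel_right[of a "residue n f x" "residue n f y"] closed * xy by (simp add: F_of B_facts(4) res)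
  next
    fix b a a' assume "b \<in> carrier (pol_module (B_mod n f))" "a \<in> carrier (pol_module M)" "a' \<in> carrier (pol_module M)"
    then obtain x where *: "x \<in> CF" "b = coset NF x" "a \<in> carrier M" "a' \<in> carrier M" by (auto simp: B_facts(2))
    then show "F (frag_of (b, a \<oplus>\<^bsub>pol_module M\<^esub> a')) - F (frag_of (b, a)) - F (frag_of (b, a')) \<in> Mf.Rel"
      using Mf.Rel_left[of a a' "residue n f x"] closed by (simp add: F_of res)
  next
    fix p :: "'k mpol" and b a assume "p \<in> carrier (pol_ring n)" "b \<in> carrier (pol_module (B_mod n f))" "a \<in> carrier (pol_module M)"
    then obtain x where *: "p \<in> pols n" "x \<in> CF" "b = coset NF x" "a \<in> carrier M" by (auto simp: B_facts(2))
    have p: "p \<in> pols (Suc n)" using *(1) by (rule pols_mono) simp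
    have px: "rat p * x \<in> CF" by (intro CF_mult CF_rat p *)
    have "residue n f (rat p * x) = rat p * residue n f x"
      using * CF_CE by (intro residue_mult[OF f f0] loc_f_facts(4)) auto
    then have "F (frag_of (p \<odot>\<^bsub>pol_module (B_mod n f)\<^esub> b, a)) = frag_of (a, rat p * residue n f x)"
      using * by (simp only: F_of restrict_scalars_simps B_facts(5)[OF p] res[OF px])
    moreover have "F (frag_of (b, p \<odot>\<^bsub>pol_module M\<^esub> a)) = frag_of (weyl_pol p \<odot>\<^bsub>M\<^esub> a, residue n f x)"
      using * by (simp only: F_of restrict_scalars_simps res)
    moreover have "frag_of (weyl_pol p \<odot>\<^bsub>M\<^esub> a, residue n f x) - frag_of (a, rat p * residue n f x) \<in> Mf.Rel"
      using Mf.Rel_smult[of p a "residue n f x"] closed *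
      by (simp only: restrict_scalars_simps ratfun_weyl_module_smult ratfun_weyl_module_simps(1) pol_ring_carrier)
    from add_subgroup_minus[OF Mf.add_subgroup_Rel this]
    have "frag_of (a, rat p * residue n f x) - frag_of (weyl_pol p \<odot>\<^bsub>M\<^esub> a, residue n f x) \<in> Mf.Rel" by simp
    ultimately show "F (frag_of (p \<odot>\<^bsub>pol_module (B_mod n f)\<^esub> b, a)) - F (frag_of (b, p \<odot>\<^bsub>pol_module M\<^esub> a)) \<in> Mf.Rel"
      by simp
  qed
  then have "frag_of (m, 1) \<in> Mf.Rel"
    using residue_delta[OF f f0] by (simp add: F_of res[OF delta_in_CF])
  then show ?thesis by (rule Mf_kernel[OF m])
qed

lemma F_generates:
  assumes S: "S \<subseteq> carrier F.T" "(\<lambda>m. F.tensor F.delta_class m) ` carrier M \<subseteq> S"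
    and add: "\<And>x y. x \<in> S \<Longrightarrow> y \<in> S \<Longrightarrow> x \<oplus>\<^bsub>F.T\<^esub> y \<in> S"
    and smult: "\<And>P x. P \<in> W (Suc n) \<Longrightarrow> x \<in> S \<Longrightarrow> P \<odot>\<^bsub>F.T\<^esub> x \<in> S"
  shows "S = carrier F.T"
proof -
  have delta_S: "F.tensor F.delta_class m \<in> S" if "m \<in> carrier M" for m using S(2) that by auto
  have M_sub: "carrier M \<subseteq> carrier (pol_module M)" by simp
  note sub = S(1) add smult M_sub delta_S
  have zero: "\<zero>\<^bsub>F.T\<^esub> \<in> S" by (rule F.zero_in_submodule[OF sub M.M.zero_closed])
  have absorbed: "x \<in> F.absorbed S (carrier M)" if x: "x \<in> CF" for x
  proof -
    obtain p k where "p \<in> pols (Suc n)" "x = Fraction_Field.Fract p (tf1 n f ^ k)"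
      using x unfolding CF_def localization_def by blast
    then show ?thesis using F.absorbed_pol[OF sub _ F.absorbed_tf1_inverse[OF sub, of k], of p] by simp
  qed
  show ?thesis
  proof (rule F.tensor_span[OF S(1) _ zero add smult])
    fix b m assume "b \<in> carrier (pol_module (B_mod n f))" "m \<in> carrier (pol_module M)"
    then show "F.tensor b m \<in> S" using absorbed by (auto simp: B_facts(2) F.absorbed_def)
  qed
qed

sublocale F_delta: delta_embedding n f M F.T "\<lambda>m. F.tensor F.delta_class m"
proof (intro delta_embedding.intro M F.left_module_T f)
  fix m assume m: "m \<in> carrier M"
  then have m': "m \<in> carrier (pol_module M)" by simp
  show "F.tensor F.delta_class m \<in> carrier F.T" by (rule F.tensor_closed[OF F.delta_class_closed m'])
  show "F.tensor F.delta_class (m \<oplus>\<^bsub>M\<^esub> m'') = F.tensor F.delta_class m \<oplus>\<^bsub>F.T\<^esub> F.tensor F.delta_class m''" if "m'' \<in> carrier M" for m''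
    using F.tensor_add_right[OF F.delta_class_closed m', of m''] that by simp
  show "weyl_pol p \<odot>\<^bsub>F.T\<^esub> F.tensor F.delta_class m = F.tensor F.delta_class (weyl_pol p \<odot>\<^bsub>M\<^esub> m)" if "p \<in> pols n" for p
    using F.tensor_pol[OF pols_mono[OF that] F.delta_class_closed m'] F.tensor_smult[OF _ F.delta_class_closed m', of p] that by simp
  show "theta n f i \<odot>\<^bsub>F.T\<^esub> F.tensor F.delta_class m = F.tensor F.delta_class (weyl_del i \<odot>\<^bsub>M\<^esub> m)"
    if "i < n" for i by (rule F.theta_delta_tensor[OF that m'])
  show "weyl_pol (tf1 n f) \<odot>\<^bsub>F.T\<^esub> F.tensor F.delta_class m = \<zero>\<^bsub>F.T\<^esub>" by (rule F.tf1_delta_tensor[OF m'])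
next
  fix S assume "S \<subseteq> carrier F.T" "(\<lambda>m. F.tensor F.delta_class m) ` carrier M \<subseteq> S"
    "\<And>x y. x \<in> S \<Longrightarrow> y \<in> S \<Longrightarrow> x \<oplus>\<^bsub>F.T\<^esub> y \<in> S" "\<And>P x. P \<in> W (Suc n) \<Longrightarrow> x \<in> S \<Longrightarrow> P \<odot>\<^bsub>F.T\<^esub> x \<in> S"
  then show "S = carrier F.T" by (rule F_generates)
qed (rule F_kernel; assumption)+

end

theorem theorem2p11:
  fixes n :: nat
    and f :: "'k::field_char_0 mpol"
    and M :: "('k weyl, 'm) module"
    and u :: 'm
    and G :: "'k weyl set"
  assumes "left_module (weyl_algebra n) M"
    and "u \<in> carrier M"
    and "carrier M = cyclic_submodule (weyl_algebra n) M u"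
    and "f \<in> pols n" and "f \<noteq> 0"
    and "finite G" and "G \<subseteq> carrier (weyl_algebra n)"
    and "gen_left_ideal (weyl_algebra n) G = annihilator (weyl_algebra n) M u"
  shows "J_ideal n f G =
        annihilator (weyl_algebra (Suc n)) (Bf_tensor_Mf n f M) (delta_tensor_iota n f M u)
    \<and> carrier (Bf_tensor_Mf n f M) =
        cyclic_submodule (weyl_algebra (Suc n)) (Bf_tensor_Mf n f M) (delta_tensor_iota n f M u)
    \<and> left_module_iso (weyl_algebra (Suc n)) (B_tensor_M n f M)
        (quot_module (regular_module (weyl_algebra (Suc n))) (J_ideal n f G)) \<noteq> {}"
proof -
  interpret localized_module n f M by (intro localized_module.intro assms)
  have delta_iota: "delta_tensor_iota n f M u = E.tensor (delta n f) (\<iota> u)"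
    by (simp add: delta_tensor_iota_def)
  note gens = assms(2,3,7,8)
  have "left_module_iso (weyl_algebra (Suc n)) F.T
      (quot_module (regular_module (weyl_algebra (Suc n))) (J_ideal n f G)) \<noteq> {}"
    unfolding F_delta.J_eq_annihilator[OF gens]
    by (rule F_delta.E.cyclic_iso_quotient[OF F_delta.e_closed[OF assms(2)] F_delta.E_cyclic[OF gens]])
  then show ?thesis
    using E_delta.J_eq_annihilator[OF gens] E_delta.E_cyclic[OF gens]
    unfolding delta_iota Bf_tensor_Mf_eq B_tensor_M_eq by blast
qed

end
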